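(* Let $\Lambda\subset\ell^\infty(\mathbb C)$ be open and let $\mathcal P_\Lambda$ be an analytic family of bounded polynomial sequences over $\Lambda$ which is either monic or globally analytically conjugate to a monic analytic family. Let $\lambda_0\in\mathcal{HC}_\Lambda$, with $\lambda_0$ belonging to the hyperbolic component $\Omega\subset\Lambda$ in parameter space. Then: (1) The holomorphic motion $\psi_{\lambda;m}\circ\phi_{\lambda_0;m}$, $\lambda\in\Omega$, of the iterated basins of infinity extends, via the landing points of external rays, to a holomorphic motion of the sets $\mathcal A_{\lambda_0;\infty,m}\cup\mathcal J_{\lambda_0;m}$ over $\Omega$ onto the sets $\mathcal A_{\lambda;\infty,m}\cup\mathcal J_{\lambda;m}$, and its restriction to the iterated Julia sets coincides with a uniquely defined extension to all of $\Omega$ of the locally defined conjugating holomorphic motion $\tau_{\lambda;m}$ of the iterated Julia sets, which is initially defined for $\lambda$ in a neighbourhood of $\lambda_0$. In particular, $\tau_{\lambda;m}$ can be extended in a unique fashion from a neighbourhood of $\lambda_0$ to all of $\Omega$. (2) Let $p\in\mathcal J_{\lambda_0;0}$ be such that for each $m\ge0$ the $N$ external rays $R_{\lambda_0;\theta^{1,m},m},R_{\lambda_0;\theta^{2,m},m},\dots,R_{\lambda_0;\theta^{N,m},m}$ (and no others) meet (land) at $p_m=Q_{\lambda_0;m}(p)$. Then, for each $m\ge0$ and $\lambda\in\Omega$, the $N$ external rays $R_{\lambda;\theta^{1,m},m},R_{\lambda;\theta^{2,m},m},\dots,R_{\lambda;\theta^{N,m},m}$ with these same angles, and no other rays, meet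 at $\tau_{\lambda;m}(p_m)$.
   Context: Bounded sequences. Let $d\ge2$, $K\ge1$, $M\ge0$. A sequence $\{P_m\}_{m=1}^\infty$ of complex polynomials $P_m(z)=a_{d_m,m}z^{d_m}+\dots+a_{0,m}$ is a bounded (polynomial) sequence with bounds $d,K,M$ if for all $m\ge1$: $2\le d_m=\deg P_m\le d$, $1/K\le|a_{d_m,m}|\le K$, and $|a_{n,m}|\le M$ for $0\le n<d_m$. For $0\le m\le n$, $Q_{m,n}=P_n\circ\cdots\circ P_{m+1}$ ($Q_{m,m}=\mathrm{Id}$), and $Q_m=Q_{0,m}$. For $m\ge0$: $\mathcal K_m=\{z\in\mathbb C:\limsup_n|Q_{m,n}(z)|<\infty\}$; $\mathcal A_{\infty,m}=\{z:|Q_{m,n}(z)|\to\infty\text{ as }n\to\infty\}$ (iterated basin of infinity), regarded as a subset of $\overline{\mathbb C}$ containing $\infty$; $\mathcal J_m=\partial\mathcal K_m=\partial\mathcal A_{\infty,m}$ (iterated Julia set). With a parameter $\lambda$ a subscript $\lambda$ is added. A bounded sequence is hyperbolic if there are $C>0$, $\mu>1$ with $|Q_{m,m+i}'(z)|\ge C\mu^i$ for all $i,m\ge0$, $z\in\mathcal J_m$. Analytic families. For $\Lambda\subset\ell^\infty(\mathbb C)$ open, $\mathcal P_\Lambda=\{\{P_{\lambda;m}\}_{m=1}^\infty:\lambda\in\Lambda\}$ is an analytic family over $\Lambda$ if (1) each $\{P_{\lambda;m}\}$ is a bounded polynomial sequence, with bounds locally uniform on $\Lambda$; (2) the coefficients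 are Fréchet-differentiable (complex sense) in $\lambda$ with Fréchet differentials locally uniformly bounded on $\Lambda$. The family is monic if all its polynomials are. $\mathcal{HC}_\Lambda$ is the set of $\lambda\in\Lambda$ for which all $\mathcal J_{\lambda;m}$, $m\ge0$, are connected and $\{P_{\lambda;m}\}$ is hyperbolic. Hyperbolicity is an open condition on $\lambda$; a hyperbolic component is a connected component of the set of $\lambda\in\Lambda$ for which $\{P_{\lambda;m}\}$ is hyperbolic. Two analytic families $\mathcal P_\Lambda,\tilde{\mathcal P}_\Lambda$ over the same $\Lambda$ are globally analytically conjugate if there are affine maps $\chi_{\lambda;m}(z)=\alpha_m(\lambda)z+\beta_m(\lambda)$, $m\ge0$, with coefficients Fréchet-holomorphic in $\lambda\in\Lambda$, $|\alpha_m(\lambda)|$ locally uniformly bounded above and below away from $0$ and $|\beta_m(\lambda)|$ locally uniformly bounded above on $\Lambda$, such that $\chi_{\lambda;m}\circ P_{\lambda;m}=\tilde P_{\lambda;m}\circ\chi_{\lambda;m-1}$ for all $m\ge1$, $\lambda\in\Lambda$. Böttcher maps and rays. For a monic family and $\lambda\in\Omega$, the Böttcher maps are the conformal bijections $\phi_{\lambda;m}:\mathcal A_{\lambda;\infty,m}\to\overline{\mathbb C}\setminus\overline{\mathbb D}$, $m\ge0$, with $\phi_{\lambda;m+1}\circ P_{\lambda;m+1}=(\phi_{\lambda;m})^{d_{m+1}}$ and $\phi_{\lambda;m}(z)/z\to1$ as $z\to\infty$ (these exist and are unique). For a family globally analytically conjugate to a monic one, they are the normalized maps of the monic family precomposed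 with $\chi_{\lambda;m}$. Put $\psi_{\lambda;m}=\phi_{\lambda;m}^{-1}$. The external ray of angle $\theta$ at time $m$ is $R_{\lambda;\theta,m}=\{\psi_{\lambda;m}(Re^{i\theta}):R>1\}$; it lands at $q$ if $\psi_{\lambda;m}(Re^{i\theta})\to q$ as $R\to1^+$; rays meet at $q$ if they land at $q$. Holomorphic motion. Let $X\subseteq\overline{\mathbb C}$ and let $\Lambda'$ be an open ball centred at $\lambda_0$ (or, for motions on a hyperbolic component, an open connected set containing $\lambda_0$) in $\ell^\infty(\mathbb C)$. Maps $\tau_\lambda:X\to\overline{\mathbb C}$, $\lambda\in\Lambda'$, are a holomorphic motion of $X$ if: (i) $\tau_\lambda$ is continuous and injective for each $\lambda$; (ii) $\lambda\mapsto\tau_\lambda(x)$ is Fréchet-holomorphic for each $x$; (iii) $\tau_{\lambda_0}(x)=x$; (iv) there are distinct $x_1,x_2,x_3\in X$ and $r>0$ with $\inf_{\lambda\in\mathrm B(\lambda_0,r')}\mathrm d^\#(\tau_\lambda(x_i),\tau_\lambda(x_j))>0$ for all $0<r'<r$, $i\ne j$, where $\mathrm d^\#$ is the spherical metric and $\mathrm B(\lambda_0,r')$ is the open ball. The local motion $\tau_{\lambda;m}$. By an earlier theorem of Comerford, if $\{P_{\lambda_0;m}\}$ is hyperbolic there is $\epsilon_0>0$ and, for each $m\ge0$, a holomorphic motion $\tau_{\lambda;m}$ of $\mathcal J_{\lambda_0;m}$ over $\mathrm B(\lambda_0,\epsilon_0)\subset\Lambda$ with $\tau_{\lambda;m}(\mathcal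 J_{\lambda_0;m})=\mathcal J_{\lambda;m}$, $\tau_{\lambda_0;m}=\mathrm{Id}$ and $\tau_{\lambda;m+1}\circ P_{\lambda_0;m+1}=P_{\lambda;m+1}\circ\tau_{\lambda;m}$ on $\mathcal J_{\lambda_0;m}$ for every $m\ge0$ and $\lambda\in\mathrm B(\lambda_0,\epsilon_0)$; $\tau_{\lambda;m}$ in the claim is this motion and its extension to $\Omega$ is as a holomorphic motion satisfying the same relations. *)

theory Defs
  imports "HOL-Complex_Analysis.Complex_Analysis"
begin

section \<open>The parameter space and complex Frechet differentiability\<close>

text \<open>Since \<open>nat\<close> carries the discrete topology, the bounded continuous functions on it are
  exactly the bounded complex sequences, with the supremum norm. The library makes this type a real
  Banach space only, so complex scalar multiplication is added here.\<close>

type_synonym linf = "nat \<Rightarrow>\<^sub>C complex"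

definition cscale :: "complex \<Rightarrow> linf \<Rightarrow> linf" where
  "cscale c v = Bcontfun (\<lambda>n. c * apply_bcontfun v n)"

lemma apply_cscale [simp]: "apply_bcontfun (cscale c v) n = c * apply_bcontfun v n"
proof -
  obtain b where b: "\<And>n. norm (apply_bcontfun v n) \<le> b"
    using bounded_apply_bcontfun[of v] by (auto simp: bounded_iff)
  have "(\<lambda>n. c * apply_bcontfun v n) \<in> bcontfun"
    by (rule bcontfun_normI[where b = "norm c * b"])
      (auto simp: norm_mult intro!: mult_left_mono b)
  then show ?thesis
    unfolding cscale_def by (simp add: Bcontfun_inverse)
qed

definition has_cfrechet_derivative ::
    "(linf \<Rightarrow> complex) \<Rightarrow> (linf \<Rightarrow> complex) \<Rightarrow> linf \<Rightarrow> bool" where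
  "has_cfrechet_derivative f D l \<longleftrightarrow>
     (f has_derivative D) (at l) \<and> (\<forall>c v. D (cscale c v) = c * D v)"

definition cfrechet_differentiable :: "(linf \<Rightarrow> complex) \<Rightarrow> linf \<Rightarrow> bool" where
  "cfrechet_differentiable f l \<longleftrightarrow> (\<exists>D. has_cfrechet_derivative f D l)"

definition frechet_holomorphic_on :: "(linf \<Rightarrow> complex) \<Rightarrow> linf set \<Rightarrow> bool" where
  "frechet_holomorphic_on f U \<longleftrightarrow> (\<forall>l\<in>U. cfrechet_differentiable f l)"


section \<open>The Riemann sphere\<close>

text \<open>\<open>None\<close> is the point at infinity. For a nonconstant polynomial \<open>p\<close>, its extension to the
  sphere is \<open>map_option (poly p)\<close>; the same applies to powers and to affine maps.\<close>

type_synonym csphere = "complex option"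

abbreviation sphere_top :: "csphere topology" where
  "sphere_top \<equiv> Alexandroff_compactification euclidean"

definition sphere_inverse :: "csphere \<Rightarrow> csphere" where
  "sphere_inverse x =
     (case x of None \<Rightarrow> Some 0 | Some z \<Rightarrow> (if z = 0 then None else Some (inverse z)))"

text \<open>The geodesic metric of the unit sphere under stereographic projection.\<close>

fun sphere_dist :: "csphere \<Rightarrow> csphere \<Rightarrow> real" where
  "sphere_dist (Some z) (Some w) =
     2 * arcsin (cmod (z - w) / (sqrt (1 + (cmod z)\<^sup>2) * sqrt (1 + (cmod w)\<^sup>2)))"
| "sphere_dist (Some z) None = 2 * arcsin (1 / sqrt (1 + (cmod z)\<^sup>2))"
| "sphere_dist None (Some w) = 2 * arcsin (1 / sqrt (1 + (cmod w)\<^sup>2))"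
| "sphere_dist None None = 0"

text \<open>Differentiability at a point of a sphere-valued map, read in one of the two standard charts
  \<open>z\<close> and \<open>1/z\<close>; \<open>D\<close> is the notion of differentiability for complex-valued maps.\<close>

definition sphere_valued_differentiable ::
    "(('a::topological_space \<Rightarrow> complex) \<Rightarrow> 'a \<Rightarrow> bool) \<Rightarrow> ('a \<Rightarrow> csphere) \<Rightarrow> 'a \<Rightarrow> bool" where
  "sphere_valued_differentiable D f a \<longleftrightarrow>
     ((\<forall>\<^sub>F x in nhds a. f x \<noteq> None) \<and> D (\<lambda>x. the (f x)) a) \<or>
     ((\<forall>\<^sub>F x in nhds a. f x \<noteq> Some 0) \<and> D (\<lambda>x. the (sphere_inverse (f x))) a)"

definition sphere_frechet_holomorphic_on :: "(linf \<Rightarrow> csphere) \<Rightarrow> linf set \<Rightarrow> bool" where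
  "sphere_frechet_holomorphic_on f U \<longleftrightarrow>
     (\<forall>l\<in>U. sphere_valued_differentiable cfrechet_differentiable f l)"

definition sphere_holomorphic_on :: "(csphere \<Rightarrow> csphere) \<Rightarrow> csphere set \<Rightarrow> bool" where
  "sphere_holomorphic_on f U \<longleftrightarrow>
     (\<forall>x\<in>U. case x of
        Some z \<Rightarrow> sphere_valued_differentiable (\<lambda>g a. g field_differentiable at a)
                    (\<lambda>w. f (Some w)) z
      | None \<Rightarrow> sphere_valued_differentiable (\<lambda>g a. g field_differentiable at a)
                    (\<lambda>w. f (sphere_inverse (Some w))) 0)"

definition conformal_bijection ::
    "(csphere \<Rightarrow> csphere) \<Rightarrow> csphere set \<Rightarrow> csphere set \<Rightarrow> bool" where
  "conformal_bijection f U V \<longleftrightarrow>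
     openin sphere_top U \<and> openin sphere_top V \<and> bij_betw f U V \<and> sphere_holomorphic_on f U"


section \<open>Bounded polynomial sequences\<close>

text \<open>Sequences of polynomials are indexed from 1; the entry at index 0 is never used.\<close>

definition bounded_poly_seq :: "nat \<Rightarrow> real \<Rightarrow> real \<Rightarrow> (nat \<Rightarrow> complex poly) \<Rightarrow> bool" where
  "bounded_poly_seq d K M P \<longleftrightarrow> 2 \<le> d \<and> 1 \<le> K \<and> 0 \<le> M \<and>
     (\<forall>m\<ge>1. 2 \<le> degree (P m) \<and> degree (P m) \<le> d \<and>
        1 / K \<le> cmod (lead_coeff (P m)) \<and> cmod (lead_coeff (P m)) \<le> K \<and>
        (\<forall>n<degree (P m). cmod (coeff (P m) n) \<le> M))"

text \<open>\<open>Q P m n\<close> is the composition of \<open>P (m + 1)\<close> (applied first) up to \<open>P n\<close> (applied last).\<close>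

definition Q :: "(nat \<Rightarrow> complex poly) \<Rightarrow> nat \<Rightarrow> nat \<Rightarrow> complex \<Rightarrow> complex" where
  "Q P m n = fold (\<lambda>k. poly (P k)) [Suc m..<Suc n]"

definition filled_julia :: "(nat \<Rightarrow> complex poly) \<Rightarrow> nat \<Rightarrow> complex set" where
  "filled_julia P m = {z. limsup (\<lambda>n. ereal (cmod (Q P m n z))) < \<infinity>}"

definition julia :: "(nat \<Rightarrow> complex poly) \<Rightarrow> nat \<Rightarrow> complex set" where
  "julia P m = frontier (filled_julia P m)"

definition basin :: "(nat \<Rightarrow> complex poly) \<Rightarrow> nat \<Rightarrow> csphere set" where
  "basin P m =
     insert None (Some ` {z. filterlim (\<lambda>n. cmod (Q P m n z)) at_top sequentially})"

definition hyperbolic :: "(nat \<Rightarrow> complex poly) \<Rightarrow> bool" where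
  "hyperbolic P \<longleftrightarrow> (\<exists>C>0. \<exists>\<mu>>1. \<forall>i m. \<forall>z\<in>julia P m.
     C * \<mu> ^ i \<le> cmod (deriv (Q P m (m + i)) z))"


section \<open>Analytic families\<close>

text \<open>Locally uniform bounds are uniform in the time index \<open>m\<close> as well.\<close>

definition analytic_family :: "linf set \<Rightarrow> (linf \<Rightarrow> nat \<Rightarrow> complex poly) \<Rightarrow> bool" where
  "analytic_family \<Lambda> P \<longleftrightarrow>
     (\<forall>l\<in>\<Lambda>. \<exists>\<delta>>0. \<exists>d K M. \<forall>l'\<in>\<Lambda> \<inter> ball l \<delta>. bounded_poly_seq d K M (P l')) \<and>
     (\<forall>l\<in>\<Lambda>. \<exists>\<delta>>0. \<exists>B. \<forall>l'\<in>\<Lambda> \<inter> ball l \<delta>. \<forall>m\<ge>1. \<forall>n. \<exists>D.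
        has_cfrechet_derivative (\<lambda>l. coeff (P l m) n) D l' \<and> onorm D \<le> B)"

definition monic_family :: "linf set \<Rightarrow> (linf \<Rightarrow> nat \<Rightarrow> complex poly) \<Rightarrow> bool" where
  "monic_family \<Lambda> P \<longleftrightarrow> (\<forall>l\<in>\<Lambda>. \<forall>m\<ge>1. lead_coeff (P l m) = 1)"

definition hyperbolic_parameters ::
    "linf set \<Rightarrow> (linf \<Rightarrow> nat \<Rightarrow> complex poly) \<Rightarrow> linf set" where
  "hyperbolic_parameters \<Lambda> P = {l\<in>\<Lambda>. hyperbolic (P l)}"

definition HC :: "linf set \<Rightarrow> (linf \<Rightarrow> nat \<Rightarrow> complex poly) \<Rightarrow> linf set" where
  "HC \<Lambda> P = {l\<in>\<Lambda>. (\<forall>m. connected (julia (P l) m)) \<and> hyperbolic (P l)}"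

definition hyperbolic_component ::
    "linf set \<Rightarrow> (linf \<Rightarrow> nat \<Rightarrow> complex poly) \<Rightarrow> linf set \<Rightarrow> bool" where
  "hyperbolic_component \<Lambda> P \<Omega> \<longleftrightarrow> \<Omega> \<in> components (hyperbolic_parameters \<Lambda> P)"

definition conjugacy_by ::
    "linf set \<Rightarrow> (nat \<Rightarrow> linf \<Rightarrow> complex) \<Rightarrow> (nat \<Rightarrow> linf \<Rightarrow> complex) \<Rightarrow>
     (linf \<Rightarrow> nat \<Rightarrow> complex poly) \<Rightarrow> (linf \<Rightarrow> nat \<Rightarrow> complex poly) \<Rightarrow> bool" where
  "conjugacy_by \<Lambda> \<alpha> \<beta> P P' \<longleftrightarrow>
     (\<forall>m. frechet_holomorphic_on (\<alpha> m) \<Lambda> \<and> frechet_holomorphic_on (\<beta> m) \<Lambda>) \<and>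
     (\<forall>l\<in>\<Lambda>. \<exists>\<delta>>0. \<exists>a>0. \<exists>b. \<forall>l'\<in>\<Lambda> \<inter> ball l \<delta>. \<forall>m.
        a \<le> cmod (\<alpha> m l') \<and> cmod (\<alpha> m l') \<le> b \<and> cmod (\<beta> m l') \<le> b) \<and>
     (\<forall>l\<in>\<Lambda>. \<forall>m\<ge>1. \<forall>z. \<alpha> m l * poly (P l m) z + \<beta> m l =
        poly (P' l m) (\<alpha> (m - 1) l * z + \<beta> (m - 1) l))"

definition globally_analytically_conjugate ::
    "linf set \<Rightarrow> (linf \<Rightarrow> nat \<Rightarrow> complex poly) \<Rightarrow> (linf \<Rightarrow> nat \<Rightarrow> complex poly) \<Rightarrow> bool" where
  "globally_analytically_conjugate \<Lambda> P P' \<longleftrightarrow> (\<exists>\<alpha> \<beta>. conjugacy_by \<Lambda> \<alpha> \<beta> P P')"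


section \<open>Boettcher maps and external rays\<close>

definition disc_exterior :: "csphere set" where
  "disc_exterior = insert None (Some ` {w. 1 < cmod w})"

definition boettcher_maps ::
    "(nat \<Rightarrow> complex poly) \<Rightarrow> (nat \<Rightarrow> csphere \<Rightarrow> csphere) \<Rightarrow> bool" where
  "boettcher_maps P \<phi> \<longleftrightarrow> (\<forall>m.
     conformal_bijection (\<phi> m) (basin P m) disc_exterior \<and>
     (\<forall>x\<in>basin P m. \<phi> (Suc m) (map_option (poly (P (Suc m))) x) =
        map_option (\<lambda>w. w ^ degree (P (Suc m))) (\<phi> m x)) \<and>
     ((\<lambda>z. the (\<phi> m (Some z)) / z) \<longlongrightarrow> 1) at_infinity)"

text \<open>For a non-monic family the Boettcher maps come from a monic family to which it is conjugate,
  so they depend on the conjugacy; one and the same conjugacy is used for all parameters and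
  times.\<close>

definition boettcher_family ::
    "linf set \<Rightarrow> linf set \<Rightarrow> (linf \<Rightarrow> nat \<Rightarrow> complex poly) \<Rightarrow>
     (linf \<Rightarrow> nat \<Rightarrow> csphere \<Rightarrow> csphere) \<Rightarrow> bool" where
  "boettcher_family \<Lambda> \<Omega> P \<phi> \<longleftrightarrow>
     (monic_family \<Lambda> P \<and> (\<forall>l\<in>\<Omega>. boettcher_maps (P l) (\<phi> l))) \<or>
     (\<exists>P' \<alpha> \<beta> \<phi>'. analytic_family \<Lambda> P' \<and> monic_family \<Lambda> P' \<and> conjugacy_by \<Lambda> \<alpha> \<beta> P P' \<and>
        (\<forall>l\<in>\<Omega>. boettcher_maps (P' l) (\<phi>' l) \<and>
           (\<forall>m. \<forall>x\<in>basin (P l) m.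
              \<phi> l m x = \<phi>' l m (map_option (\<lambda>z. \<alpha> m l * z + \<beta> m l) x))))"

text \<open>In what follows \<open>\<phi>\<close> stands for the Boettcher maps of the single sequence \<open>P\<close>.\<close>

definition boettcher_inv ::
    "(nat \<Rightarrow> complex poly) \<Rightarrow> (nat \<Rightarrow> csphere \<Rightarrow> csphere) \<Rightarrow> nat \<Rightarrow> csphere \<Rightarrow> csphere" where
  "boettcher_inv P \<phi> m = inv_into (basin P m) (\<phi> m)"

definition external_ray ::
    "(nat \<Rightarrow> complex poly) \<Rightarrow> (nat \<Rightarrow> csphere \<Rightarrow> csphere) \<Rightarrow> real \<Rightarrow> nat \<Rightarrow> csphere set" where
  "external_ray P \<phi> \<theta> m = {boettcher_inv P \<phi> m (Some (of_real R * cis \<theta>)) | R. R > 1}"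

definition ray_lands_at ::
    "(nat \<Rightarrow> complex poly) \<Rightarrow> (nat \<Rightarrow> csphere \<Rightarrow> csphere) \<Rightarrow> real \<Rightarrow> nat \<Rightarrow> csphere \<Rightarrow> bool" where
  "ray_lands_at P \<phi> \<theta> m q \<longleftrightarrow>
     limitin sphere_top (\<lambda>R. boettcher_inv P \<phi> m (Some (of_real R * cis \<theta>))) q (at_right 1)"

text \<open>Angles are real numbers, so different angles may give the same ray; hence distinctness and
  \<open>no other rays\<close> are expressed through the rays.\<close>

definition exactly_these_rays_meet_at ::
    "(nat \<Rightarrow> complex poly) \<Rightarrow> (nat \<Rightarrow> csphere \<Rightarrow> csphere) \<Rightarrow> nat \<Rightarrow> nat \<Rightarrow> (nat \<Rightarrow> real) \<Rightarrow>
     csphere \<Rightarrow> bool" where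
  "exactly_these_rays_meet_at P \<phi> m N \<theta> q \<longleftrightarrow>
     inj_on (\<lambda>i. external_ray P \<phi> (\<theta> i) m) {1..N} \<and>
     (\<forall>i\<in>{1..N}. ray_lands_at P \<phi> (\<theta> i) m q) \<and>
     (\<forall>t. ray_lands_at P \<phi> t m q \<longrightarrow>
        (\<exists>i\<in>{1..N}. external_ray P \<phi> t m = external_ray P \<phi> (\<theta> i) m))"


section \<open>Holomorphic motions\<close>

definition holomorphic_motion ::
    "csphere set \<Rightarrow> linf set \<Rightarrow> linf \<Rightarrow> (linf \<Rightarrow> csphere \<Rightarrow> csphere) \<Rightarrow> bool" where
  "holomorphic_motion X \<Lambda>' l0 \<tau> \<longleftrightarrow>
     open \<Lambda>' \<and> connected \<Lambda>' \<and> l0 \<in> \<Lambda>' \<and>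
     (\<forall>l\<in>\<Lambda>'. continuous_map (subtopology sphere_top X) sphere_top (\<tau> l) \<and> inj_on (\<tau> l) X) \<and>
     (\<forall>x\<in>X. sphere_frechet_holomorphic_on (\<lambda>l. \<tau> l x) \<Lambda>') \<and>
     (\<forall>x\<in>X. \<tau> l0 x = x) \<and>
     (\<exists>x1\<in>X. \<exists>x2\<in>X. \<exists>x3\<in>X. x1 \<noteq> x2 \<and> x2 \<noteq> x3 \<and> x1 \<noteq> x3 \<and>
        (\<exists>r>0. ball l0 r \<subseteq> \<Lambda>' \<and> (\<forall>r'. 0 < r' \<and> r' < r \<longrightarrow>
           (\<forall>x\<in>{x1, x2, x3}. \<forall>y\<in>{x1, x2, x3}. x \<noteq> y \<longrightarrow>
              (INF l\<in>ball l0 r'. sphere_dist (\<tau> l x) (\<tau> l y)) > 0))))"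

text \<open>A motion of the iterated Julia sets that conjugates the sequence at \<open>l0\<close> to the one
  at \<open>l\<close>.\<close>

definition conjugating_julia_motion ::
    "(linf \<Rightarrow> nat \<Rightarrow> complex poly) \<Rightarrow> linf set \<Rightarrow> linf \<Rightarrow>
     (linf \<Rightarrow> nat \<Rightarrow> csphere \<Rightarrow> csphere) \<Rightarrow> bool" where
  "conjugating_julia_motion P \<Lambda>' l0 \<tau> \<longleftrightarrow> (\<forall>m.
     holomorphic_motion (Some ` julia (P l0) m) \<Lambda>' l0 (\<lambda>l. \<tau> l m) \<and>
     (\<forall>l\<in>\<Lambda>'. \<tau> l m ` (Some ` julia (P l0) m) = Some ` julia (P l) m \<and>
        (\<forall>x\<in>Some ` julia (P l0) m.
           \<tau> l (Suc m) (map_option (poly (P l0 (Suc m))) x) =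
           map_option (poly (P l (Suc m))) (\<tau> l m x))))"

end

theory Submission
  imports Defs "HOL-Computational_Algebra.Fundamental_Theorem_Algebra"
begin

text \<open>The argument takes place in the coordinate of the exterior of the unit disc. Let \<open>S l m\<close> be the
  inverse of the Boettcher map at time \<open>m\<close> for the parameter \<open>l\<close>, so that the motion of the basins
  is \<open>S l m \<circ> (S l0 m)\<inverse>\<close>.

  Holomorphy in \<open>l\<close>. For a monic family the expansion of \<open>S l m\<close> at infinity has coefficients that
  are polynomials in the coefficients of the given polynomials, by comparison of coefficients in
  \<open>P \<circ> S m = S (m + 1) \<circ> power\<close> (\<open>functional_equation_coeff_holomorphic\<close>). The maximum principle
  bounds \<open>S l m w - w\<close> by a constant that is locally uniform in \<open>l\<close> and uniform in \<open>m\<close>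
  (\<open>exterior_inverse_bound\<close>), so the expansion converges uniformly in \<open>l\<close>
  (\<open>monic_boettcher_inverse_parameter\<close>). An affine conjugacy carries this over to the general case
  (\<open>boettcher_family_inverse\<close>).

  Extension to the Julia sets. For \<open>v \<noteq> w\<close> the function \<open>l \<mapsto> S l m v - S l m w\<close> has no zero and is
  locally bounded, so that Harnack's inequality for the logarithm of its modulus compares its sizes
  at nearby parameters (\<open>disjoint_holomorphic_distortion\<close>). Along the connected \<open>\<Omega>\<close> this makes
  \<open>S l m \<circ> (S l0 m)\<inverse>\<close> uniformly continuous near the Julia set, in both directions
  (\<open>dominated_all\<close>). Hence it extends to a homeomorphism between the closures, which depends
  holomorphically on \<open>l\<close> and which takes the landing point of a ray to the landing point of the ray of
  the same angle. The statements on landing patterns are then immediate.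

  Landing. The basin contains no critical points and \<open>1 / Q'\<close> vanishes at infinity; by the maximum
  principle the expansion on the Julia set holds on the whole basin
  (\<open>deriv_Q_lower_bound_escaping\<close>). Along a ray this makes the increments of \<open>S m\<close> between the
  radii \<open>2 powr (1 / deg m n)\<close> summable, uniformly in the angle (\<open>ray_uniformly_Cauchy\<close>). So all
  rays land, and by compactness of the circle every Julia point is a landing point.

  The component \<open>\<Omega>\<close> is open (\<open>hyperbolic_component_open\<close>): expansion makes the set of
  points at distance at least \<open>\<rho>\<close> from the basin invariant under many steps of a slightly perturbed
  sequence, so perturbed Julia sets stay close to the basin, where the sequence expands.

  Uniqueness. Two conjugating motions give, for each Julia point, two sequences of uniformly bounded
  holomorphic functions of \<open>l\<close> that agree at \<open>l0\<close>; expansion forces their Taylor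
  coefficients at \<open>l0\<close> to agree (\<open>bounded_orbits_unique\<close>), and the identity theorem does the
  rest.\<close>

section \<open>Holomorphic functions of a parameter in a Banach space\<close>

lemma cscale_bounded_linear_left: "bounded_linear (\<lambda>c. cscale c v)"
proof (rule bounded_linear_intro[where K = "norm v"])
  fix x y :: complex and r :: real
  show "cscale (x + y) v = cscale x v + cscale y v"
    by (rule bcontfun_eqI) (simp add: algebra_simps)
  show "cscale (r *\<^sub>R x) v = r *\<^sub>R cscale x v"
    by (rule bcontfun_eqI) (simp add: algebra_simps)
  show "norm (cscale x v) \<le> norm x * norm v"
    by (rule norm_bound) (simp add: norm_mult mult_left_mono norm_bounded)
qed

lemma cscale_0 [simp]: "cscale 0 v = 0" and cscale_1 [simp]: "cscale 1 v = v"
  by (rule bcontfun_eqI; simp)+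

lemma norm_cscale_le: "norm (cscale c v) \<le> norm c * norm v"
  by (rule norm_bound) (simp add: norm_mult mult_left_mono norm_bounded)

lemma cscale_line_has_derivative:
  "((\<lambda>t. l + cscale t v) has_derivative (\<lambda>t. cscale t v)) (at t)"
  using bounded_linear.has_derivative[OF cscale_bounded_linear_left has_derivative_ident]
  by (auto intro!: derivative_eq_intros)

lemma continuous_on_cscale_line: "continuous_on A (\<lambda>t. l + cscale t v)"
  by (intro continuous_at_imp_continuous_on ballI has_derivative_continuous[OF cscale_line_has_derivative])

lemma cfrechet_differentiable_imp_isCont: "cfrechet_differentiable f l \<Longrightarrow> isCont f l"
  unfolding cfrechet_differentiable_def has_cfrechet_derivative_def
  using has_derivative_continuous by blast

lemma has_cfrechet_derivative_along_line:
  assumes "has_cfrechet_derivative f D (l + cscale t v)"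
  shows "((\<lambda>t. f (l + cscale t v)) has_field_derivative D v) (at t)"
proof -
  have "((\<lambda>t. f (l + cscale t v)) has_derivative (\<lambda>s. D (cscale s v))) (at t)"
    using has_derivative_compose[OF cscale_line_has_derivative[of l v t]] assms
    unfolding has_cfrechet_derivative_def by blast
  moreover have "(\<lambda>s. D (cscale s v)) = (*) (D v)"
    using assms unfolding has_cfrechet_derivative_def by (auto simp: mult.commute)
  ultimately show ?thesis
    unfolding has_field_derivative_def by simp
qed

lemma cfrechet_differentiable_along_line:
  assumes "\<And>t. t \<in> T \<Longrightarrow> cfrechet_differentiable f (l + cscale t v)"
  shows "(\<lambda>t. f (l + cscale t v)) holomorphic_on T"
  using assms has_cfrechet_derivative_along_line
  unfolding cfrechet_differentiable_def holomorphic_on_def field_differentiable_def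
  by (metis DERIV_subset subset_UNIV)

lemma cfrechet_differentiable_const [simp]: "cfrechet_differentiable (\<lambda>_. c) l"
  unfolding cfrechet_differentiable_def has_cfrechet_derivative_def
  by (rule exI[where x = "\<lambda>_. 0"]) auto

lemma cfrechet_differentiable_add:
  assumes "cfrechet_differentiable f l" "cfrechet_differentiable g l"
  shows "cfrechet_differentiable (\<lambda>x. f x + g x) l"
proof -
  obtain D E where "has_cfrechet_derivative f D l" "has_cfrechet_derivative g E l"
    using assms unfolding cfrechet_differentiable_def by blast
  then have "has_cfrechet_derivative (\<lambda>x. f x + g x) (\<lambda>h. D h + E h) l"
    unfolding has_cfrechet_derivative_def by (auto simp: algebra_simps intro: has_derivative_add)
  then show ?thesis unfolding cfrechet_differentiable_def by blast
qed

lemma cfrechet_differentiable_mult: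
  assumes "cfrechet_differentiable f l" "cfrechet_differentiable g l"
  shows "cfrechet_differentiable (\<lambda>x. f x * g x) l"
proof -
  obtain D E where "has_cfrechet_derivative f D l" "has_cfrechet_derivative g E l"
    using assms unfolding cfrechet_differentiable_def by blast
  then have "has_cfrechet_derivative (\<lambda>x. f x * g x) (\<lambda>h. f l * E h + D h * g l) l"
    unfolding has_cfrechet_derivative_def
    by (intro conjI has_derivative_mult) (auto simp: algebra_simps)
  then show ?thesis unfolding cfrechet_differentiable_def by blast
qed

lemma cfrechet_differentiable_diff:
  assumes "cfrechet_differentiable f l" "cfrechet_differentiable g l"
  shows "cfrechet_differentiable (\<lambda>x. f x - g x) l"
  using cfrechet_differentiable_add[OF assms(1)
      cfrechet_differentiable_mult[OF cfrechet_differentiable_const[of "-1"] assms(2)]] by simp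

lemma cfrechet_differentiable_sum:
  "(\<And>i. i \<in> I \<Longrightarrow> cfrechet_differentiable (f i) l) \<Longrightarrow>
     cfrechet_differentiable (\<lambda>x. \<Sum>i\<in>I. f i x) l"
  by (induction I rule: infinite_finite_induct) (auto intro: cfrechet_differentiable_add)

lemma cfrechet_differentiable_inverse:
  assumes "cfrechet_differentiable f l" "f l \<noteq> 0"
  shows "cfrechet_differentiable (\<lambda>x. inverse (f x)) l"
proof -
  obtain D where D: "has_cfrechet_derivative f D l"
    using assms unfolding cfrechet_differentiable_def by blast
  then have "has_cfrechet_derivative (\<lambda>x. inverse (f x))
      (\<lambda>h. - (inverse (f l) * D h * inverse (f l))) l"
    using assms(2) unfolding has_cfrechet_derivative_def
    by (intro conjI Deriv.has_derivative_inverse) (auto simp: algebra_simps)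
  then show ?thesis unfolding cfrechet_differentiable_def by blast
qed

lemma cfrechet_differentiable_divide:
  assumes "cfrechet_differentiable f l" "cfrechet_differentiable g l" "g l \<noteq> 0"
  shows "cfrechet_differentiable (\<lambda>x. f x / g x) l"
  unfolding divide_inverse
  using assms by (intro cfrechet_differentiable_mult cfrechet_differentiable_inverse)

lemma cfrechet_differentiable_cong:
  assumes "\<forall>\<^sub>F x in nhds l. f x = g x"
  shows "cfrechet_differentiable f l \<longleftrightarrow> cfrechet_differentiable g l"
proof -
  obtain S where S: "open S" "l \<in> S" "\<And>x. x \<in> S \<Longrightarrow> f x = g x"
    using assms unfolding eventually_nhds by blast
  have "(f has_derivative D) (at l) \<longleftrightarrow> (g has_derivative D) (at l)" for D
  proof
    assume "(f has_derivative D) (at l)"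
    then show "(g has_derivative D) (at l)"
      by (rule has_derivative_transform_within_open[OF _ S])
  next
    assume "(g has_derivative D) (at l)"
    then show "(f has_derivative D) (at l)"
      by (rule has_derivative_transform_within_open[OF _ S(1,2)]) (simp add: S(3))
  qed
  then show ?thesis
    unfolding cfrechet_differentiable_def has_cfrechet_derivative_def by simp
qed

text \<open>Cauchy's inequality on the complex line through the centre in the direction \<open>h\<close>. The loss
  of the factor 2 avoids a limit of radii.\<close>

lemma cfrechet_Cauchy_estimate:
  assumes hol: "\<And>x. x \<in> ball l r \<Longrightarrow> cfrechet_differentiable f x"
    and bd: "\<And>x. x \<in> ball l r \<Longrightarrow> norm (f x) \<le> M" and r: "r > 0"
    and D: "has_cfrechet_derivative f D l"
  shows "norm (D h) \<le> 2 * M / r * norm h"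
proof (cases "h = 0")
  case True
  then show ?thesis
    using D unfolding has_cfrechet_derivative_def by (metis has_derivative_bounded_linear
        linear_simps(3) mult_zero_right norm_zero order_refl)
next
  case False
  define \<rho> where "\<rho> = r / (2 * norm h)"
  have \<rho>: "\<rho> > 0" using False r by (simp add: \<rho>_def)
  let ?g = "\<lambda>t. f (l + cscale t h)"
  have inb: "l + cscale t h \<in> ball l r" if "norm t \<le> \<rho>" for t
  proof -
    have "norm (cscale t h) \<le> norm t * norm h" by (rule norm_cscale_le)
    also have "\<dots> \<le> \<rho> * norm h" using that by (simp add: mult_right_mono)
    also have "\<dots> < r" using False r by (simp add: \<rho>_def)
    finally show ?thesis by (simp add: dist_norm)
  qed
  have hc: "?g holomorphic_on cball 0 \<rho>"
    by (rule cfrechet_differentiable_along_line) (use hol inb in auto)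
  have "norm ((deriv ^^ 1) ?g 0) \<le> fact 1 * M / \<rho> ^ 1"
  proof (rule Cauchy_inequality)
    show "?g holomorphic_on ball 0 \<rho>" using hc by (rule holomorphic_on_subset) auto
    show "continuous_on (cball 0 \<rho>) ?g" using hc holomorphic_on_imp_continuous_on by blast
  qed (use \<rho> bd inb in auto)
  moreover have "deriv ?g 0 = D h"
    by (rule DERIV_imp_deriv, rule has_cfrechet_derivative_along_line) (use D in simp)
  ultimately show ?thesis using False r by (simp add: \<rho>_def field_simps)
qed

text \<open>Weierstrass' theorem: by Cauchy's inequality the differentials converge uniformly along with
  the functions.\<close>

lemma frechet_holomorphic_uniform_limit:
  fixes f :: "nat \<Rightarrow> linf \<Rightarrow> complex"
  assumes hol: "\<And>n. frechet_holomorphic_on (f n) U"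
    and lim: "\<And>l. l \<in> U \<Longrightarrow> \<exists>\<delta>>0. ball l \<delta> \<subseteq> U \<and> uniform_limit (ball l \<delta>) f g sequentially"
  shows "frechet_holomorphic_on g U"
  unfolding frechet_holomorphic_on_def
proof
  fix l assume "l \<in> U"
  then obtain \<delta> where \<delta>: "\<delta> > 0" "ball l \<delta> \<subseteq> U" "uniform_limit (ball l \<delta>) f g sequentially"
    using lim by blast
  define S where "S = ball l (\<delta>/2)"
  have ex: "\<forall>n. \<forall>x. \<exists>D. x \<in> S \<longrightarrow> has_cfrechet_derivative (f n) D x"
  proof (intro allI)
    fix n x
    show "\<exists>D. x \<in> S \<longrightarrow> has_cfrechet_derivative (f n) D x"
    proof (cases "x \<in> S")
      case True
      then have "x \<in> ball l \<delta>" using \<delta>(1) by (simp add: S_def)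
      then have "x \<in> U" using \<delta>(2) by blast
      then show ?thesis
        using hol[of n] unfolding frechet_holomorphic_on_def cfrechet_differentiable_def by blast
    qed simp
  qed
  then obtain D where D: "\<And>n x. x \<in> S \<Longrightarrow> has_cfrechet_derivative (f n) (D n x) x"
    by metis
  have sub: "ball x (\<delta>/2) \<subseteq> ball l \<delta>" if "x \<in> S" for x
  proof
    fix y assume "y \<in> ball x (\<delta>/2)"
    moreover have "dist l y \<le> dist l x + dist x y" by (rule dist_triangle)
    ultimately show "y \<in> ball l \<delta>" using that by (simp add: S_def)
  qed
  have close: "\<exists>N. \<forall>m\<ge>N. \<forall>n\<ge>N. \<forall>x\<in>S. \<forall>h. norm (D m x h - D n x h) \<le> e * norm h"
    if e: "e > 0" for e
  proof -
    have "uniformly_Cauchy_on (ball l \<delta>) f"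
      using \<delta>(3) uniformly_convergent_Cauchy uniformly_convergent_on_def by blast
    then obtain N where N: "\<And>x m n. x \<in> ball l \<delta> \<Longrightarrow> m \<ge> N \<Longrightarrow> n \<ge> N \<Longrightarrow>
        dist (f m x) (f n x) < e * \<delta> / 4"
      unfolding uniformly_Cauchy_on_def using e \<delta>(1)
      by (metis divide_pos_pos mult_pos_pos zero_less_numeral)
    have "norm (D m x h - D n x h) \<le> e * norm h" if mn: "m \<ge> N" "n \<ge> N" and x: "x \<in> S" for m n x h
    proof -
      have der: "has_cfrechet_derivative (\<lambda>y. f m y - f n y) (\<lambda>h. D m x h - D n x h) x"
        using D[OF x, of m] D[OF x, of n] unfolding has_cfrechet_derivative_def
        by (auto intro: has_derivative_diff simp: algebra_simps)
      have "norm (D m x h - D n x h) \<le> 2 * (e * \<delta> / 4) / (\<delta>/2) * norm h"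
      proof (rule cfrechet_Cauchy_estimate[OF _ _ _ der])
        fix y assume y: "y \<in> ball x (\<delta>/2)"
        then have yb: "y \<in> ball l \<delta>" using sub[OF x] by blast
        show "norm (f m y - f n y) \<le> e * \<delta> / 4"
          using N[OF yb mn] by (simp add: dist_norm)
        show "cfrechet_differentiable (\<lambda>y. f m y - f n y) y"
          using yb \<delta>(2) hol unfolding frechet_holomorphic_on_def
          by (blast intro: cfrechet_differentiable_diff)
      qed (use \<delta> in simp)
      then show ?thesis using \<delta>(1) by simp
    qed
    then show ?thesis by blast
  qed
  define G where "G x h = lim (\<lambda>n. D n x h)" for x h
  have G: "(\<lambda>n. D n x h) \<longlonglongrightarrow> G x h" if x: "x \<in> S" for x h
  proof -
    have "Cauchy (\<lambda>n. D n x h)"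
    proof (rule metric_CauchyI)
      fix e :: real assume e: "e > 0"
      have "e / (norm h + 1) > 0" using e by (simp add: add_nonneg_pos)
      from close[OF this] obtain N where N: "\<forall>m\<ge>N. \<forall>n\<ge>N. \<forall>x\<in>S. \<forall>k.
          norm (D m x k - D n x k) \<le> e / (norm h + 1) * norm k" by blast
      have "dist (D m x h) (D n x h) < e" if "m \<ge> N" "n \<ge> N" for m n
      proof -
        have "dist (D m x h) (D n x h) \<le> e / (norm h + 1) * norm h"
          using N that x by (simp add: dist_norm)
        also have "\<dots> = e * (norm h / (norm h + 1))" by simp
        also have "\<dots> < e * 1"
          using e by (intro mult_strict_left_mono) (simp_all add: add_nonneg_pos)
        finally show ?thesis by simp
      qed
      then show "\<exists>M. \<forall>m\<ge>M. \<forall>n\<ge>M. dist (D m x h) (D n x h) < e" by blast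
    qed
    then show ?thesis unfolding G_def by (simp add: Cauchy_convergent_iff convergent_LIMSEQ_iff)
  qed
  have "\<exists>g2. \<forall>x\<in>S. (\<lambda>n. f n x) \<longlonglongrightarrow> g2 x \<and> (g2 has_derivative G x) (at x within S)"
  proof (rule has_derivative_sequence[where f' = D and ?x0.0 = l and l = "g l"])
    show "convex S" by (simp add: S_def)
    show "(f n has_derivative D n x) (at x within S)" if "x \<in> S" for n x
      using D[OF that] unfolding has_cfrechet_derivative_def by (blast intro: has_derivative_at_withinI)
    show "l \<in> S" using \<delta>(1) by (simp add: S_def)
    show "(\<lambda>n. f n l) \<longlonglongrightarrow> g l" using tendsto_uniform_limitI[OF \<delta>(3)] \<delta>(1) by simp
    fix e :: real assume "e > 0"
    then obtain N where N: "\<forall>m\<ge>N. \<forall>n\<ge>N. \<forall>x\<in>S. \<forall>h. norm (D m x h - D n x h) \<le> e * norm h"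
      using close by blast
    have "norm (D n x h - G x h) \<le> e * norm h" if "n \<ge> N" "x \<in> S" for n x h
    proof (rule LIMSEQ_le_const2)
      show "(\<lambda>k. norm (D n x h - D k x h)) \<longlonglongrightarrow> norm (D n x h - G x h)"
        by (intro tendsto_intros G that)
      show "\<exists>M. \<forall>k\<ge>M. norm (D n x h - D k x h) \<le> e * norm h" using N that by blast
    qed
    then show "\<forall>\<^sub>F n in sequentially. \<forall>x\<in>S. \<forall>h. norm (D n x h - G x h) \<le> e * norm h"
      using eventually_sequentially by blast
  qed
  then obtain g2 where g2: "\<And>x. x \<in> S \<Longrightarrow> (\<lambda>n. f n x) \<longlonglongrightarrow> g2 x"
      "\<And>x. x \<in> S \<Longrightarrow> (g2 has_derivative G x) (at x within S)" by blast
  have lS: "l \<in> S" using \<delta>(1) by (simp add: S_def)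
  have eq: "g2 x = g x" if "x \<in> S" for x
  proof (rule LIMSEQ_unique[OF g2(1)[OF that]])
    have "x \<in> ball l \<delta>" using that \<delta>(1) by (simp add: S_def)
    then show "(\<lambda>n. f n x) \<longlonglongrightarrow> g x" using tendsto_uniform_limitI[OF \<delta>(3)] by blast
  qed
  have "(g2 has_derivative G l) (at l)"
    using g2(2)[OF lS] at_within_open[OF lS] by (simp add: S_def)
  then have "(g has_derivative G l) (at l)"
    by (rule has_derivative_transform_within_open[OF _ _ lS]) (use eq in \<open>auto simp: S_def\<close>)
  moreover have "G l (cscale c v) = c * G l v" for c v
  proof (rule LIMSEQ_unique[OF G[OF lS]])
    have "\<And>n. D n l (cscale c v) = c * D n l v"
      using D[OF lS] unfolding has_cfrechet_derivative_def by blast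
    then show "(\<lambda>n. D n l (cscale c v)) \<longlonglongrightarrow> c * G l v"
      using tendsto_mult_left[OF G[OF lS, of v], of c] by simp
  qed
  ultimately show "cfrechet_differentiable g l"
    unfolding cfrechet_differentiable_def has_cfrechet_derivative_def by blast
qed

lemma open_vimage_cscale_line: "open U \<Longrightarrow> open {t. l + cscale t v \<in> U}"
  using open_vimage[of U "\<lambda>t. l + cscale t v", OF _ continuous_on_cscale_line]
  unfolding vimage_def .

text \<open>The complex line through \<open>a\<close> and \<open>l\<close> meets the ball in a convex set, on which the identity
  theorem in one variable applies.\<close>

lemma frechet_identity_ball:
  assumes f: "frechet_holomorphic_on f (ball c r)" and g: "frechet_holomorphic_on g (ball c r)"
    and a: "a \<in> ball c r" and eq: "\<forall>\<^sub>F x in nhds a. f x = g x" and l: "l \<in> ball c r"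
  shows "f l = g l"
proof -
  define T where "T = {t. a + cscale t (l - a) \<in> ball c r}"
  obtain V where V: "open V" "a \<in> V" "\<And>x. x \<in> V \<Longrightarrow> f x = g x"
    using eq unfolding eventually_nhds by blast
  define W where "W = {t. a + cscale t (l - a) \<in> V} \<inter> T"
  have opT: "open T" unfolding T_def by (rule open_vimage_cscale_line) simp
  have cvx: "convex T"
  proof (rule convexI)
    fix s t :: complex and u v :: real
    assume st: "s \<in> T" "t \<in> T" and uv: "0 \<le> u" "0 \<le> v" "u + v = 1"
    have "a + cscale (u *\<^sub>R s + v *\<^sub>R t) (l - a) =
       u *\<^sub>R (a + cscale s (l - a)) + v *\<^sub>R (a + cscale t (l - a))"
    proof (rule bcontfun_eqI)
      fix n
      have "apply_bcontfun a n = of_real u * apply_bcontfun a n + of_real v * apply_bcontfun a n"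
        using uv(3) by (metis distrib_right mult_1 of_real_1 of_real_add)
      then show "apply_bcontfun (a + cscale (u *\<^sub>R s + v *\<^sub>R t) (l - a)) n =
        apply_bcontfun (u *\<^sub>R (a + cscale s (l - a)) + v *\<^sub>R (a + cscale t (l - a))) n"
        by (simp add: scaleR_conv_of_real algebra_simps)
    qed
    moreover have "u *\<^sub>R (a + cscale s (l - a)) + v *\<^sub>R (a + cscale t (l - a)) \<in> ball c r"
      using convexD[OF convex_ball[of c r]] st uv unfolding T_def by blast
    ultimately show "u *\<^sub>R s + v *\<^sub>R t \<in> T" unfolding T_def by simp
  qed
  have "f (a + cscale 1 (l - a)) = g (a + cscale 1 (l - a))"
  proof (rule analytic_continuation_open[where s = W and s' = T and
        f = "\<lambda>t. f (a + cscale t (l - a))" and g = "\<lambda>t. g (a + cscale t (l - a))"])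
    show "open W" unfolding W_def using opT V(1) open_vimage_cscale_line by blast
    have "0 \<in> W" using V(2) a by (simp add: W_def T_def)
    then show "W \<noteq> {}" by blast
    show "connected T" using cvx convex_connected by blast
    show "(\<lambda>t. f (a + cscale t (l - a))) holomorphic_on T"
      "(\<lambda>t. g (a + cscale t (l - a))) holomorphic_on T"
      using f g unfolding frechet_holomorphic_on_def T_def
      by (auto intro!: cfrechet_differentiable_along_line)
    show "1 \<in> T" using l by (simp add: T_def)
  qed (use opT V in \<open>auto simp: W_def\<close>)
  then show ?thesis by simp
qed

lemma frechet_identity_connected:
  assumes U: "open U" "connected U"
    and f: "frechet_holomorphic_on f U" and g: "frechet_holomorphic_on g U"
    and a: "a \<in> U" and eq: "\<forall>\<^sub>F x in nhds a. f x = g x" and l: "l \<in> U"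
  shows "f l = g l"
proof -
  have "\<forall>\<^sub>F x in nhds l. f x = g x"
  proof (rule connected_induction_simple[where P = "\<lambda>c. \<forall>\<^sub>F x in nhds c. f x = g x", OF U(2) a l eq])
    fix c assume "c \<in> U"
    then obtain r where r: "r > 0" "ball c r \<subseteq> U" using U(1) openE by blast
    have fb: "frechet_holomorphic_on f (ball c r)" and gb: "frechet_holomorphic_on g (ball c r)"
      using f g r(2) unfolding frechet_holomorphic_on_def by blast+
    have "\<forall>\<^sub>F z in nhds y. f z = g z"
      if x: "x \<in> ball c r" and y: "y \<in> ball c r" and e: "\<forall>\<^sub>F z in nhds x. f z = g z" for x y
      using eventually_nhds_in_open[OF open_ball y]
      by (rule eventually_mono) (rule frechet_identity_ball[OF fb gb x e])
    moreover have "openin (top_of_set U) (ball c r)" "c \<in> ball c r"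
      using r U(1) by (simp_all add: openin_open_eq)
    ultimately show "\<exists>T. openin (top_of_set U) T \<and> c \<in> T \<and> (\<forall>x\<in>T. \<forall>y\<in>T.
        (\<forall>\<^sub>F x in nhds x. f x = g x) \<longrightarrow> (\<forall>\<^sub>F x in nhds y. f x = g x))"
      by blast
  qed
  then show ?thesis by (rule eventually_nhds_x_imp_x)
qed

text \<open>Harnack's inequality for the positive harmonic function \<open>- ln \<bar>g\<bar>\<close>: the Cayley transform
  based at \<open>h 0\<close> takes \<open>h = - Ln g\<close> from the right half plane to the unit disc, and the Schwarz
  lemma gives \<open>Re h / Re (h 0) \<in> [1/3, 3]\<close> on the disc of radius \<open>1/2\<close>. Exponentiation turns the
  ratio 3 into a third power.\<close>

lemma Harnack_nonvanishing:
  assumes g: "g holomorphic_on ball 0 1"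
    and nz: "\<And>z. z \<in> ball 0 1 \<Longrightarrow> g z \<noteq> 0" and lt: "\<And>z. z \<in> ball 0 1 \<Longrightarrow> norm (g z) < 1"
    and z: "norm z \<le> 1/2"
  shows "norm (g z) ^ 3 \<le> norm (g 0)" "norm (g 0) ^ 3 \<le> norm (g z)"
proof -
  obtain k where k: "k holomorphic_on ball 0 1" "\<And>x. x \<in> ball 0 1 \<Longrightarrow> g x = exp (k x)"
    using contractible_imp_holomorphic_log[OF g convex_imp_contractible[OF convex_ball] nz] by blast
  define h where "h = (\<lambda>x. - k x)"
  have h: "h holomorphic_on ball 0 1" unfolding h_def by (intro holomorphic_intros k)
  have ng: "norm (g x) = exp (- Re (h x))" if "x \<in> ball 0 1" for x
    using k(2)[OF that] by (simp add: h_def)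
  have pos: "Re (h x) > 0" if "x \<in> ball 0 1" for x
    using ng[OF that] lt[OF that] by simp
  define c where "c = h 0"
  have c: "Re c > 0" using pos[of 0] by (simp add: c_def)
  define m where "m = (\<lambda>x. (h x - c) / (h x + cnj c))"
  have dnz: "h x + cnj c \<noteq> 0" if "x \<in> ball 0 1" for x
  proof
    assume "h x + cnj c = 0"
    then have "Re (h x + cnj c) = 0" by simp
    then show False using pos[OF that] c by simp
  qed
  have "norm (m z) \<le> norm z"
  proof (rule Schwarz_Lemma(1))
    show "m holomorphic_on ball 0 1" unfolding m_def by (intro holomorphic_intros h dnz)
    show "m 0 = 0" by (simp add: m_def c_def)
    show "norm (m x) < 1" if "norm x < 1" for x
    proof -
      have x: "x \<in> ball 0 1" using that by simp
      have "(norm (h x - c))\<^sup>2 < (norm (h x + cnj c))\<^sup>2"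
        using mult_pos_pos[OF pos[OF x] c]
        by (simp add: cmod_power2) (simp add: power2_eq_square algebra_simps)
      then have "norm (h x - c) < norm (h x + cnj c)"
        by (rule power_less_imp_less_base) simp
      then show ?thesis using dnz[OF x] by (simp add: m_def norm_divide)
    qed
    show "norm z < 1" using z by simp
  qed
  then have mz: "norm (m z) \<le> 1/2" using z by simp
  have zb: "z \<in> ball 0 1" using z by simp
  have "norm (h z - c) \<le> 1/2 * norm (h z + cnj c)"
    using mz dnz[OF zb] by (simp add: m_def norm_divide field_simps)
  then have "(norm (h z - c))\<^sup>2 \<le> (1/2 * norm (h z + cnj c))\<^sup>2"
    by (rule power_mono) simp
  then have "4 * ((Re (h z) - Re c)\<^sup>2 + (Im (h z) - Im c)\<^sup>2)
      \<le> (Re (h z) + Re c)\<^sup>2 + (Im (h z) - Im c)\<^sup>2"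
    by (simp add: cmod_power2 power_mult_distrib power_divide)
  then have "4 * (Re (h z) - Re c)\<^sup>2 \<le> (Re (h z) + Re c)\<^sup>2"
    using zero_le_power2[of "Im (h z) - Im c"] by argo
  then have "(2 * (Re (h z) - Re c))\<^sup>2 \<le> (Re (h z) + Re c)\<^sup>2"
    unfolding power_mult_distrib by simp
  then have "\<bar>2 * (Re (h z) - Re c)\<bar> \<le> \<bar>Re (h z) + Re c\<bar>"
    using abs_le_square_iff by blast
  then have ab: "Re (h z) \<le> 3 * Re c" "Re c \<le> 3 * Re (h z)"
    using pos[OF zb] c by auto
  have e3: "exp (- x) ^ 3 = exp (- (3 * x))" for x :: real
    by (simp add: exp_of_nat_mult[symmetric])
  show "norm (g z) ^ 3 \<le> norm (g 0)" "norm (g 0) ^ 3 \<le> norm (g z)"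
    using ab ng[OF zb] ng[of 0] by (auto simp: e3 c_def)
qed

text \<open>The quantitative core of the \<open>\<lambda>\<close>-lemma: two parameter-holomorphic bounded functions that
  never meet keep their distance, up to a power, under a change of parameter.\<close>

lemma disjoint_holomorphic_distortion:
  assumes f: "frechet_holomorphic_on f (ball c r)" and g: "frechet_holomorphic_on g (ball c r)"
    and bd: "\<And>x. x \<in> ball c r \<Longrightarrow> norm (f x) \<le> B" "\<And>x. x \<in> ball c r \<Longrightarrow> norm (g x) \<le> B"
    and ne: "\<And>x. x \<in> ball c r \<Longrightarrow> f x \<noteq> g x"
    and B: "B > 0" and l: "l \<in> ball c (r/2)"
  shows "norm (f l - g l) ^ 3 \<le> (3 * B)\<^sup>2 * norm (f c - g c)"
    and "norm (f c - g c) ^ 3 \<le> (3 * B)\<^sup>2 * norm (f l - g l)"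
proof -
  define v where "v = 2 *\<^sub>R (l - c)"
  have v: "norm v < r" using l by (simp add: v_def dist_norm norm_minus_commute)
  have inb: "c + cscale t v \<in> ball c r" if "t \<in> ball 0 1" for t
  proof -
    have "norm (cscale t v) \<le> norm t * norm v" by (rule norm_cscale_le)
    also have "\<dots> \<le> 1 * norm v" using that by (intro mult_right_mono) auto
    finally show ?thesis using v by (simp add: dist_norm)
  qed
  define h where "h = (\<lambda>t. (f (c + cscale t v) - g (c + cscale t v)) / of_real (3 * B))"
  have hol: "h holomorphic_on ball 0 1" unfolding h_def
    using f g inb B unfolding frechet_holomorphic_on_def
    by (intro holomorphic_intros cfrechet_differentiable_along_line) auto
  have nz: "h t \<noteq> 0" if "t \<in> ball 0 1" for t using ne[OF inb[OF that]] B by (simp add: h_def)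
  have lt: "norm (h t) < 1" if "t \<in> ball 0 1" for t
  proof -
    have "norm (f (c + cscale t v) - g (c + cscale t v)) \<le> B + B"
      by (rule order_trans[OF norm_triangle_ineq4 add_mono]) (use bd inb[OF that] in auto)
    then show ?thesis using B by (simp add: h_def norm_divide norm_mult)
  qed
  have half: "cscale (1/2) v = l - c"
    unfolding v_def by (rule bcontfun_eqI) (simp add: scaleR_conv_of_real)
  have n: "norm (h (1/2)) = norm (f l - g l) / (3 * B)" "norm (h 0) = norm (f c - g c) / (3 * B)"
    using B half by (simp_all add: h_def norm_divide norm_mult)
  have *: "(a / (3*B)) ^ 3 \<le> b / (3*B) \<Longrightarrow> a ^ 3 \<le> (3 * B)\<^sup>2 * b" for a b :: real
    using B by (simp add: power_divide power3_eq_cube power2_eq_square field_simps)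
  show "norm (f l - g l) ^ 3 \<le> (3 * B)\<^sup>2 * norm (f c - g c)"
    "norm (f c - g c) ^ 3 \<le> (3 * B)\<^sup>2 * norm (f l - g l)"
    using Harnack_nonvanishing[OF hol nz lt, of "1/2"] unfolding n by (intro *; simp)+
qed

section \<open>Escaping points of a bounded polynomial sequence\<close>

definition escaping :: "(nat \<Rightarrow> complex poly) \<Rightarrow> nat \<Rightarrow> complex set" where
  "escaping P m = {z. filterlim (\<lambda>n. cmod (Q P m n z)) at_top sequentially}"

lemma basin_eq: "basin P m = insert None (Some ` escaping P m)"
  by (simp add: basin_def escaping_def)

lemma Q_same [simp]: "Q P m m z = z"
  by (simp add: Q_def)

lemma Q_Suc: "m \<le> n \<Longrightarrow> Q P m (Suc n) z = poly (P (Suc n)) (Q P m n z)"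
  by (simp add: Q_def)

lemma Q_step: "Q P m (Suc m) z = poly (P (Suc m)) z"
  by (simp add: Q_Suc)

lemma Q_trans: "m \<le> k \<Longrightarrow> k \<le> n \<Longrightarrow> Q P m n z = Q P k n (Q P m k z)"
proof -
  assume "m \<le> k" "k \<le> n"
  then have "[Suc m..<Suc n] = [Suc m..<Suc k] @ [Suc k..<Suc n]"
    using upt_add_eq_append[of "Suc m" "Suc k" "n - k"] by simp
  then show ?thesis unfolding Q_def by simp
qed

text \<open>\<open>Q\<close> as a polynomial, which gives access to its degree and its roots.\<close>

definition qpoly :: "(nat \<Rightarrow> complex poly) \<Rightarrow> nat \<Rightarrow> nat \<Rightarrow> complex poly" where
  "qpoly P m n = fold (\<lambda>k. pcompose (P k)) [Suc m..<Suc n] [:0, 1:]"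

lemma poly_qpoly: "poly (qpoly P m n) z = Q P m n z"
proof -
  have "poly (fold (\<lambda>k. pcompose (P k)) xs p) z = fold (\<lambda>k. poly (P k)) xs (poly p z)" for xs p
    by (induction xs arbitrary: p) (auto simp: poly_pcompose)
  then show ?thesis by (simp add: qpoly_def Q_def)
qed

lemma Q_eq_poly: "Q P m n = poly (qpoly P m n)"
  by (simp add: poly_qpoly fun_eq_iff)

lemma holomorphic_Q: "Q P m n holomorphic_on A"
  unfolding Q_eq_poly by (intro holomorphic_intros)

lemma continuous_on_Q: "continuous_on A (Q P m n)"
  using holomorphic_Q holomorphic_on_imp_continuous_on by blast

lemma DERIV_Q: "(Q P m n has_field_derivative deriv (Q P m n) z) (at z)"
  using holomorphic_derivI[OF holomorphic_Q open_UNIV UNIV_I] .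

lemma deriv_Q_eq: "deriv (Q P m n) z = poly (pderiv (qpoly P m n)) z"
  unfolding Q_eq_poly by (rule DERIV_imp_deriv[OF poly_DERIV])

lemma deriv_Q_same: "deriv (Q P m m) z = 1"
proof (rule DERIV_imp_deriv)
  have "Q P m m = (\<lambda>z. z)" by (simp add: fun_eq_iff)
  then show "(Q P m m has_field_derivative 1) (at z)" by simp
qed

lemma deriv_Q_trans:
  assumes "m \<le> k" "k \<le> n"
  shows "deriv (Q P m n) z = deriv (Q P k n) (Q P m k z) * deriv (Q P m k) z"
proof (rule DERIV_imp_deriv)
  have "((\<lambda>z. Q P k n (Q P m k z)) has_field_derivative
      deriv (Q P k n) (Q P m k z) * deriv (Q P m k) z) (at z)"
    by (rule DERIV_chain2[OF DERIV_Q DERIV_Q])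
  then show "(Q P m n has_field_derivative deriv (Q P k n) (Q P m k z) * deriv (Q P m k) z) (at z)"
    using Q_trans[OF assms, of P] by (metis (no_types, lifting) ext)
qed

lemma bounded_poly_seq_degree:
  "bounded_poly_seq d K M P \<Longrightarrow> m \<ge> 1 \<Longrightarrow> 2 \<le> degree (P m) \<and> degree (P m) \<le> d"
  by (simp add: bounded_poly_seq_def)

lemma degree_qpoly_ge:
  assumes P: "bounded_poly_seq d K M P" and "m \<le> n"
  shows "2 ^ (n - m) \<le> degree (qpoly P m n)"
  using \<open>m \<le> n\<close>
proof (induction n rule: dec_induct)
  case base
  then show ?case by (simp add: qpoly_def)
next
  case (step n)
  have eq: "qpoly P m (Suc n) = pcompose (P (Suc n)) (qpoly P m n)"
    using step by (simp add: qpoly_def)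
  have "2 * 2 ^ (n - m) \<le> degree (P (Suc n)) * degree (qpoly P m n)"
    using bounded_poly_seq_degree[OF P, of "Suc n"] step by (intro mult_mono) auto
  then show ?case using step by (simp add: eq degree_pcompose Suc_diff_le)
qed

lemma degree_qpoly_le:
  assumes P: "bounded_poly_seq d K M P" and "m \<le> n"
  shows "degree (qpoly P m n) \<le> d ^ (n - m)"
  using \<open>m \<le> n\<close>
proof (induction n rule: dec_induct)
  case base
  then show ?case by (simp add: qpoly_def)
next
  case (step n)
  have eq: "qpoly P m (Suc n) = pcompose (P (Suc n)) (qpoly P m n)"
    using step by (simp add: qpoly_def)
  have "degree (P (Suc n)) * degree (qpoly P m n) \<le> d * d ^ (n - m)"
    using bounded_poly_seq_degree[OF P, of "Suc n"] step by (intro mult_mono) auto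
  then show ?case using step by (simp add: eq degree_pcompose Suc_diff_le)
qed

text \<open>Beyond this radius the leading term dominates the other terms so much that the modulus at
  least doubles in each step.\<close>

definition escape_radius :: "nat \<Rightarrow> real \<Rightarrow> real \<Rightarrow> real" where
  "escape_radius d K M = K * (M * real d + 2)"

lemma escape_radius_ge:
  assumes "bounded_poly_seq d K M P"
  shows "escape_radius d K M \<ge> 2"
proof -
  have "1 * 2 \<le> K * (M * real d + 2)"
    using assms by (intro mult_mono) (auto simp: bounded_poly_seq_def)
  then show ?thesis by (simp add: escape_radius_def)
qed

lemma escape_radius_doubling:
  assumes P: "bounded_poly_seq d K M P" and m: "m \<ge> 1" and z: "cmod z \<ge> escape_radius d K M"
  shows "cmod (poly (P m) z) \<ge> 2 * cmod z"
proof -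
  let ?D = "degree (P m)"
  have K: "K \<ge> 1" and M: "M \<ge> 0" and D: "2 \<le> ?D" "?D \<le> d"
    and lc: "cmod (lead_coeff (P m)) \<ge> 1 / K" and co: "\<And>n. n < ?D \<Longrightarrow> cmod (coeff (P m) n) \<le> M"
    using P m by (auto simp: bounded_poly_seq_def)
  have z1: "cmod z \<ge> 1" using z escape_radius_ge[OF P] by linarith
  have eq: "poly (P m) z = (\<Sum>i<?D. coeff (P m) i * z ^ i) + lead_coeff (P m) * z ^ ?D"
    unfolding poly_altdef by (simp add: lessThan_Suc_atMost[symmetric])
  have "cmod (\<Sum>i<?D. coeff (P m) i * z ^ i) \<le> (\<Sum>i<?D. M * cmod z ^ (?D - 1))"
  proof (rule order_trans[OF norm_sum sum_mono])
    fix i assume i: "i \<in> {..<?D}"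
    have "cmod z ^ i \<le> cmod z ^ (?D - 1)" using z1 i by (intro power_increasing) auto
    then show "cmod (coeff (P m) i * z ^ i) \<le> M * cmod z ^ (?D - 1)"
      using co[of i] i M by (simp add: norm_mult norm_power mult_mono)
  qed
  also have "\<dots> = real ?D * (M * cmod z ^ (?D - 1))" by simp
  also have "\<dots> \<le> real d * (M * cmod z ^ (?D - 1))"
    using D M by (intro mult_right_mono) auto
  finally have low: "cmod (\<Sum>i<?D. coeff (P m) i * z ^ i) \<le> real d * M * cmod z ^ (?D - 1)"
    by (simp add: mult.assoc)
  have pw: "cmod z ^ ?D = cmod z * cmod z ^ (?D - 1)" using D by (cases ?D) auto
  have "M * real d + 2 \<le> cmod z / K" using z K by (simp add: escape_radius_def field_simps)
  then have "2 \<le> cmod z / K - real d * M" by (simp add: mult.commute)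
  moreover have "cmod z \<le> cmod z ^ (?D - 1)"
    using z1 D power_increasing[of 1 "?D - 1" "cmod z"] by simp
  ultimately have "2 * cmod z \<le> (cmod z / K - real d * M) * cmod z ^ (?D - 1)"
    using z1 by (intro mult_mono) auto
  also have "\<dots> = 1 / K * cmod z ^ ?D - real d * M * cmod z ^ (?D - 1)"
    unfolding pw by (simp add: algebra_simps)
  also have "\<dots> \<le> cmod (lead_coeff (P m) * z ^ ?D) - cmod (\<Sum>i<?D. coeff (P m) i * z ^ i)"
    using mult_right_mono[OF lc, of "cmod z ^ ?D"] low by (simp add: norm_mult norm_power)
  also have "\<dots> \<le> cmod (poly (P m) z)"
    unfolding eq by (subst add.commute) (rule norm_diff_ineq)
  finally show ?thesis .
qed

lemma escape_radius_growth:
  assumes P: "bounded_poly_seq d K M P" and z: "cmod z \<ge> escape_radius d K M" and "m \<le> n"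
  shows "cmod (Q P m n z) \<ge> 2 ^ (n - m) * cmod z"
  using \<open>m \<le> n\<close>
proof (induction n rule: dec_induct)
  case (step n)
  have "1 * cmod z \<le> 2 ^ (n - m) * cmod z" by (rule mult_right_mono) auto
  then have "cmod (Q P m n z) \<ge> escape_radius d K M" using step z by linarith
  then have "2 * cmod (Q P m n z) \<le> cmod (Q P m (Suc n) z)"
    using escape_radius_doubling[OF P, of "Suc n"] step by (simp add: Q_Suc)
  then show ?case using step by (simp add: Suc_diff_le)
qed simp

lemma escaping_Q_iff:
  assumes "m \<le> k"
  shows "Q P m k z \<in> escaping P k \<longleftrightarrow> z \<in> escaping P m"
proof -
  have "\<forall>\<^sub>F n in sequentially. cmod (Q P m n z) = cmod (Q P k n (Q P m k z))"
    using eventually_ge_at_top[of k] by eventually_elim (use Q_trans assms in metis)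
  then show ?thesis unfolding escaping_def by (simp add: filterlim_cong)
qed

lemma escaping_poly_iff: "poly (P (Suc m)) z \<in> escaping P (Suc m) \<longleftrightarrow> z \<in> escaping P m"
  using escaping_Q_iff[of m "Suc m" P z] by (simp add: Q_step)

lemma outside_escape_radius:
  assumes P: "bounded_poly_seq d K M P" and z: "cmod z \<ge> escape_radius d K M"
  shows "z \<in> escaping P m"
proof -
  have "filterlim (\<lambda>n. - real m + real n) at_top sequentially"
    by (rule filterlim_tendsto_add_at_top[OF tendsto_const filterlim_real_sequentially])
  moreover have "\<forall>\<^sub>F n in sequentially. - real m + real n \<le> cmod (Q P m n z)"
    using eventually_ge_at_top[of m]
  proof eventually_elim
    case (elim n)
    have "- real m + real n = real (n - m)" using elim by simp
    also have "\<dots> \<le> 2 ^ (n - m)" using of_nat_less_two_power[of "n - m"] by (rule less_imp_le)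
    also have "\<dots> \<le> 2 ^ (n - m) * cmod z" using z escape_radius_ge[OF P] by simp
    also have "\<dots> \<le> cmod (Q P m n z)" by (rule escape_radius_growth[OF P z elim])
    finally show ?case .
  qed
  ultimately show ?thesis
    unfolding escaping_def mem_Collect_eq by (rule filterlim_at_top_mono)
qed

text \<open>One visit beyond the escape radius suffices. So to escape is an open condition.\<close>

lemma escaping_iff:
  assumes P: "bounded_poly_seq d K M P"
  shows "z \<in> escaping P m \<longleftrightarrow> (\<exists>n\<ge>m. escape_radius d K M < cmod (Q P m n z))"
proof
  assume "z \<in> escaping P m"
  then have "\<forall>\<^sub>F n in sequentially. escape_radius d K M < cmod (Q P m n z)"
    unfolding escaping_def by (simp add: filterlim_at_top_dense)
  then have "\<forall>\<^sub>F n in sequentially. n \<ge> m \<and> escape_radius d K M < cmod (Q P m n z)"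
    using eventually_ge_at_top[of m] by eventually_elim simp
  then show "\<exists>n\<ge>m. escape_radius d K M < cmod (Q P m n z)"
    using eventually_sequentially by auto
next
  assume "\<exists>n\<ge>m. escape_radius d K M < cmod (Q P m n z)"
  then obtain n where "n \<ge> m" "escape_radius d K M < cmod (Q P m n z)" by blast
  then show "z \<in> escaping P m"
    using outside_escape_radius[OF P, of "Q P m n z" n] escaping_Q_iff[of m n P z] by simp
qed

lemma filled_julia_eq:
  assumes P: "bounded_poly_seq d K M P"
  shows "filled_julia P m = - escaping P m"
proof (intro set_eqI iffI)
  fix z assume z: "z \<in> filled_julia P m"
  show "z \<in> - escaping P m"
  proof
    assume "z \<in> escaping P m"
    then have "((\<lambda>n. ereal (cmod (Q P m n z))) \<longlongrightarrow> \<infinity>) sequentially"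
      unfolding escaping_def by (simp add: tendsto_PInfty_eq_at_top)
    then have "limsup (\<lambda>n. ereal (cmod (Q P m n z))) = \<infinity>"
      by (rule lim_imp_Limsup[rotated]) simp
    then show False using z by (simp add: filled_julia_def)
  qed
next
  fix z assume "z \<in> - escaping P m"
  then have "\<And>n. n \<ge> m \<Longrightarrow> cmod (Q P m n z) \<le> escape_radius d K M"
    using escaping_iff[OF P] by (meson ComplD not_le)
  then have "limsup (\<lambda>n. ereal (cmod (Q P m n z))) \<le> ereal (escape_radius d K M)"
    by (intro Limsup_bounded) (auto simp: eventually_sequentially)
  then show "z \<in> filled_julia P m"
    unfolding filled_julia_def mem_Collect_eq
    by (rule le_less_trans) simp
qed

lemma open_escaping:
  assumes P: "bounded_poly_seq d K M P"
  shows "open (escaping P m)"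
proof -
  have "escaping P m = (\<Union>n\<in>{m..}. {z. escape_radius d K M < cmod (Q P m n z)})"
    using escaping_iff[OF P] by auto
  moreover have "open (\<Union>n\<in>{m..}. {z. escape_radius d K M < cmod (Q P m n z)})"
    by (intro open_UN ballI open_Collect_less continuous_intros continuous_on_Q)
  ultimately show ?thesis by metis
qed

lemma not_escaping_bound:
  assumes P: "bounded_poly_seq d K M P" and "z \<notin> escaping P m"
  shows "cmod z < escape_radius d K M"
  using assms outside_escape_radius[OF P] by (meson not_le)

lemma julia_eq:
  assumes P: "bounded_poly_seq d K M P"
  shows "julia P m = closure (escaping P m) - escaping P m"
  unfolding julia_def filled_julia_eq[OF P] frontier_complement
  using open_escaping[OF P] by (simp add: frontier_def interior_open)

lemma julia_bound:
  "bounded_poly_seq d K M P \<Longrightarrow> z \<in> julia P m \<Longrightarrow> cmod z < escape_radius d K M"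
  using julia_eq not_escaping_bound by blast

text \<open>Backward invariance holds because nonconstant polynomials are open maps: near \<open>z\<close> there are
  points whose images escape.\<close>

lemma julia_Q_iff:
  assumes P: "bounded_poly_seq d K M P" and "m \<le> k"
  shows "Q P m k z \<in> julia P k \<longleftrightarrow> z \<in> julia P m"
proof -
  have "Q P m k z \<in> closure (escaping P k)" if "z \<in> closure (escaping P m)"
  proof -
    have "Q P m k ` escaping P m \<subseteq> closure (escaping P k)"
      using escaping_Q_iff[OF \<open>m \<le> k\<close>, of P] closure_subset by blast
    then have "Q P m k ` closure (escaping P m) \<subseteq> closure (escaping P k)"
      by (intro image_closure_subset continuous_on_Q) auto
    then show ?thesis using that by blast
  qed
  moreover have "z \<in> closure (escaping P m)" if *: "Q P m k z \<in> closure (escaping P k)"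
    unfolding closure_iff_nhds_not_empty
  proof (intro allI impI)
    fix A V assume V: "V \<subseteq> A" "open V" "z \<in> V"
    obtain e where e: "e > 0" "ball z e \<subseteq> V" using V openE by blast
    have "open (Q P m k ` ball z e)"
    proof (rule open_mapping_thm[of "Q P m k" UNIV])
      show "\<not> Q P m k constant_on UNIV"
      proof
        assume "Q P m k constant_on UNIV"
        then obtain c where "\<And>w. poly (qpoly P m k) w = c"
          unfolding constant_on_def poly_qpoly by auto
        then have "qpoly P m k = [:c:]" by (intro poly_ext) simp
        then have "degree (qpoly P m k) = 0" by simp
        moreover have "degree (qpoly P m k) > 0"
          using degree_qpoly_ge[OF P \<open>m \<le> k\<close>] by (meson less_le_trans zero_less_numeral zero_less_power)
        ultimately show False by simp
      qed
    qed (auto simp: holomorphic_Q)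
    moreover have "Q P m k z \<in> Q P m k ` ball z e" using e by simp
    ultimately obtain w where "w \<in> ball z e" "Q P m k w \<in> escaping P k"
      using * unfolding closure_iff_nhds_not_empty by blast
    then show "escaping P m \<inter> A \<noteq> {}"
      using e V(1) escaping_Q_iff[OF \<open>m \<le> k\<close>, of P] by blast
  qed
  ultimately show ?thesis
    unfolding julia_eq[OF P] using escaping_Q_iff[OF \<open>m \<le> k\<close>, of P z] by blast
qed

text \<open>As the derivative does not vanish on the Julia set, a Julia point has as many preimages under
  \<open>Q\<close> as the degree says; two steps give at least four.\<close>

lemma julia_three_points:
  assumes P: "bounded_poly_seq d K M P" and ne: "julia P (m + 2) \<noteq> {}"
    and reg: "\<And>z. z \<in> julia P m \<Longrightarrow> deriv (Q P m (m + 2)) z \<noteq> 0"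
  shows "\<exists>x\<in>julia P m. \<exists>y\<in>julia P m. \<exists>z\<in>julia P m. x \<noteq> y \<and> y \<noteq> z \<and> x \<noteq> z"
proof -
  obtain y where y: "y \<in> julia P (m + 2)" using ne by blast
  define p where "p = qpoly P m (m + 2) - [:y:]"
  have root: "poly p z = 0 \<longleftrightarrow> Q P m (m + 2) z = y" for z by (simp add: p_def poly_qpoly)
  have inJ: "z \<in> julia P m" if "poly p z = 0" for z
    using that y julia_Q_iff[OF P, of m "m + 2" z] root by simp
  have deg: "degree p \<ge> 4"
    using degree_qpoly_ge[OF P, of m "m + 2"] degree_add_eq_left[of "[:- y:]" "qpoly P m (m + 2)"]
    unfolding p_def diff_conv_add_uminus by simp
  then have p0: "p \<noteq> 0" by auto
  have "rsquarefree p"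
    unfolding rsquarefree_roots
  proof (intro allI notI)
    fix a assume a: "poly p a = 0 \<and> poly (pderiv p) a = 0"
    then have "deriv (Q P m (m + 2)) a = 0" by (simp add: deriv_Q_eq p_def pderiv_diff pderiv_pCons)
    then show False using reg inJ a by blast
  qed
  then have "p = smult (lead_coeff p) (\<Prod>z | poly p z = 0. [:-z, 1:])"
    using complex_poly_decompose_rsquarefree by metis
  then have "degree p = degree (\<Prod>z | poly p z = 0. [:-z, 1:])"
    using p0 by (metis degree_smult_eq leading_coeff_0_iff)
  then have "degree p = card {z. poly p z = 0}"
    by (simp add: degree_prod_eq_sum_degree)
  then have "card {z. poly p z = 0} \<ge> 3" using deg by simp
  then obtain S where S: "S \<subseteq> {z. poly p z = 0}" "card S = 3"
    using obtain_subset_with_card_n by metis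
  then obtain a b c where "S = {a, b, c}" "a \<noteq> b" "b \<noteq> c" "a \<noteq> c"
    unfolding card_3_iff by blast
  then show ?thesis using S inJ by blast
qed

section \<open>Conformal maps of a neighbourhood of infinity\<close>

lemma openin_sphere_iff:
  "openin sphere_top U \<longleftrightarrow>
     (\<exists>V. open V \<and> U = Some ` V) \<or> (\<exists>C. compact C \<and> U = insert None (Some ` (- C)))"
  unfolding openin_Alexandroff_compactification
  by (auto simp: Compl_eq_Diff_UNIV compact_imp_closed)

text \<open>If the chart at infinity is the one that witnesses differentiability, then the finite values
  near \<open>a\<close> are nonzero, and inversion leads back to the affine chart.\<close>

lemma sphere_valued_differentiable_finite:
  assumes cong: "\<And>g h. \<forall>\<^sub>F x in nhds a. g x = h x \<Longrightarrow> D g a \<Longrightarrow> D h a"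
    and inv: "\<And>g. D g a \<Longrightarrow> g a \<noteq> 0 \<Longrightarrow> D (\<lambda>x. inverse (g x)) a"
    and f: "sphere_valued_differentiable D f a"
    and fin: "\<forall>\<^sub>F x in nhds a. f x = Some (h x)"
  shows "D h a"
  using f unfolding sphere_valued_differentiable_def
proof (elim disjE conjE)
  assume "D (\<lambda>x. the (f x)) a"
  then show ?thesis by (rule cong[rotated]) (use fin in eventually_elim, simp)
next
  assume ne: "\<forall>\<^sub>F x in nhds a. f x \<noteq> Some 0" and D: "D (\<lambda>x. the (sphere_inverse (f x))) a"
  have eq: "\<forall>\<^sub>F x in nhds a. h x \<noteq> 0 \<and> the (sphere_inverse (f x)) = inverse (h x)"
    using ne fin by eventually_elim (auto simp: sphere_inverse_def)
  have "D (\<lambda>x. inverse (the (sphere_inverse (f x)))) a"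
    by (rule inv[OF D]) (use eventually_nhds_x_imp_x[OF eq] in simp)
  then show ?thesis by (rule cong[rotated]) (use eq in eventually_elim, simp)
qed

lemma field_differentiable_cong_nhds:
  assumes "\<forall>\<^sub>F x in nhds a. g x = h x" "g field_differentiable at a"
  shows "h field_differentiable at a"
  using assms DERIV_cong_ev[OF refl assms(1) refl] unfolding field_differentiable_def by blast

lemma cfrechet_differentiable_of_sphere:
  assumes "sphere_valued_differentiable cfrechet_differentiable f l"
    and "\<forall>\<^sub>F x in nhds l. f x = Some (h x)"
  shows "cfrechet_differentiable h l"
  using sphere_valued_differentiable_finite[of l cfrechet_differentiable, OF _ _ assms]
    cfrechet_differentiable_cong cfrechet_differentiable_inverse by blast

lemma field_differentiable_of_sphere:
  assumes "sphere_valued_differentiable (\<lambda>g a. g field_differentiable at a) f (l::complex)"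
    and "\<forall>\<^sub>F x in nhds l. f x = Some (h x)"
  shows "h field_differentiable at l"
  using sphere_valued_differentiable_finite[of l "\<lambda>g a. g field_differentiable at a", OF _ _ assms]
    field_differentiable_cong_nhds field_differentiable_inverse by blast

lemma sphere_valued_differentiable_Some:
  "D h a \<Longrightarrow> sphere_valued_differentiable D (\<lambda>x. Some (h x)) a"
  unfolding sphere_valued_differentiable_def by simp

lemma sphere_frechet_holomorphic_const_None: "sphere_frechet_holomorphic_on (\<lambda>_. None) U"
  unfolding sphere_frechet_holomorphic_on_def sphere_valued_differentiable_def
  by (simp add: sphere_inverse_def)

text \<open>Riemann's theorem on removable singularities in the coordinate at infinity.\<close>

lemma holomorphic_in_inverse_at_infinity:
  fixes h :: "complex \<Rightarrow> complex"
  assumes h: "h holomorphic_on {w. R < cmod w}" and R: "R > 0" and lim: "(h \<longlongrightarrow> L) at_infinity"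
  shows "(\<lambda>u. if u = 0 then L else h (inverse u)) holomorphic_on ball 0 (1/R)"
    (is "?g holomorphic_on _")
proof (rule no_isolated_singularity[where K = "{0}"])
  have hol: "?g holomorphic_on ball 0 (1/R) - {0}"
  proof (rule holomorphic_transform)
    show "(h \<circ> inverse) holomorphic_on ball 0 (1/R) - {0}"
      by (rule holomorphic_on_compose_gen[OF _ h])
        (use R in \<open>auto intro!: holomorphic_intros simp: norm_divide divide_inverse[symmetric] field_simps\<close>)
  qed auto
  then show "?g holomorphic_on ball 0 (1/R) - {0}" .
  show "continuous_on (ball 0 (1/R)) ?g"
    unfolding continuous_on_eq_continuous_at[OF open_ball]
  proof
    fix u :: complex assume u: "u \<in> ball 0 (1/R)"
    show "isCont ?g u"
    proof (cases "u = 0")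
      case True
      have "((h \<circ> inverse) \<longlongrightarrow> L) (at 0)" using lim lim_at_infinity_0 by blast
      then have "(?g \<longlongrightarrow> L) (at 0)"
        by (rule Lim_transform_eventually) (simp add: eventually_at_filter)
      then show ?thesis using True by (simp add: isCont_def)
    next
      case False
      then show ?thesis
        using u holomorphic_on_imp_continuous_on[OF hol] continuous_on_eq_continuous_at
        by (metis (no_types, lifting) Diff_iff empty_iff finite.emptyI finite_imp_closed
            finite_insert insert_iff open_Diff open_ball)
    qed
  qed
qed auto

text \<open>The inverse, in affine coordinates, of a conformal map \<open>f\<close> of a neighbourhood of infinity onto
  the exterior of the disc. The last condition says that infinity is fixed.\<close>

definition exterior_inverse :: "(csphere \<Rightarrow> csphere) \<Rightarrow> complex set \<Rightarrow> (complex \<Rightarrow> complex) \<Rightarrow> bool" where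
  "exterior_inverse f A \<psi> \<longleftrightarrow> f None = None \<and> bij_betw \<psi> {w. 1 < cmod w} A \<and>
     \<psi> holomorphic_on {w. 1 < cmod w} \<and> (\<forall>w. 1 < cmod w \<longrightarrow> f (Some (\<psi> w)) = Some w) \<and>
     filterlim \<psi> at_infinity at_infinity"

text \<open>The normalization excludes a finite value at infinity. So \<open>f\<close> restricts to an injective
  holomorphic function \<open>F\<close> of the finite points. The open mapping theorem for \<open>1 / F (1 / u)\<close> at
  \<open>0\<close> shows that large values are taken near infinity only.\<close>

lemma exterior_inverse_exists:
  assumes cb: "conformal_bijection f (insert None (Some ` A)) disc_exterior"
    and nrm: "((\<lambda>z. the (f (Some z)) / z) \<longlongrightarrow> 1) at_infinity"
  obtains \<psi> where "exterior_inverse f A \<psi>" "((\<lambda>w. \<psi> w / w) \<longlongrightarrow> 1) at_infinity"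
proof -
  let ?W = "{w::complex. 1 < cmod w}"
  define F where "F = (\<lambda>z. the (f (Some z)))"
  have op: "openin sphere_top (insert None (Some ` A))"
    and bij: "bij_betw f (insert None (Some ` A)) disc_exterior"
    and hol: "sphere_holomorphic_on f (insert None (Some ` A))"
    using cb by (auto simp: conformal_bijection_def)
  obtain C where C: "compact C" "insert None (Some ` A) = insert None (Some ` (- C))"
    using op unfolding openin_sphere_iff by auto
  then have AC: "A = - C" by blast
  then have opA: "open A" using compact_imp_closed[OF C(1)] by (simp add: open_Compl)
  obtain r where r: "r > 0" "\<And>z. cmod z > r \<Longrightarrow> z \<in> A"
    using compact_imp_bounded[OF C(1)] unfolding bounded_pos AC by (meson ComplI not_le)
  have invA: "inverse u \<in> A" if "u \<noteq> 0" "cmod u < 1 / r" for u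
    using that r(1) by (intro r(2), unfold norm_inverse) (simp add: field_simps)
  have lim0: "((\<lambda>w. the (f (Some (inverse w))) * w) \<longlongrightarrow> 1) (at 0)"
    using nrm unfolding lim_at_infinity_0 o_def by (simp add: divide_inverse)
  define g where "g = (\<lambda>w. f (sphere_inverse (Some w)))"
  have sd: "sphere_valued_differentiable (\<lambda>g a. g field_differentiable at a) g 0"
    using hol unfolding sphere_holomorphic_on_def g_def by (auto split: option.splits)
  have g0: "g 0 = f None" and g1: "\<And>w. w \<noteq> 0 \<Longrightarrow> g w = f (Some (inverse w))"
    by (simp_all add: g_def sphere_inverse_def)
  \<comment> \<open>A finite value at infinity would be a finite limit of \<open>f\<close>, against the growth of \<open>f z\<close>.\<close>
  have nolim: False if c: "((\<lambda>w. the (g w)) \<longlongrightarrow> c) (at 0)" for c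
  proof -
    have "((\<lambda>w. the (g w) * w) \<longlongrightarrow> c * 0) (at 0)" by (intro tendsto_intros c)
    moreover have "\<forall>\<^sub>F w in at 0. the (g w) * w = the (f (Some (inverse w))) * w"
      using eventually_neq_at_within[of 0 0 UNIV] by eventually_elim (subst g1, auto)
    ultimately have "((\<lambda>w. the (f (Some (inverse w))) * w) \<longlongrightarrow> c * 0) (at 0)"
      by (rule Lim_transform_eventually)
    then show False using tendsto_unique[OF _ lim0] by fastforce
  qed
  have fN: "f None = None"
  proof (rule ccontr)
    assume "f None \<noteq> None"
    moreover have "f None \<in> disc_exterior" using bij by (auto simp: bij_betw_def)
    ultimately obtain c where c: "f None = Some c" "1 < cmod c" by (auto simp: disc_exterior_def)
    then have c0: "c \<noteq> 0" by auto
    from sd show False unfolding sphere_valued_differentiable_def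
    proof (elim disjE conjE)
      assume "(\<lambda>w. the (g w)) field_differentiable at 0"
      then have "isCont (\<lambda>w. the (g w)) 0" by (rule field_differentiable_imp_continuous_at)
      then show False using nolim unfolding isCont_def by blast
    next
      assume "(\<lambda>w. the (sphere_inverse (g w))) field_differentiable at 0"
      then have "isCont (\<lambda>w. the (sphere_inverse (g w))) 0"
        by (rule field_differentiable_imp_continuous_at)
      then have s: "((\<lambda>w. the (sphere_inverse (g w))) \<longlongrightarrow> inverse c) (at 0)"
        using c c0 by (simp add: isCont_def g0 sphere_inverse_def)
      then have "\<forall>\<^sub>F w in at 0. the (sphere_inverse (g w)) \<noteq> 0"
        by (rule tendsto_imp_eventually_ne) (use c0 in simp)
      moreover have "\<forall>\<^sub>F w in at 0. g w \<noteq> Some 0"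
      proof -
        have "0 < cmod (w::complex) \<and> cmod w < 1 / r \<Longrightarrow> g w \<noteq> Some 0" for w
        proof
          assume w: "0 < cmod w \<and> cmod w < 1 / r" "g w = Some 0"
          then have "inverse w \<in> A" by (intro invA) auto
          then have "f (Some (inverse w)) \<in> disc_exterior" using bij by (auto simp: bij_betw_def)
          then show False using w g1[of w] by (auto simp: disc_exterior_def)
        qed
        then show ?thesis unfolding eventually_at dist_norm using r(1)
          by (intro exI[of _ "1/r"]) simp
      qed
      ultimately have "\<forall>\<^sub>F w in at 0. inverse (the (sphere_inverse (g w))) = the (g w)"
        by eventually_elim (auto simp: sphere_inverse_def split: option.splits if_splits)
      moreover have "((\<lambda>w. inverse (the (sphere_inverse (g w)))) \<longlongrightarrow> inverse (inverse c)) (at 0)"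
        using c0 by (intro tendsto_inverse s) auto
      ultimately show False by (intro nolim[OF Lim_transform_eventually])
    qed
  qed
  have injf: "inj_on f (insert None (Some ` A))"
    and imf: "f ` insert None (Some ` A) = disc_exterior"
    using bij by (auto simp: bij_betw_def)
  have fS: "f (Some z) = Some (F z) \<and> 1 < cmod (F z)" if "z \<in> A" for z
  proof -
    have "f (Some z) \<noteq> f None" using inj_onD[OF injf, of "Some z" None] that by blast
    moreover have "f (Some z) \<in> disc_exterior" using imf that by blast
    ultimately show ?thesis using fN by (auto simp: F_def disc_exterior_def)
  qed
  have holF: "F holomorphic_on A"
  proof -
    have "F field_differentiable at z" if z: "z \<in> A" for z
    proof (rule field_differentiable_of_sphere)
      show "sphere_valued_differentiable (\<lambda>g a. g field_differentiable at a) (\<lambda>w. f (Some w)) z"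
        using hol z unfolding sphere_holomorphic_on_def by (auto split: option.splits)
      show "\<forall>\<^sub>F w in nhds z. f (Some w) = Some (F w)"
        using eventually_nhds_in_open[OF opA z] by eventually_elim (use fS in blast)
    qed
    then show ?thesis by (simp add: holomorphic_on_def field_differentiable_at_within)
  qed
  have injF: "inj_on F A"
  proof (rule inj_onI)
    fix x y assume "x \<in> A" "y \<in> A" "F x = F y"
    then show "x = y" using inj_onD[OF injf, of "Some x" "Some y"] fS by auto
  qed
  have imF: "F ` A = ?W"
  proof (intro equalityI subsetI)
    fix w assume "w \<in> F ` A" then show "w \<in> ?W" using fS by auto
  next
    fix w assume "w \<in> ?W"
    then have "Some w \<in> f ` insert None (Some ` A)" unfolding imf by (auto simp: disc_exterior_def)
    then obtain z where "z \<in> A" "f (Some z) = Some w" using fN by auto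
    then show "w \<in> F ` A" using fS by force
  qed
  obtain \<psi> where \<psi>: "\<psi> holomorphic_on ?W" "\<And>z. z \<in> A \<Longrightarrow> \<psi> (F z) = z"
    using holomorphic_has_inverse[OF holF opA injF] unfolding imF by metis
  have F\<psi>: "\<psi> w \<in> A \<and> F (\<psi> w) = w" if "w \<in> ?W" for w
    using that imF \<psi>(2) by (metis (no_types, lifting) imageE)
  have bij\<psi>: "bij_betw \<psi> ?W A"
    by (rule bij_betw_byWitness[where f' = F]) (use F\<psi> \<psi>(2) imF in auto)
  have Finf: "filterlim F at_infinity at_infinity"
  proof -
    have "filterlim (\<lambda>z. F z / z * z) at_infinity at_infinity"
      by (rule tendsto_mult_filterlim_at_infinity[where c = 1])
        (use nrm in \<open>auto simp: F_def filterlim_ident\<close>)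
    moreover have "\<forall>\<^sub>F z in at_infinity. F z / z * z = F z"
      using eventually_not_equal_at_infinity[of 0] by eventually_elim simp
    ultimately show ?thesis by (simp add: filterlim_cong)
  qed
  define G where "G = (\<lambda>u. if u = 0 then 0 else inverse (F (inverse u)))"
  have Gh: "G holomorphic_on ball 0 (1/r)"
    unfolding G_def
  proof (rule holomorphic_in_inverse_at_infinity)
    have "{w. r < cmod w} \<subseteq> A" using r by blast
    moreover have "F z \<noteq> 0" if "z \<in> A" for z using fS[OF that] by auto
    ultimately show "(\<lambda>z. inverse (F z)) holomorphic_on {w. r < cmod w}"
      by (intro holomorphic_intros holomorphic_on_subset[OF holF]) auto
    show "((\<lambda>z. inverse (F z)) \<longlongrightarrow> 0) at_infinity"
      using filterlim_compose[OF tendsto_inverse_0 Finf] .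
  qed (use r in simp)
  have \<psi>inf: "filterlim \<psi> at_infinity at_infinity"
    unfolding filterlim_at_infinity[OF order_refl]
  proof (intro allI impI)
    fix R :: real assume R: "R > 0"
    define \<epsilon> where "\<epsilon> = min (1/r) (1/R)"
    have \<epsilon>: "\<epsilon> > 0" using r R by (simp add: \<epsilon>_def)
    have G0: "G u \<noteq> 0" if "u \<noteq> 0" "u \<in> ball 0 \<epsilon>" for u
    proof -
      have "inverse u \<in> A" using that by (intro invA) (auto simp: \<epsilon>_def)
      then show ?thesis using fS[of "inverse u"] that by (auto simp: G_def)
    qed
    have "open (G ` ball 0 \<epsilon>)"
    proof (rule open_mapping_thm[of G "ball 0 \<epsilon>"])
      show "G holomorphic_on ball 0 \<epsilon>" by (rule holomorphic_on_subset[OF Gh]) (auto simp: \<epsilon>_def)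
      show "\<not> G constant_on ball 0 \<epsilon>"
      proof
        assume "G constant_on ball 0 \<epsilon>"
        moreover have "(0::complex) \<in> ball 0 \<epsilon>" "complex_of_real (\<epsilon>/2) \<in> ball 0 \<epsilon>"
          using \<epsilon> by (auto simp: norm_divide)
        ultimately have "G (complex_of_real (\<epsilon>/2)) = G 0" unfolding constant_on_def by metis
        moreover have "G 0 = 0" by (simp add: G_def)
        ultimately show False
          using G0[of "complex_of_real (\<epsilon>/2)"] \<epsilon> \<open>complex_of_real (\<epsilon>/2) \<in> ball 0 \<epsilon>\<close> by auto
      qed
    qed auto
    moreover have "0 \<in> G ` ball 0 \<epsilon>" using \<epsilon> by (force simp: G_def)
    ultimately obtain \<eta> where \<eta>: "\<eta> > 0" "ball 0 \<eta> \<subseteq> G ` ball 0 \<epsilon>" using openE by metis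
    have "R \<le> cmod (\<psi> w)" if w: "cmod w > 1/\<eta>" for w
    proof -
      have w0: "w \<noteq> 0" using w \<eta>(1) by (auto simp: field_simps)
      have "inverse w \<in> ball 0 \<eta>"
        using w \<eta>(1) w0 by (simp only: mem_ball dist_0_norm norm_inverse) (simp add: field_simps)
      then obtain u where u: "u \<in> ball 0 \<epsilon>" "inverse w = G u" using \<eta>(2) by blast
      then have u0: "u \<noteq> 0" using w0 by (auto simp: G_def)
      then have "w = F (inverse u)" using u by (simp add: G_def)
      moreover have uA: "inverse u \<in> A" using u u0 by (intro invA) (auto simp: \<epsilon>_def)
      ultimately have "\<psi> w = inverse u" using \<psi>(2) by simp
      moreover have "R \<le> inverse (cmod u)" using u u0 R by (auto simp: \<epsilon>_def field_simps)
      ultimately show ?thesis by (simp add: norm_inverse)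
    qed
    then show "\<forall>\<^sub>F w in at_infinity. R \<le> cmod (\<psi> w)"
      unfolding eventually_at_infinity
      by (intro exI[of _ "1/\<eta> + 1"]) auto
  qed
  have "((\<lambda>w. \<psi> w / w) \<longlongrightarrow> 1) at_infinity"
  proof -
    have "((\<lambda>w. F (\<psi> w) / \<psi> w) \<longlongrightarrow> 1) at_infinity"
      using filterlim_compose[OF nrm \<psi>inf] by (simp add: F_def)
    then have "((\<lambda>w. inverse (F (\<psi> w) / \<psi> w)) \<longlongrightarrow> inverse 1) at_infinity"
      by (rule tendsto_inverse) simp
    moreover have "\<forall>\<^sub>F w in at_infinity. inverse (F (\<psi> w) / \<psi> w) = \<psi> w / w"
      unfolding eventually_at_infinity using F\<psi> by (intro exI[of _ 2]) auto
    ultimately have "((\<lambda>w. \<psi> w / w) \<longlongrightarrow> inverse 1) at_infinity"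
      by (rule Lim_transform_eventually)
    then show ?thesis by simp
  qed
  moreover have "exterior_inverse f A \<psi>"
    unfolding exterior_inverse_def using fN bij\<psi> \<psi>(1) F\<psi> fS \<psi>inf by (auto simp: )
  ultimately show thesis using that by blast
qed

text \<open>As \<open>w\<close> approaches the unit circle, \<open>\<psi> w\<close> approaches the complement of \<open>A\<close>, so that the modulus
  of \<open>\<psi> w - w\<close> is eventually at most \<open>r + \<bar>w\<bar>\<close>. This function is holomorphic at infinity too, and
  the maximum principle bounds it by \<open>r + 1\<close> everywhere. The bound depends on the size of the
  complement only.\<close>

lemma exterior_inverse_bound:
  assumes ei: "exterior_inverse f A \<psi>" and nrm: "((\<lambda>w. \<psi> w / w) \<longlongrightarrow> 1) at_infinity"
    and nf: "((\<lambda>z. the (f (Some z)) / z) \<longlongrightarrow> 1) at_infinity"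
    and r: "r > 0" "\<And>z. cmod z \<ge> r \<Longrightarrow> z \<in> A"
  obtains h where "h holomorphic_on ball 0 1" "h 0 = 1" "\<And>u. u \<in> ball 0 1 \<Longrightarrow> cmod (h u) \<le> r + 2"
    "\<And>w. 1 < cmod w \<Longrightarrow> \<psi> w = w * h (inverse w)"
    "\<And>w. 1 < cmod w \<Longrightarrow> cmod (\<psi> w - w) \<le> r + 1"
proof -
  let ?W = "{w::complex. 1 < cmod w}"
  have bij: "bij_betw \<psi> ?W A" and hol: "\<psi> holomorphic_on ?W" and inf: "filterlim \<psi> at_infinity at_infinity"
    using ei by (auto simp: exterior_inverse_def)
  have opW: "open ?W" by (intro open_Collect_less continuous_intros)
  define h where "h = (\<lambda>u. if u = 0 then 1 else \<psi> (inverse u) / inverse u)"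
  have hh: "h holomorphic_on ball 0 1"
  proof -
    have "(\<lambda>w. \<psi> w / w) holomorphic_on ?W" by (intro holomorphic_intros hol) auto
    then show ?thesis
      using holomorphic_in_inverse_at_infinity[of "\<lambda>w. \<psi> w / w" 1 1] nrm unfolding h_def by simp
  qed
  have \<psi>h: "\<psi> w = w * h (inverse w)" if "1 < cmod w" for w
    using that by (auto simp: h_def)
  obtain F where F: "F holomorphic_on A" "\<And>w. w \<in> ?W \<Longrightarrow> F (\<psi> w) = w"
    using holomorphic_has_inverse[OF hol opW] bij by (metis bij_betw_def)
  have FW: "1 < cmod (F z)" "the (f (Some z)) = F z" if "z \<in> A" for z
  proof -
    obtain w where "w \<in> ?W" "z = \<psi> w" using \<open>z \<in> A\<close> bij by (auto simp: bij_betw_def)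
    then show "1 < cmod (F z)" "the (f (Some z)) = F z"
      using F(2)[of w] ei by (auto simp: exterior_inverse_def)
  qed
  have near: "\<exists>\<eta>>0. \<forall>w. 1 < cmod w \<and> cmod w < 1 + \<eta> \<longrightarrow> cmod (\<psi> w) \<le> r"
  proof -
    have "\<forall>\<^sub>F z in at_infinity. dist (the (f (Some z)) / z) 1 < 1/2"
      using nf by (rule tendstoD) simp
    then obtain b where b: "\<And>z. cmod z \<ge> b \<Longrightarrow> dist (the (f (Some z)) / z) 1 < 1/2"
      unfolding eventually_at_infinity by blast
    define r' where "r' = max (max b 4) r"
    have big: "cmod (F z) \<ge> 2" if z: "cmod z \<ge> r'" for z
    proof -
      have zA: "z \<in> A" using z r(2) by (simp add: r'_def)
      have "cmod (1 - F z / z) < 1/2"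
        using b[of z] z FW(2)[OF zA] by (simp add: r'_def dist_norm norm_minus_commute)
      moreover have "cmod 1 - cmod (F z / z) \<le> cmod (1 - F z / z)" by (rule norm_triangle_ineq2)
      ultimately have "1/2 \<le> cmod (F z) / cmod z" by (simp add: norm_divide)
      moreover have "cmod z \<ge> 4" using z by (simp add: r'_def)
      ultimately show ?thesis using pos_le_divide_eq[of "cmod z" "1/2" "cmod (F z)"] by linarith
    qed
    define C where "C = {z. r \<le> cmod z} \<inter> cball 0 r'"
    have C: "compact C" unfolding C_def by (intro closed_Int_compact closed_Collect_le continuous_intros) simp
    have "complex_of_real r \<in> C" using r(1) by (simp add: C_def r'_def)
    then have "C \<noteq> {}" by blast
    moreover have "continuous_on C (\<lambda>z. cmod (F z))"
      by (intro continuous_on_norm continuous_on_subset[OF holomorphic_on_imp_continuous_on[OF F(1)]])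
        (use r in \<open>auto simp: C_def\<close>)
    ultimately obtain z0 where z0: "z0 \<in> C" "\<And>z. z \<in> C \<Longrightarrow> cmod (F z0) \<le> cmod (F z)"
      using continuous_attains_inf[OF C] by blast
    have z1: "1 < cmod (F z0)" using FW(1) z0(1) r(2) by (simp add: C_def)
    show ?thesis
    proof (intro exI[of _ "min 1 (cmod (F z0) - 1)"] conjI allI impI)
      show "0 < min 1 (cmod (F z0) - 1)" using z1 by simp
      fix w assume w: "1 < cmod w \<and> cmod w < 1 + min 1 (cmod (F z0) - 1)"
      show "cmod (\<psi> w) \<le> r"
      proof (rule ccontr)
        assume n: "\<not> cmod (\<psi> w) \<le> r"
        have "cmod (\<psi> w) < r'"
        proof (rule ccontr)
          assume "\<not> cmod (\<psi> w) < r'"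
          then have "2 \<le> cmod (F (\<psi> w))" by (intro big) simp
          then show False using F(2)[of w] w by simp
        qed
        then have "\<psi> w \<in> C" using n by (simp add: C_def)
        then have "cmod (F z0) \<le> cmod w" using z0(2)[of "\<psi> w"] F(2)[of w] w by simp
        then show False using w by linarith
      qed
    qed
  qed
  then obtain \<eta> where \<eta>: "\<eta> > 0" "\<And>w. 1 < cmod w \<Longrightarrow> cmod w < 1 + \<eta> \<Longrightarrow> cmod (\<psi> w) \<le> r" by blast
  define g where "g = (\<lambda>u. if u = 0 then deriv h 0 else (h u - h 0) / (u - 0))"
  have gh: "g holomorphic_on ball 0 1" unfolding g_def by (rule pole_lemma_open[OF hh open_ball])
  have g\<psi>: "g u = \<psi> (inverse u) - inverse u" if "u \<noteq> 0" for u
    using that by (simp add: g_def h_def field_simps)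
  have gb: "cmod (g u) \<le> r + 1" if u: "u \<in> ball 0 1" for u
  proof (rule field_le_epsilon)
    fix e :: real assume e: "e > 0"
    \<comment> \<open>A circle around \<open>u\<close> on which \<open>\<psi> (inverse z)\<close> is bounded by \<open>r\<close> and \<open>inverse z\<close> by \<open>1 + e\<close>.\<close>
    obtain \<rho> where \<rho>: "max (cmod u) (1 / (1 + min \<eta> e)) < \<rho>" "\<rho> < 1"
      using dense[of "max (cmod u) (1 / (1 + min \<eta> e))" 1] u e \<eta>(1) by (auto simp: field_simps)
    have \<rho>0: "\<rho> > 0" using \<rho>(1) norm_ge_zero[of u] by linarith
    have inv: "1 < 1 / \<rho>" "1 / \<rho> < 1 + min \<eta> e"
    proof -
      have "1 / (1 + min \<eta> e) < \<rho>" using \<rho>(1) by simp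
      moreover have "1 + min \<eta> e > 0" using e \<eta>(1) by simp
      ultimately show "1 / \<rho> < 1 + min \<eta> e" using \<rho>0 by (simp add: field_simps)
      show "1 < 1 / \<rho>" using \<rho>0 \<rho>(2) by simp
    qed
    show "cmod (g u) \<le> r + 1 + e"
    proof (rule maximum_modulus_frontier[where S = "ball 0 \<rho>" and f = g and \<xi> = u])
      show "g holomorphic_on interior (ball 0 \<rho>)"
        using \<rho>(2) by (auto intro!: holomorphic_on_subset[OF gh])
      show "continuous_on (closure (ball 0 \<rho>)) g"
        using \<rho> \<rho>0 by (intro holomorphic_on_imp_continuous_on holomorphic_on_subset[OF gh]) auto
      show "u \<in> ball 0 \<rho>" using \<rho>(1) by simp
      fix z assume "z \<in> frontier (ball (0::complex) \<rho>)"
      then have z: "cmod z = \<rho>" using \<rho>0 by simp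
      then have z0: "z \<noteq> 0" using \<rho>0 by auto
      have iz: "cmod (inverse z) = 1 / \<rho>" using z by (simp add: norm_inverse norm_divide inverse_eq_divide)
      have "cmod (g z) \<le> cmod (\<psi> (inverse z)) + cmod (inverse z)"
        unfolding g\<psi>[OF z0] by (rule norm_triangle_ineq4)
      also have "\<dots> \<le> r + (1 + e)"
        using \<eta>(2)[of "inverse z"] inv iz by (intro add_mono) auto
      finally show "cmod (g z) \<le> r + 1 + e" by simp
    qed simp
  qed
  have "cmod (\<psi> w - w) \<le> r + 1" if w: "1 < cmod w" for w
  proof -
    have "w \<noteq> 0" "inverse w \<in> ball 0 1" using w by (auto simp: norm_inverse inverse_less_1_iff)
    then show ?thesis using gb[of "inverse w"] g\<psi>[of "inverse w"] by simp
  qed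
  moreover have "cmod (h u) \<le> r + 2" if u: "u \<in> ball 0 1" for u
  proof -
    have "h u = 1 + u * g u" by (simp add: g_def h_def)
    moreover have "cmod (1 + u * g u) \<le> 1 + cmod u * cmod (g u)"
      using norm_triangle_ineq[of 1 "u * g u"] by (simp add: norm_mult)
    moreover have "cmod u * cmod (g u) \<le> 1 * (r + 1)" using u gb[OF u] by (intro mult_mono) auto
    ultimately show ?thesis by simp
  qed
  ultimately show thesis using that[OF hh _ _ \<psi>h] by (simp add: h_def)
qed

section \<open>Holomorphic dependence of the inverse Boettcher maps on the parameter\<close>

text \<open>The mean value inequality, with the bound on the differentials, which is uniform in the
  time.\<close>

lemma analytic_family_coeff_Lipschitz:
  assumes \<Lambda>: "open \<Lambda>" and fam: "analytic_family \<Lambda> P" and l: "l \<in> \<Lambda>"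
  obtains \<delta> B d K M where "\<delta> > 0" "B > 0" "ball l \<delta> \<subseteq> \<Lambda>"
    "\<And>x. x \<in> ball l \<delta> \<Longrightarrow> bounded_poly_seq d K M (P x)"
    "\<And>x y m n. x \<in> ball l \<delta> \<Longrightarrow> y \<in> ball l \<delta> \<Longrightarrow> m \<ge> 1 \<Longrightarrow>
        cmod (coeff (P x m) n - coeff (P y m) n) \<le> B * norm (x - y)"
proof -
  obtain \<delta>0 where \<delta>0: "\<delta>0 > 0" "ball l \<delta>0 \<subseteq> \<Lambda>" using \<Lambda> l openE by blast
  obtain \<delta>1 d K M where \<delta>1: "\<delta>1 > 0" "\<And>x. x \<in> \<Lambda> \<inter> ball l \<delta>1 \<Longrightarrow> bounded_poly_seq d K M (P x)"
    using fam l unfolding analytic_family_def by blast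
  obtain \<delta>2 B where \<delta>2: "\<delta>2 > 0" "\<And>x m n. x \<in> \<Lambda> \<inter> ball l \<delta>2 \<Longrightarrow> m \<ge> 1 \<Longrightarrow>
      \<exists>D. has_cfrechet_derivative (\<lambda>l. coeff (P l m) n) D x \<and> onorm D \<le> B"
    using fam l unfolding analytic_family_def by metis
  define \<delta> where "\<delta> = min \<delta>0 (min \<delta>1 \<delta>2)"
  have sub: "ball l \<delta> \<subseteq> \<Lambda> \<inter> ball l \<delta>1 \<inter> ball l \<delta>2" using \<delta>0(2) by (auto simp: \<delta>_def)
  have lip: "cmod (coeff (P x m) n - coeff (P y m) n) \<le> max B 1 * norm (x - y)"
    if x: "x \<in> ball l \<delta>" and y: "y \<in> ball l \<delta>" and m: "m \<ge> 1" for x y m n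
  proof -
    have "\<forall>z. \<exists>D. z \<in> ball l \<delta> \<longrightarrow> has_cfrechet_derivative (\<lambda>l. coeff (P l m) n) D z \<and> onorm D \<le> B"
      using \<delta>2(2) sub m by blast
    then obtain D where D: "\<And>z. z \<in> ball l \<delta> \<Longrightarrow>
        has_cfrechet_derivative (\<lambda>l. coeff (P l m) n) (D z) z \<and> onorm (D z) \<le> B" by metis
    show ?thesis
    proof (rule differentiable_bound[OF convex_ball _ _ x y])
      fix z assume "z \<in> ball l \<delta>"
      from D[OF this] show "((\<lambda>l. coeff (P l m) n) has_derivative D z) (at z within ball l \<delta>)"
        "onorm (D z) \<le> max B 1"
        unfolding has_cfrechet_derivative_def by (auto intro: has_derivative_at_withinI)
    qed
  qed
  show thesis
    by (rule that[of \<delta> "max B 1" d K M]) (use \<delta>0 \<delta>1 \<delta>2 sub lip in \<open>auto simp: \<delta>_def\<close>)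
qed

text \<open>Leading coefficients are bounded away from 0 and all coefficients move continuously,
  uniformly in the time; so no coefficient can become or cease to be the leading one.\<close>

lemma analytic_family_degree_locally_constant:
  assumes \<Lambda>: "open \<Lambda>" and fam: "analytic_family \<Lambda> P" and l: "l \<in> \<Lambda>"
  shows "\<exists>\<delta>>0. ball l \<delta> \<subseteq> \<Lambda> \<and> (\<forall>x\<in>ball l \<delta>. \<forall>m\<ge>1. degree (P x m) = degree (P l m))"
proof -
  obtain \<delta> B d K M where \<delta>: "\<delta> > 0" "B > 0" "ball l \<delta> \<subseteq> \<Lambda>"
    and bd: "\<And>x. x \<in> ball l \<delta> \<Longrightarrow> bounded_poly_seq d K M (P x)"
    and lip: "\<And>x y m n. x \<in> ball l \<delta> \<Longrightarrow> y \<in> ball l \<delta> \<Longrightarrow> m \<ge> 1 \<Longrightarrow>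
        cmod (coeff (P x m) n - coeff (P y m) n) \<le> B * norm (x - y)"
    using analytic_family_coeff_Lipschitz[OF \<Lambda> fam l] by metis
  have ll: "l \<in> ball l \<delta>" using \<delta> by simp
  have K: "K \<ge> 1" using bd[OF ll] by (simp add: bounded_poly_seq_def)
  define \<epsilon> where "\<epsilon> = min \<delta> (1 / (K * B))"
  have \<epsilon>: "\<epsilon> > 0" using \<delta> K by (simp add: \<epsilon>_def)
  have le: "degree (P x m) \<le> degree (P y m)"
    if xy: "x \<in> ball l \<delta>" "y \<in> ball l \<delta>" "norm (x - y) < \<epsilon>" "m \<ge> 1" for x y m
  proof (rule le_degree)
    let ?e = "degree (P x m)"
    have "cmod (coeff (P x m) ?e - coeff (P y m) ?e) < 1 / K"
    proof -
      have "B * norm (x - y) < B * (1 / (K * B))"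
        using xy(3) \<delta>(2) by (intro mult_strict_left_mono) (auto simp: \<epsilon>_def)
      then show ?thesis using lip[OF xy(1,2,4), of ?e] \<delta>(2) by simp
    qed
    moreover have "1 / K \<le> cmod (lead_coeff (P x m))"
      using bd[OF xy(1)] xy(4) by (simp add: bounded_poly_seq_def)
    ultimately show "coeff (P y m) ?e \<noteq> 0" by auto
  qed
  have "ball l \<epsilon> \<subseteq> ball l \<delta>" by (auto simp: \<epsilon>_def)
  then have "\<forall>x\<in>ball l \<epsilon>. \<forall>m\<ge>1. degree (P x m) = degree (P l m)"
  proof (intro ballI allI impI antisym)
    fix x m assume "ball l \<epsilon> \<subseteq> ball l \<delta>" and x: "x \<in> ball l \<epsilon>" and m: "m \<ge> (1::nat)"
    then have xb: "x \<in> ball l \<delta>" by blast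
    have "norm (l - x) < \<epsilon>" "norm (x - l) < \<epsilon>" using x by (simp_all add: dist_norm norm_minus_commute)
    then show "degree (P x m) \<le> degree (P l m)" "degree (P l m) \<le> degree (P x m)"
      using le[OF xb ll _ m] le[OF ll xb _ m] by simp_all
  qed
  moreover have "ball l \<epsilon> \<subseteq> \<Lambda>" using \<delta>(3) subset_ball[of \<epsilon> \<delta> l] by (simp add: \<epsilon>_def)
  ultimately show ?thesis using \<epsilon> by (intro exI[of _ \<epsilon>] conjI)
qed

lemma analytic_family_coeff_holomorphic:
  "analytic_family \<Lambda> P \<Longrightarrow> open \<Lambda> \<Longrightarrow> m \<ge> 1 \<Longrightarrow> frechet_holomorphic_on (\<lambda>l. coeff (P l m) n) \<Lambda>"
  unfolding frechet_holomorphic_on_def analytic_family_def cfrechet_differentiable_def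
  by (meson IntI centre_in_ball)

lemma frechet_holomorphic_on_subset:
  "frechet_holomorphic_on f U \<Longrightarrow> V \<subseteq> U \<Longrightarrow> frechet_holomorphic_on f V"
  unfolding frechet_holomorphic_on_def by blast

lemma frechet_holomorphic_on_cong:
  assumes "open U" "\<And>x. x \<in> U \<Longrightarrow> f x = g x" "frechet_holomorphic_on f U"
  shows "frechet_holomorphic_on g U"
  unfolding frechet_holomorphic_on_def
proof
  fix x assume x: "x \<in> U"
  have "\<forall>\<^sub>F y in nhds x. f y = g y"
    using eventually_nhds_in_open[OF assms(1) x] by eventually_elim (rule assms(2))
  then show "cfrechet_differentiable g x"
    using cfrechet_differentiable_cong assms(3) x unfolding frechet_holomorphic_on_def by blast
qed

named_theorems frechet_intros

lemma frechet_holomorphic_on_const [frechet_intros]: "frechet_holomorphic_on (\<lambda>_. c) U"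
  by (simp add: frechet_holomorphic_on_def)

lemma frechet_holomorphic_on_add [frechet_intros]:
  "frechet_holomorphic_on f U \<Longrightarrow> frechet_holomorphic_on g U \<Longrightarrow>
     frechet_holomorphic_on (\<lambda>x. f x + g x) U"
  by (simp add: frechet_holomorphic_on_def cfrechet_differentiable_add)

lemma frechet_holomorphic_on_diff [frechet_intros]:
  "frechet_holomorphic_on f U \<Longrightarrow> frechet_holomorphic_on g U \<Longrightarrow>
     frechet_holomorphic_on (\<lambda>x. f x - g x) U"
  by (simp add: frechet_holomorphic_on_def cfrechet_differentiable_diff)

lemma frechet_holomorphic_on_mult [frechet_intros]:
  "frechet_holomorphic_on f U \<Longrightarrow> frechet_holomorphic_on g U \<Longrightarrow>
     frechet_holomorphic_on (\<lambda>x. f x * g x) U"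
  by (simp add: frechet_holomorphic_on_def cfrechet_differentiable_mult)

lemma frechet_holomorphic_on_divide [frechet_intros]:
  "frechet_holomorphic_on f U \<Longrightarrow> frechet_holomorphic_on g U \<Longrightarrow> (\<And>x. x \<in> U \<Longrightarrow> g x \<noteq> 0) \<Longrightarrow>
     frechet_holomorphic_on (\<lambda>x. f x / g x) U"
  by (simp add: frechet_holomorphic_on_def cfrechet_differentiable_divide)

lemma frechet_holomorphic_on_sum [frechet_intros]:
  "(\<And>i. i \<in> I \<Longrightarrow> frechet_holomorphic_on (f i) U) \<Longrightarrow>
     frechet_holomorphic_on (\<lambda>x. \<Sum>i\<in>I. f i x) U"
  by (simp add: frechet_holomorphic_on_def cfrechet_differentiable_sum)

lemma fps_power_coeff_holomorphic:
  assumes "\<And>k. k < n \<Longrightarrow> frechet_holomorphic_on (\<lambda>x. fps_nth (F x) k) U" and "k < n"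
  shows "frechet_holomorphic_on (\<lambda>x. fps_nth (F x ^ d) k) U"
  using \<open>k < n\<close>
proof (induction d arbitrary: k)
  case 0
  then show ?case by (simp add: fps_one_nth frechet_holomorphic_on_const)
next
  case (Suc d)
  then show ?case unfolding power_Suc fps_mult_nth by (intro frechet_intros assms(1)) auto
qed

text \<open>With constant term 1, the \<open>n\<close>-th coefficient of \<open>F ^ d\<close> is \<open>d\<close> times that of \<open>F\<close> plus a
  polynomial in lower coefficients.\<close>

lemma fps_power_top_coeff_holomorphic:
  assumes U: "open U" and F0: "\<And>x. x \<in> U \<Longrightarrow> fps_nth (F x) 0 = 1" and n: "n > 0"
    and low: "\<And>k. k < n \<Longrightarrow> frechet_holomorphic_on (\<lambda>x. fps_nth (F x) k) U"
  shows "frechet_holomorphic_on (\<lambda>x. fps_nth (F x ^ d) n - of_nat d * fps_nth (F x) n) U"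
proof (induction d)
  case 0
  then show ?case using n by (simp add: fps_one_nth frechet_holomorphic_on_const)
next
  case (Suc d)
  have "frechet_holomorphic_on (\<lambda>x. (fps_nth (F x ^ d) n - of_nat d * fps_nth (F x) n) +
      (\<Sum>i=1..n-1. fps_nth (F x) i * fps_nth (F x ^ d) (n - i))) U"
    by (intro frechet_intros Suc.IH low fps_power_coeff_holomorphic[OF low]) (use n in auto)
  then show ?case
  proof (rule frechet_holomorphic_on_cong[OF U, rotated])
    fix x assume x: "x \<in> U"
    obtain q where q: "n = Suc q" using n by (cases n) auto
    have one: "fps_nth (F x ^ d) 0 = 1" using F0[OF x] by (simp add: fps_nth_power_0)
    have "fps_nth (F x ^ Suc d) n = fps_nth (F x) 0 * fps_nth (F x ^ d) n +
        (\<Sum>i=1..q. fps_nth (F x) i * fps_nth (F x ^ d) (n - i)) +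
        fps_nth (F x) n * fps_nth (F x ^ d) 0"
      unfolding power_Suc fps_mult_nth q
      by (subst sum.atLeast0_atMost_Suc, subst sum.atLeast_Suc_atMost) auto
    then show "fps_nth (F x ^ d) n - of_nat d * fps_nth (F x) n +
      (\<Sum>i=1..n-1. fps_nth (F x) i * fps_nth (F x ^ d) (n - i)) =
      fps_nth (F x ^ Suc d) n - of_nat (Suc d) * fps_nth (F x) n"
      using F0[OF x] one q by (simp add: algebra_simps)
  qed
qed

text \<open>Comparison of coefficients in the functional equation: the coefficient of index \<open>n\<close> on the
  right belongs to the index \<open>n div D m < n\<close>. So the coefficients at all times are obtained
  recursively, by sums, products and division by the constant \<open>D m\<close>, from those of the
  polynomials.\<close>

lemma functional_equation_coeff_holomorphic:
  fixes F :: "linf \<Rightarrow> nat \<Rightarrow> complex fps"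
  assumes U: "open U" and F0: "\<And>x m. x \<in> U \<Longrightarrow> fps_nth (F x m) 0 = 1"
    and D: "\<And>m. D m \<ge> 2"
    and a: "\<And>m j. frechet_holomorphic_on (\<lambda>x. a x m j) U"
    and eq: "\<And>x m. x \<in> U \<Longrightarrow> F x m ^ D m + (\<Sum>j<D m. fps_const (a x m j) * (fps_X ^ (D m - j) * F x m ^ j))
        = fps_compose (F x (Suc m)) (fps_X ^ D m)"
  shows "frechet_holomorphic_on (\<lambda>x. fps_nth (F x m) n) U"
proof (induction n arbitrary: m rule: less_induct)
  case (less n)
  show ?case
  proof (cases "n = 0")
    case True
    show ?thesis
      by (rule frechet_holomorphic_on_cong[OF U _ frechet_holomorphic_on_const[of 1]])
        (simp add: True F0)
  next
    case False
    have "frechet_holomorphic_on (\<lambda>x. ((if D m dvd n then fps_nth (F x (Suc m)) (n div D m) else 0)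
        - (\<Sum>j<D m. a x m j * (if n < D m - j then 0 else fps_nth (F x m ^ j) (n - (D m - j))))
        - (fps_nth (F x m ^ D m) n - of_nat (D m) * fps_nth (F x m) n)) / of_nat (D m)) U"
    proof (rule frechet_holomorphic_on_divide[OF frechet_holomorphic_on_diff[OF
          frechet_holomorphic_on_diff[OF _ frechet_holomorphic_on_sum[OF frechet_holomorphic_on_mult[OF a]]]]
          frechet_holomorphic_on_const])
      show "frechet_holomorphic_on (\<lambda>x. if D m dvd n then fps_nth (F x (Suc m)) (n div D m) else 0) U"
        using less.IH[of "n div D m" "Suc m"] False D[of m]
        by (cases "D m dvd n") (auto intro: frechet_intros)
      show "frechet_holomorphic_on
          (\<lambda>x. if n < D m - j then 0 else fps_nth (F x m ^ j) (n - (D m - j))) U"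
        if "j \<in> {..<D m}" for j
      proof (cases "n < D m - j")
        case nl: False
        have "frechet_holomorphic_on (\<lambda>x. fps_nth (F x m ^ j) (n - (D m - j))) U"
          by (rule fps_power_coeff_holomorphic[of n]) (use less.IH False that in auto)
        then show ?thesis using nl by simp
      qed (simp add: frechet_intros)
      show "frechet_holomorphic_on (\<lambda>x. fps_nth (F x m ^ D m) n - of_nat (D m) * fps_nth (F x m) n) U"
        by (rule fps_power_top_coeff_holomorphic[OF U F0]) (use False less.IH in auto)
      show "(of_nat (D m) :: complex) \<noteq> 0" using D[of m] by simp
    qed
    then show ?thesis
    proof (rule frechet_holomorphic_on_cong[OF U, rotated])
      fix x assume x: "x \<in> U"
      have "fps_nth (F x m ^ D m + (\<Sum>j<D m. fps_const (a x m j) * (fps_X ^ (D m - j) * F x m ^ j))) n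
          = (if D m dvd n then fps_nth (F x (Suc m)) (n div D m) else 0)"
        unfolding eq[OF x] by (rule fps_nth_compose_X_power)
      then have "fps_nth (F x m ^ D m) n + (\<Sum>j<D m. a x m j * (if n < D m - j then 0 else
          fps_nth (F x m ^ j) (n - (D m - j)))) =
          (if D m dvd n then fps_nth (F x (Suc m)) (n div D m) else 0)"
        by (simp add: fps_sum_nth fps_X_power_mult_nth)
      then show "((if D m dvd n then fps_nth (F x (Suc m)) (n div D m) else 0)
        - (\<Sum>j<D m. a x m j * (if n < D m - j then 0 else fps_nth (F x m ^ j) (n - (D m - j))))
        - (fps_nth (F x m ^ D m) n - of_nat (D m) * fps_nth (F x m) n)) / of_nat (D m)
        = fps_nth (F x m) n"
        using D[of m] by (simp add: field_simps)
    qed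
  qed
qed

lemma power_series_parameter_holomorphic:
  assumes U: "open U" and hol: "\<And>x. x \<in> U \<Longrightarrow> h x holomorphic_on ball 0 1"
    and B: "\<And>x u. x \<in> U \<Longrightarrow> u \<in> ball 0 1 \<Longrightarrow> cmod (h x u) \<le> B"
    and c: "\<And>n. frechet_holomorphic_on (\<lambda>x. fps_nth (fps_expansion (h x) 0) n) U"
    and u: "u \<in> ball 0 1"
  shows "frechet_holomorphic_on (\<lambda>x. h x u) U"
proof (rule frechet_holomorphic_uniform_limit)
  let ?c = "\<lambda>x n. fps_nth (fps_expansion (h x) 0) n"
  show "frechet_holomorphic_on (\<lambda>x. \<Sum>i<n. ?c x i * u ^ i) U" for n
    by (intro frechet_intros c)
  define \<rho> where "\<rho> = (1 + cmod u) / 2"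
  have \<rho>: "cmod u < \<rho>" "\<rho> < 1" "\<rho> > 0" using u by (auto simp: \<rho>_def add_pos_nonneg)
  have cb: "cmod (?c x n * u ^ n) \<le> B * (cmod u / \<rho>) ^ n" if x: "x \<in> U" for x n
  proof -
    have sub: "cball 0 \<rho> \<subseteq> ball (0::complex) 1" using \<rho> by auto
    have "cmod ((deriv ^^ n) (h x) 0) \<le> fact n * B / \<rho> ^ n"
    proof (rule Cauchy_inequality)
      show "h x holomorphic_on ball 0 \<rho>" by (rule holomorphic_on_subset[OF hol[OF x]]) (use \<rho> in auto)
      show "continuous_on (cball 0 \<rho>) (h x)"
        using holomorphic_on_imp_continuous_on[OF holomorphic_on_subset[OF hol[OF x] sub]] .
    qed (use \<rho> B[OF x] in auto)
    then have "cmod (?c x n) \<le> B / \<rho> ^ n"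
      by (simp add: fps_expansion_def norm_divide field_simps)
    then have "cmod (?c x n) * cmod u ^ n \<le> B / \<rho> ^ n * cmod u ^ n" by (rule mult_right_mono) simp
    then show ?thesis by (simp add: norm_mult norm_power power_divide)
  qed
  have sums: "(\<lambda>n. ?c x n * u ^ n) sums h x u" if "x \<in> U" for x
    using holomorphic_power_series[OF hol[OF that] u] by (simp add: fps_expansion_def)
  have "uniform_limit U (\<lambda>n x. \<Sum>i<n. ?c x i * u ^ i) (\<lambda>x. \<Sum>i. ?c x i * u ^ i) sequentially"
  proof (rule Weierstrass_m_test)
    show "summable (\<lambda>n. B * (cmod u / \<rho>) ^ n)"
      using \<rho> by (intro summable_mult summable_geometric) simp
  qed (use cb in auto)
  then have ul: "uniform_limit U (\<lambda>n x. \<Sum>i<n. ?c x i * u ^ i) (\<lambda>x. h x u) sequentially"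
    by (rule uniform_limit_cong'[THEN iffD1, rotated -1]) (auto simp: sums_unique[OF sums, symmetric])
  fix l assume "l \<in> U"
  then obtain \<delta> where "\<delta> > 0" "ball l \<delta> \<subseteq> U" using U openE by blast
  then show "\<exists>\<delta>>0. ball l \<delta> \<subseteq> U \<and>
      uniform_limit (ball l \<delta>) (\<lambda>n x. \<Sum>i<n. ?c x i * u ^ i) (\<lambda>x. h x u) sequentially"
    using uniform_limit_on_subset[OF ul] by blast
qed

lemma exterior_inverse_functional_equation:
  assumes b: "boettcher_maps P \<phi>" and e: "\<And>m. exterior_inverse (\<phi> m) (escaping P m) (\<psi> m)"
    and w: "1 < cmod w"
  shows "poly (P (Suc m)) (\<psi> m w) = \<psi> (Suc m) (w ^ degree (P (Suc m)))"
proof -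
  let ?z = "\<psi> m w"
  have z: "?z \<in> escaping P m" "\<phi> m (Some ?z) = Some w"
    using e[of m] w by (auto simp: exterior_inverse_def bij_betw_def)
  have "\<phi> (Suc m) (map_option (poly (P (Suc m))) (Some ?z)) =
      map_option (\<lambda>w. w ^ degree (P (Suc m))) (\<phi> m (Some ?z))"
    using b z(1) unfolding boettcher_maps_def basin_eq by blast
  then have *: "\<phi> (Suc m) (Some (poly (P (Suc m)) ?z)) = Some (w ^ degree (P (Suc m)))"
    using z(2) by simp
  have "poly (P (Suc m)) ?z \<in> escaping P (Suc m)" using z(1) escaping_poly_iff by blast
  then obtain v where v: "1 < cmod v" "poly (P (Suc m)) ?z = \<psi> (Suc m) v"
    using e[of "Suc m"] by (auto simp: exterior_inverse_def bij_betw_def)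
  then show ?thesis using * e[of "Suc m"] by (auto simp: exterior_inverse_def)
qed

text \<open>In the form \<open>\<psi> w = w * h (1 / w)\<close> the functional equation is an identity between power series
  on the unit disc, whose coefficients are holomorphic in the parameter. The bound on \<open>h\<close> is uniform
  in the parameter, and so is the convergence of its series.\<close>

lemma monic_boettcher_inverse_parameter:
  assumes U: "open U" and bd: "\<And>x. x \<in> U \<Longrightarrow> bounded_poly_seq d K M (P x)"
    and mon: "\<And>x m. x \<in> U \<Longrightarrow> m \<ge> 1 \<Longrightarrow> lead_coeff (P x m) = 1"
    and deg: "\<And>x m. x \<in> U \<Longrightarrow> m \<ge> 1 \<Longrightarrow> degree (P x m) = D m"
    and co: "\<And>m n. m \<ge> 1 \<Longrightarrow> frechet_holomorphic_on (\<lambda>x. coeff (P x m) n) U"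
    and b: "\<And>x. x \<in> U \<Longrightarrow> boettcher_maps (P x) (\<phi> x)"
    and e: "\<And>x m. x \<in> U \<Longrightarrow> exterior_inverse (\<phi> x m) (escaping (P x) m) (\<psi> x m)"
    and nrm: "\<And>x m. x \<in> U \<Longrightarrow> ((\<lambda>w. \<psi> x m w / w) \<longlongrightarrow> 1) at_infinity"
    and w: "1 < cmod w"
  shows "frechet_holomorphic_on (\<lambda>x. \<psi> x m w) U"
proof -
  define r where "r = escape_radius d K M"
  define R where "R x m h \<longleftrightarrow> h holomorphic_on ball 0 1 \<and> h 0 = 1 \<and>
     (\<forall>u\<in>ball 0 1. cmod (h u) \<le> r + 2) \<and>
     (\<forall>w. 1 < cmod w \<longrightarrow> \<psi> x m w = w * h (inverse w))" for x m h
  define h where "h x m = (SOME h. R x m h)" for x m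
  have R: "R x m (h x m)" if x: "x \<in> U" for x m
  proof -
    have nf: "((\<lambda>z. the (\<phi> x m (Some z)) / z) \<longlongrightarrow> 1) at_infinity"
      using b[OF x] by (simp add: boettcher_maps_def)
    have r0: "r > 0" using escape_radius_ge[OF bd[OF x]] by (simp add: r_def)
    have out: "z \<in> escaping (P x) m" if "cmod z \<ge> r" for z
      using outside_escape_radius[OF bd[OF x]] that unfolding r_def .
    have "\<exists>h. R x m h"
    proof (rule exterior_inverse_bound[OF e[OF x] nrm[OF x] nf r0 out])
      fix h
      assume "h holomorphic_on ball 0 1" "h 0 = 1" "\<And>u. u \<in> ball 0 1 \<Longrightarrow> cmod (h u) \<le> r + 2"
        "\<And>w. 1 < cmod w \<Longrightarrow> \<psi> x m w = w * h (inverse w)"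
      then have "R x m h" unfolding R_def by simp
      then show "\<exists>h. R x m h" by (rule exI[of "R x m"])
    qed
    then show ?thesis unfolding h_def by (rule someI_ex)
  qed
  have h: "\<And>x m. x \<in> U \<Longrightarrow> h x m holomorphic_on ball 0 1" "\<And>x m. x \<in> U \<Longrightarrow> h x m 0 = 1"
      "\<And>x m u. x \<in> U \<Longrightarrow> u \<in> ball 0 1 \<Longrightarrow> cmod (h x m u) \<le> r + 2"
      "\<And>x m w. x \<in> U \<Longrightarrow> 1 < cmod w \<Longrightarrow> \<psi> x m w = w * h x m (inverse w)"
    using R unfolding R_def by blast+
  define E where "E m = D (Suc m)" for m
  have E: "E m \<ge> 2" if "x \<in> U" for x m
    using bounded_poly_seq_degree[OF bd[OF that], of "Suc m"] deg[OF that, of "Suc m"] by (simp add: E_def)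
  define F where "F x m = fps_expansion (h x m) 0" for x m
  have hF: "h x m has_fps_expansion F x m" if "x \<in> U" for x m
    unfolding F_def by (rule has_fps_expansion_fps_expansion[OF open_ball _ h(1)[OF that]]) simp
  have eq: "h x m u ^ E m + (\<Sum>j<E m. coeff (P x (Suc m)) j * (u ^ (E m - j) * h x m u ^ j))
      = h x (Suc m) (u ^ E m)" if x: "x \<in> U" and u: "u \<in> ball 0 1" for x m u
  proof (cases "u = 0")
    case True
    then show ?thesis using h(2)[OF x] E[OF x, of m] by (simp add: power_0_left)
  next
    case False
    let ?w = "inverse u" and ?z = "\<psi> x m (inverse u)"
    have w: "1 < cmod ?w" using u False by (simp add: norm_inverse one_less_inverse_iff)
    have dP: "degree (P x (Suc m)) = E m" using deg[OF x] by (simp add: E_def)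
    have z: "?z = h x m u / u" using h(4)[OF x w] by (simp add: divide_inverse mult.commute)
    have w': "1 < cmod (?w ^ E m)"
      unfolding norm_power using w E[OF x, of m] by (intro one_less_power) auto
    have "poly (P x (Suc m)) ?z = \<psi> x (Suc m) (?w ^ E m)"
      using exterior_inverse_functional_equation[OF b[OF x] e[OF x] w, of m] dP by simp
    also have "\<dots> = h x (Suc m) (u ^ E m) / u ^ E m"
      using h(4)[OF x w'] by (simp add: power_inverse divide_inverse mult.commute)
    finally have "h x (Suc m) (u ^ E m) = u ^ E m * poly (P x (Suc m)) ?z"
      using False by simp
    also have "poly (P x (Suc m)) ?z = ?z ^ E m + (\<Sum>j<E m. coeff (P x (Suc m)) j * ?z ^ j)"
      using mon[OF x, of "Suc m"] dP unfolding poly_altdef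
      by (simp add: lessThan_Suc_atMost[symmetric])
    also have "u ^ E m * (?z ^ E m + (\<Sum>j<E m. coeff (P x (Suc m)) j * ?z ^ j)) =
        h x m u ^ E m + (\<Sum>j<E m. coeff (P x (Suc m)) j * (u ^ (E m - j) * h x m u ^ j))"
    proof -
      have "u ^ E m * (coeff (P x (Suc m)) j * ?z ^ j) =
          coeff (P x (Suc m)) j * (u ^ (E m - j) * h x m u ^ j)" if "j < E m" for j
      proof -
        have "u ^ E m = u ^ (E m - j) * u ^ j" using that by (simp add: power_add[symmetric])
        then show ?thesis using False by (simp add: z power_divide)
      qed
      then show ?thesis using False by (simp add: distrib_left sum_distrib_left z power_divide)
    qed
    finally show ?thesis by simp
  qed
  have "frechet_holomorphic_on (\<lambda>x. fps_nth (F x m) n) U" for m n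
  proof (cases "U = {}")
    case True
    then show ?thesis by (simp add: frechet_holomorphic_on_def)
  next
    case False
    then have E2: "E m \<ge> 2" for m using E by blast
    show ?thesis
    proof (rule functional_equation_coeff_holomorphic[where a = "\<lambda>x m j. coeff (P x (Suc m)) j" and D = E])
      show "fps_nth (F x m) 0 = 1" if "x \<in> U" for x m
        using h(2)[OF that] by (simp add: F_def fps_expansion_def)
      fix x m assume x: "x \<in> U"
      let ?L = "F x m ^ E m + (\<Sum>j<E m. fps_const (coeff (P x (Suc m)) j) * (fps_X ^ (E m - j) * F x m ^ j))"
      have 1: "(\<lambda>u. h x m u ^ E m + (\<Sum>j<E m. coeff (P x (Suc m)) j * (u ^ (E m - j) * h x m u ^ j)))
          has_fps_expansion ?L"
        by (intro fps_expansion_intros hF x)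
      have 3: "(h x (Suc m) \<circ> (\<lambda>u. u ^ E m)) has_fps_expansion fps_compose (F x (Suc m)) (fps_X ^ E m)"
        by (intro fps_expansion_intros hF x) (use E2[of m] in \<open>simp add: fps_X_power_nth\<close>)
      have ev: "\<forall>\<^sub>F u in nhds 0. (h x (Suc m) \<circ> (\<lambda>u. u ^ E m)) u =
         h x m u ^ E m + (\<Sum>j<E m. coeff (P x (Suc m)) j * (u ^ (E m - j) * h x m u ^ j))"
        using eventually_nhds_in_open[OF open_ball, of 0 0 1]
        by (rule eventually_mono) (use eq[OF x] in simp_all)
      have 2: "(\<lambda>u. h x m u ^ E m + (\<Sum>j<E m. coeff (P x (Suc m)) j * (u ^ (E m - j) * h x m u ^ j)))
          has_fps_expansion fps_compose (F x (Suc m)) (fps_X ^ E m)"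
        by (rule iffD1[OF has_fps_expansion_cong[OF ev refl] 3])
      show "?L = fps_compose (F x (Suc m)) (fps_X ^ E m)"
        by (rule fps_expansion_unique_complex[OF 1 2])
    qed (use U E2 co in auto)
  qed
  then have "frechet_holomorphic_on (\<lambda>x. h x m (inverse w)) U"
    using w by (intro power_series_parameter_holomorphic[OF U h(1,3)])
      (auto simp: F_def norm_inverse inverse_less_1_iff)
  then have "frechet_holomorphic_on (\<lambda>x. w * h x m (inverse w)) U" by (intro frechet_intros)
  then show "frechet_holomorphic_on (\<lambda>x. \<psi> x m w) U"
    by (rule frechet_holomorphic_on_cong[OF U, rotated]) (use h(4) w in simp)
qed

section \<open>Inverse Boettcher maps of a family conjugate to a monic one\<close>

lemma conjugacy_Q:
  assumes "\<And>m z. chi (Suc m) (poly (P (Suc m)) z) = poly (P' (Suc m)) (chi m z)" and "m \<le> n"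
  shows "chi n (Q P m n z) = Q P' m n (chi m z)"
  using \<open>m \<le> n\<close> by (induction n rule: dec_induct) (simp_all add: Q_Suc assms(1))

lemma escaping_conjugacy:
  assumes chi: "\<And>m z. \<alpha> (Suc m) * poly (P (Suc m)) z + \<beta> (Suc m) = poly (P' (Suc m)) (\<alpha> m * z + \<beta> m)"
    and bd: "a > 0" "\<And>m. a \<le> cmod (\<alpha> m)" "\<And>m. cmod (\<alpha> m) \<le> b" "\<And>m. cmod (\<beta> m) \<le> b"
  shows "\<alpha> m * z + \<beta> m \<in> escaping P' m \<longleftrightarrow> z \<in> escaping P m"
proof -
  have b: "b > 0" using bd(1) bd(2,3)[of 0] by linarith
  let ?x = "\<lambda>n. cmod (Q P m n z)" and ?y = "\<lambda>n. cmod (Q P' m n (\<alpha> m * z + \<beta> m))"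
  have eq: "\<alpha> n * Q P m n z + \<beta> n = Q P' m n (\<alpha> m * z + \<beta> m)" if "m \<le> n" for n
    using conjugacy_Q[of "\<lambda>n z. \<alpha> n * z + \<beta> n" P P' m n z, OF chi that] .
  have up: "?y n \<le> b * ?x n + b" and low: "a * ?x n - b \<le> ?y n" if "m \<le> n" for n
  proof -
    have "?y n \<le> cmod (\<alpha> n) * ?x n + cmod (\<beta> n)"
      unfolding eq[OF that, symmetric] by (rule norm_triangle_le) (simp add: norm_mult)
    also have "\<dots> \<le> b * ?x n + b" by (intro add_mono mult_right_mono bd) simp
    finally show "?y n \<le> b * ?x n + b" .
    have "a * ?x n - b \<le> cmod (\<alpha> n) * ?x n - cmod (\<beta> n)"
      by (intro diff_mono mult_right_mono bd) simp
    also have "\<dots> \<le> ?y n"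
      unfolding eq[OF that, symmetric] using norm_diff_ineq[of "\<alpha> n * Q P m n z" "\<beta> n"]
      by (simp add: norm_mult)
    finally show "a * ?x n - b \<le> ?y n" .
  qed
  have "filterlim ?y at_top sequentially" if "filterlim ?x at_top sequentially"
  proof (rule filterlim_at_top_mono)
    have "filterlim (\<lambda>n. - b + a * ?x n) at_top sequentially"
      by (intro filterlim_tendsto_add_at_top[OF tendsto_const]
          filterlim_tendsto_pos_mult_at_top[OF tendsto_const bd(1) that])
    then show "filterlim (\<lambda>n. a * ?x n - b) at_top sequentially" by (simp add: algebra_simps)
    show "\<forall>\<^sub>F n in sequentially. a * ?x n - b \<le> ?y n"
      using eventually_ge_at_top[of m] by eventually_elim (rule low)
  qed
  moreover have "filterlim ?x at_top sequentially" if "filterlim ?y at_top sequentially"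
  proof (rule filterlim_at_top_mono)
    show "filterlim (\<lambda>n. - 1 + 1 / b * ?y n) at_top sequentially"
      by (intro filterlim_tendsto_add_at_top[OF tendsto_const]
          filterlim_tendsto_pos_mult_at_top[OF tendsto_const _ that]) (use b in simp)
    show "\<forall>\<^sub>F n in sequentially. - 1 + 1 / b * ?y n \<le> ?x n"
      using eventually_ge_at_top[of m]
    proof eventually_elim
      case (elim n)
      show ?case using up[OF elim] b by (simp add: field_simps)
    qed
  qed
  ultimately show ?thesis unfolding escaping_def by blast
qed

lemma degree_conjugacy:
  fixes p q :: "complex poly"
  assumes "\<And>z. a * poly p z + b = poly q (c * z + e)" and "a \<noteq> 0" "c \<noteq> 0"
  shows "degree p = degree q"
proof -
  have "pcompose [:b, a:] p = pcompose q [:e, c:]"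
    by (rule poly_ext) (use assms(1) in \<open>simp add: poly_pcompose algebra_simps\<close>)
  then have "degree (pcompose [:b, a:] p) = degree (pcompose q [:e, c:])" by simp
  then show ?thesis using assms(2,3) by (simp add: degree_pcompose)
qed

lemma boettcher_family_conjugate:
  assumes "boettcher_family \<Lambda> \<Omega> P \<phi>" "analytic_family \<Lambda> P"
  obtains P' \<alpha> \<beta> \<phi>' where "analytic_family \<Lambda> P'" "monic_family \<Lambda> P'" "conjugacy_by \<Lambda> \<alpha> \<beta> P P'"
    "\<And>l. l \<in> \<Omega> \<Longrightarrow> boettcher_maps (P' l) (\<phi>' l)"
    "\<And>l m x. l \<in> \<Omega> \<Longrightarrow> x \<in> basin (P l) m \<Longrightarrow>
        \<phi> l m x = \<phi>' l m (map_option (\<lambda>z. \<alpha> m l * z + \<beta> m l) x)"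
proof -
  \<comment> \<open>A monic family is conjugate to itself by the identity.\<close>
  have triv: "conjugacy_by \<Lambda> (\<lambda>_ _. 1) (\<lambda>_ _. 0) P P"
    unfolding conjugacy_by_def
    by (auto simp: frechet_holomorphic_on_const intro!: exI[of _ "1::real"])
  have triv2: "x = map_option (\<lambda>z. 1 * z + 0) x" for x :: csphere by (simp add: option.map_ident)
  from assms(1) show thesis
    unfolding boettcher_family_def
  proof (elim disjE exE conjE)
    assume "monic_family \<Lambda> P" "\<forall>l\<in>\<Omega>. boettcher_maps (P l) (\<phi> l)"
    then show thesis
      by (intro that[OF assms(2) _ triv, of \<phi>]) (use triv2 in auto)
  next
    fix P' \<alpha> \<beta> \<phi>'
    assume *: "analytic_family \<Lambda> P'" "monic_family \<Lambda> P'" "conjugacy_by \<Lambda> \<alpha> \<beta> P P'"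
      and **: "\<forall>l\<in>\<Omega>. boettcher_maps (P' l) (\<phi>' l) \<and> (\<forall>m. \<forall>x\<in>basin (P l) m.
           \<phi> l m x = \<phi>' l m (map_option (\<lambda>z. \<alpha> m l * z + \<beta> m l) x))"
    show thesis by (rule that[OF *]) (use ** in blast)+
  qed
qed

text \<open>The inverse maps of the monic family, transported by the conjugacy. As the bounds on the
  conjugacy are uniform in the time, so is the growth bound in the third part.\<close>

lemma boettcher_family_inverse:
  assumes \<Lambda>: "open \<Lambda>" and fam: "analytic_family \<Lambda> P" and \<Omega>: "\<Omega> \<subseteq> \<Lambda>"
    and bf: "boettcher_family \<Lambda> \<Omega> P \<phi>"
  obtains S :: "linf \<Rightarrow> nat \<Rightarrow> complex \<Rightarrow> complex" where
    "\<And>l m. l \<in> \<Omega> \<Longrightarrow> exterior_inverse (\<phi> l m) (escaping (P l) m) (S l m)"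
    "\<And>l m w. l \<in> \<Omega> \<Longrightarrow> 1 < cmod w \<Longrightarrow>
       poly (P l (Suc m)) (S l m w) = S l (Suc m) (w ^ degree (P l (Suc m)))"
    "\<And>l. l \<in> \<Omega> \<Longrightarrow> \<exists>\<delta>>0. \<exists>d K M B. ball l \<delta> \<subseteq> \<Lambda> \<and> (\<forall>x\<in>ball l \<delta>. bounded_poly_seq d K M (P x)) \<and>
       (\<forall>x\<in>ball l \<delta> \<inter> \<Omega>. \<forall>m w. 1 < cmod w \<longrightarrow> cmod (S x m w) \<le> B * cmod w)"
    "\<And>m w. open \<Omega> \<Longrightarrow> 1 < cmod w \<Longrightarrow> frechet_holomorphic_on (\<lambda>l. S l m w) \<Omega>"
proof -
  obtain P' \<alpha> \<beta> \<phi>' where fam': "analytic_family \<Lambda> P'" and mon: "monic_family \<Lambda> P'"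
    and cj: "conjugacy_by \<Lambda> \<alpha> \<beta> P P'"
    and b: "\<And>l. l \<in> \<Omega> \<Longrightarrow> boettcher_maps (P' l) (\<phi>' l)"
    and \<phi>: "\<And>l m x. l \<in> \<Omega> \<Longrightarrow> x \<in> basin (P l) m \<Longrightarrow>
        \<phi> l m x = \<phi>' l m (map_option (\<lambda>z. \<alpha> m l * z + \<beta> m l) x)"
    using boettcher_family_conjugate[OF bf fam] by metis
  have ab: "\<exists>\<delta>>0. \<exists>a>0. \<exists>b. \<forall>l'\<in>\<Lambda> \<inter> ball l \<delta>. \<forall>m.
        a \<le> cmod (\<alpha> m l') \<and> cmod (\<alpha> m l') \<le> b \<and> cmod (\<beta> m l') \<le> b" if "l \<in> \<Lambda>" for l
    using cj that unfolding conjugacy_by_def by blast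
  have chi: "\<alpha> (Suc m) l * poly (P l (Suc m)) z + \<beta> (Suc m) l =
      poly (P' l (Suc m)) (\<alpha> m l * z + \<beta> m l)" if "l \<in> \<Lambda>" for l m z
    using cj that unfolding conjugacy_by_def by (metis diff_Suc_1 le_add1 plus_1_eq_Suc)
  have hol\<alpha>: "frechet_holomorphic_on (\<alpha> m) \<Lambda>" "frechet_holomorphic_on (\<beta> m) \<Lambda>" for m
    using cj unfolding conjugacy_by_def by blast+
  have \<alpha>0: "\<alpha> m l \<noteq> 0" if "l \<in> \<Lambda>" for l m
  proof -
    obtain \<delta> a b where "\<delta> > 0" "a > 0" "\<forall>l'\<in>\<Lambda> \<inter> ball l \<delta>. \<forall>m.
        a \<le> cmod (\<alpha> m l') \<and> cmod (\<alpha> m l') \<le> b \<and> cmod (\<beta> m l') \<le> b" using ab[OF \<open>l \<in> \<Lambda>\<close>] by blast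
    then have "a \<le> cmod (\<alpha> m l)" using that by simp
    then show ?thesis using \<open>a > 0\<close> by auto
  qed
  have esc: "\<alpha> m l * z + \<beta> m l \<in> escaping (P' l) m \<longleftrightarrow> z \<in> escaping (P l) m" if l: "l \<in> \<Lambda>" for l m z
  proof -
    obtain \<delta> a b where ab': "\<delta> > 0" "a > 0" "\<forall>l'\<in>\<Lambda> \<inter> ball l \<delta>. \<forall>m.
        a \<le> cmod (\<alpha> m l') \<and> cmod (\<alpha> m l') \<le> b \<and> cmod (\<beta> m l') \<le> b" using ab[OF l] by blast
    have "l \<in> \<Lambda> \<inter> ball l \<delta>" using l ab'(1) by simp
    then have *: "\<forall>m. a \<le> cmod (\<alpha> m l) \<and> cmod (\<alpha> m l) \<le> b \<and> cmod (\<beta> m l) \<le> b" using ab'(3) by blast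
    show ?thesis
      by (rule escaping_conjugacy[where a = a and b = b and \<alpha> = "\<lambda>m. \<alpha> m l" and \<beta> = "\<lambda>m. \<beta> m l"])
        (use * ab'(2) chi[OF l] in auto)
  qed
  have deg: "degree (P l (Suc m)) = degree (P' l (Suc m))" if "l \<in> \<Lambda>" for l m
    by (rule degree_conjugacy[OF chi[OF that] \<alpha>0[OF that] \<alpha>0[OF that]])
  define N where "N l m \<psi> \<longleftrightarrow> exterior_inverse (\<phi>' l m) (escaping (P' l) m) \<psi> \<and>
      ((\<lambda>w. \<psi> w / w) \<longlongrightarrow> 1) at_infinity" for l m \<psi>
  define \<psi> where "\<psi> l m = (SOME \<psi>. N l m \<psi>)" for l m
  have N: "N l m (\<psi> l m)" if l: "l \<in> \<Omega>" for l m
  proof -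
    have "conformal_bijection (\<phi>' l m) (insert None (Some ` escaping (P' l) m)) disc_exterior"
      "((\<lambda>z. the (\<phi>' l m (Some z)) / z) \<longlongrightarrow> 1) at_infinity"
      using b[OF l] by (auto simp: boettcher_maps_def basin_eq)
    then have "\<exists>\<psi>. N l m \<psi>"
      by (rule exterior_inverse_exists) (use N_def in blast)
    then show ?thesis unfolding \<psi>_def by (rule someI_ex)
  qed
  have e: "exterior_inverse (\<phi>' l m) (escaping (P' l) m) (\<psi> l m)"
    and nrm: "((\<lambda>w. \<psi> l m w / w) \<longlongrightarrow> 1) at_infinity" if "l \<in> \<Omega>" for l m
    using N[OF that, of m] by (auto simp: N_def)
  define S where "S l m w = (\<psi> l m w - \<beta> m l) / \<alpha> m l" for l m w
  have S\<psi>: "\<alpha> m l * S l m w + \<beta> m l = \<psi> l m w" if "l \<in> \<Omega>" for l m w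
    using \<alpha>0[of l m] that \<Omega> by (auto simp: S_def)
  have 1: "exterior_inverse (\<phi> l m) (escaping (P l) m) (S l m)" if l: "l \<in> \<Omega>" for l m
    unfolding exterior_inverse_def
  proof (intro conjI allI impI)
    have l': "l \<in> \<Lambda>" using l \<Omega> by blast
    note ee = e[OF l, of m, unfolded exterior_inverse_def]
    show "\<phi> l m None = None" using \<phi>[OF l, of None m] ee by (simp add: basin_eq)
    show "S l m holomorphic_on {w. 1 < cmod w}"
      unfolding S_def using ee \<alpha>0[OF l'] by (intro holomorphic_intros) auto
    have bij: "bij_betw (\<psi> l m) {w. 1 < cmod w} (escaping (P' l) m)" using ee by blast
    show "bij_betw (S l m) {w. 1 < cmod w} (escaping (P l) m)"
    proof (rule bij_betwI')
      fix x y assume "x \<in> {w. 1 < cmod w}" "y \<in> {w. 1 < cmod w}"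
      then show "S l m x = S l m y \<longleftrightarrow> x = y"
        using bij_betw_imp_inj_on[OF bij] \<alpha>0[OF l'] by (auto simp: S_def dest: inj_onD)
    next
      fix x assume "x \<in> {w. 1 < cmod w}"
      then have "\<psi> l m x \<in> escaping (P' l) m" using bij by (auto simp: bij_betw_def)
      then show "S l m x \<in> escaping (P l) m" using esc[OF l', of m "S l m x"] S\<psi>[OF l] by simp
    next
      fix z assume "z \<in> escaping (P l) m"
      then have "\<alpha> m l * z + \<beta> m l \<in> \<psi> l m ` {w. 1 < cmod w}"
        using esc[OF l'] bij by (simp add: bij_betw_def)
      then obtain w where "w \<in> {w. 1 < cmod w}" "\<psi> l m w = \<alpha> m l * z + \<beta> m l" by auto
      then show "\<exists>w\<in>{w. 1 < cmod w}. z = S l m w" using \<alpha>0[OF l'] by (auto simp: S_def)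
    qed
    then have Sin: "S l m w \<in> escaping (P l) m" if "1 < cmod w" for w
      using that by (auto simp: bij_betw_def)
    show "\<phi> l m (Some (S l m w)) = Some w" if "1 < cmod w" for w
      using \<phi>[OF l, of "Some (S l m w)" m] Sin[OF that] ee that S\<psi>[OF l] by (simp add: basin_eq)
    have "filterlim (\<lambda>w. \<psi> l m w + - \<beta> m l) at_infinity at_infinity"
      by (rule tendsto_add_filterlim_at_infinity') (use ee in auto)
    then have "filterlim (\<lambda>w. 1 / \<alpha> m l * (\<psi> l m w + - \<beta> m l)) at_infinity at_infinity"
      by (intro tendsto_mult_filterlim_at_infinity[OF tendsto_const]) (use \<alpha>0[OF l'] in auto)
    then show "filterlim (S l m) at_infinity at_infinity" unfolding S_def by simp
  qed
  have 2: "poly (P l (Suc m)) (S l m w) = S l (Suc m) (w ^ degree (P l (Suc m)))"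
    if l: "l \<in> \<Omega>" and w: "1 < cmod w" for l m w
  proof -
    have l': "l \<in> \<Lambda>" using l \<Omega> by blast
    have "\<alpha> (Suc m) l * poly (P l (Suc m)) (S l m w) + \<beta> (Suc m) l = poly (P' l (Suc m)) (\<psi> l m w)"
      using chi[OF l', of m "S l m w"] S\<psi>[OF l] by simp
    also have "\<dots> = \<psi> l (Suc m) (w ^ degree (P l (Suc m)))"
      unfolding deg[OF l'] by (rule exterior_inverse_functional_equation[OF b[OF l] e[OF l] w])
    finally have eq: "\<psi> l (Suc m) (w ^ degree (P l (Suc m))) =
       \<alpha> (Suc m) l * poly (P l (Suc m)) (S l m w) + \<beta> (Suc m) l" by simp
    show ?thesis using \<alpha>0[OF l', of "Suc m"] unfolding S_def[of l "Suc m"] eq by simp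
  qed
  have 3: "\<exists>\<delta>>0. \<exists>d K M B. ball l \<delta> \<subseteq> \<Lambda> \<and> (\<forall>x\<in>ball l \<delta>. bounded_poly_seq d K M (P x)) \<and>
       (\<forall>x\<in>ball l \<delta> \<inter> \<Omega>. \<forall>m w. 1 < cmod w \<longrightarrow> cmod (S x m w) \<le> B * cmod w)" if l: "l \<in> \<Omega>" for l
  proof -
    have l': "l \<in> \<Lambda>" using l \<Omega> by blast
    obtain \<delta>1 B1 d K M where d1: "\<delta>1 > 0" "ball l \<delta>1 \<subseteq> \<Lambda>"
      "\<And>x. x \<in> ball l \<delta>1 \<Longrightarrow> bounded_poly_seq d K M (P x)"
      using analytic_family_coeff_Lipschitz[OF \<Lambda> fam l'] by metis
    obtain \<delta>2 B2 d' K' M' where d2: "\<delta>2 > 0"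
      "\<And>x. x \<in> ball l \<delta>2 \<Longrightarrow> bounded_poly_seq d' K' M' (P' x)"
      using analytic_family_coeff_Lipschitz[OF \<Lambda> fam' l'] by metis
    obtain \<delta>3 a c where d3: "\<delta>3 > 0" "a > 0" "\<forall>l'\<in>\<Lambda> \<inter> ball l \<delta>3. \<forall>m.
        a \<le> cmod (\<alpha> m l') \<and> cmod (\<alpha> m l') \<le> c \<and> cmod (\<beta> m l') \<le> c" using ab[OF l'] by blast
    define r where "r = escape_radius d' K' M'"
    define \<delta> where "\<delta> = min \<delta>1 (min \<delta>2 \<delta>3)"
    have "cmod (S x m w) \<le> (r + 2 + c) / a * cmod w" if x: "x \<in> ball l \<delta> \<inter> \<Omega>" and w: "1 < cmod w" for x m w
    proof -
      have x2: "x \<in> ball l \<delta>2" "x \<in> \<Lambda> \<inter> ball l \<delta>3" "x \<in> \<Omega>" using x \<Omega> by (auto simp: \<delta>_def)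
      have nf: "((\<lambda>z. the (\<phi>' x m (Some z)) / z) \<longlongrightarrow> 1) at_infinity"
        using b[OF x2(3)] by (simp add: boettcher_maps_def)
      have r0: "r > 0" using escape_radius_ge[OF d2(2)[OF x2(1)]] by (simp add: r_def)
      have out: "z \<in> escaping (P' x) m" if "cmod z \<ge> r" for z
        using outside_escape_radius[OF d2(2)[OF x2(1)]] that unfolding r_def .
      have "cmod (\<psi> x m w - w) \<le> r + 1"
        by (rule exterior_inverse_bound[OF e[OF x2(3)] nrm[OF x2(3)] nf r0 out]) (use w in blast)+
      then have 4: "cmod (\<psi> x m w) \<le> r + 1 + cmod w"
        using norm_triangle_sub[of "\<psi> x m w" w] by simp
      have \<alpha>\<beta>: "a \<le> cmod (\<alpha> m x)" "cmod (\<beta> m x) \<le> c" using d3(3) x2(2) by blast+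
      have c0: "c \<ge> 0" using \<alpha>\<beta>(2) norm_ge_zero[of "\<beta> m x"] by linarith
      have "cmod (\<psi> x m w - \<beta> m x) \<le> (r + 1 + cmod w) + c"
        by (rule order_trans[OF norm_triangle_ineq4 add_mono[OF 4 \<alpha>\<beta>(2)]])
      also have "\<dots> \<le> (r + 2 + c) * cmod w"
      proof -
        have "(r + 1 + c) * 1 \<le> (r + 1 + c) * cmod w" using w r0 c0 by (intro mult_left_mono) auto
        then show ?thesis by (simp add: algebra_simps)
      qed
      finally have 5: "cmod (\<psi> x m w - \<beta> m x) \<le> (r + 2 + c) * cmod w" .
      have "cmod (S x m w) \<le> (r + 2 + c) * cmod w / a"
        unfolding S_def norm_divide using 5 \<alpha>\<beta>(1) d3(2) r0 c0 by (intro frac_le) auto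
      then show ?thesis by simp
    qed
    moreover have "\<delta> > 0" "ball l \<delta> \<subseteq> \<Lambda>" "\<forall>x\<in>ball l \<delta>. bounded_poly_seq d K M (P x)"
      using d1 d2(1) d3(1) by (auto simp: \<delta>_def)
    ultimately show ?thesis by blast
  qed
  have 4: "frechet_holomorphic_on (\<lambda>l. S l m w) \<Omega>" if op: "open \<Omega>" and w: "1 < cmod w" for m w
  proof -
    have "cfrechet_differentiable (\<lambda>l. \<psi> l m w) l" if l: "l \<in> \<Omega>" for l
    proof -
      have l': "l \<in> \<Lambda>" using l \<Omega> by blast
      obtain \<delta>1 B1 d K M where d1: "\<delta>1 > 0" "\<And>x. x \<in> ball l \<delta>1 \<Longrightarrow> bounded_poly_seq d K M (P' x)"
        using analytic_family_coeff_Lipschitz[OF \<Lambda> fam' l'] by metis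
      obtain \<delta>2 where d2: "\<delta>2 > 0" "\<forall>x\<in>ball l \<delta>2. \<forall>m\<ge>1. degree (P' x m) = degree (P' l m)"
        using analytic_family_degree_locally_constant[OF \<Lambda> fam' l'] by blast
      define U where "U = \<Omega> \<inter> ball l \<delta>1 \<inter> ball l \<delta>2"
      have U: "open U" "l \<in> U" "U \<subseteq> \<Omega>" "U \<subseteq> \<Lambda>" using op d1(1) d2(1) l \<Omega> by (auto simp: U_def)
      have "frechet_holomorphic_on (\<lambda>x. \<psi> x m w) U"
      proof (rule monic_boettcher_inverse_parameter[where D = "\<lambda>m. degree (P' l m)" and P = P' and \<phi> = \<phi>'])
        show "lead_coeff (P' x m) = 1" if "x \<in> U" "m \<ge> 1" for x m
          using mon that U(4) unfolding monic_family_def by blast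
        show "frechet_holomorphic_on (\<lambda>x. coeff (P' x m) n) U" if "m \<ge> 1" for m n
          using frechet_holomorphic_on_subset[OF analytic_family_coeff_holomorphic[OF fam' \<Lambda> that] U(4)] .
        show "\<And>x m. x \<in> U \<Longrightarrow> 1 \<le> m \<Longrightarrow> degree (P' x m) = degree (P' l m)"
          using d2(2) by (simp add: U_def)
        show "\<And>x. x \<in> U \<Longrightarrow> bounded_poly_seq d K M (P' x)" using d1(2) by (simp add: U_def)
      qed (use U w b e nrm in blast)+
      then show ?thesis using U(2) unfolding frechet_holomorphic_on_def by blast
    qed
    then have "frechet_holomorphic_on (\<lambda>l. \<psi> l m w) \<Omega>" unfolding frechet_holomorphic_on_def by blast
    then show ?thesis
      unfolding S_def using frechet_holomorphic_on_subset[OF hol\<alpha>(1) \<Omega>]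
        frechet_holomorphic_on_subset[OF hol\<alpha>(2) \<Omega>] \<alpha>0 \<Omega>
      by (intro frechet_intros) auto
  qed
  show thesis by (rule that[OF 1 2 3 4])
qed

section \<open>Expansion on the basin and landing of the external rays\<close>

text \<open>A single bounded sequence with the inverses of its Boettcher maps. The linear bound, which is
  uniform in the time, replaces a normalization at infinity.\<close>

locale boettcher_sequence =
  fixes P :: "nat \<Rightarrow> complex poly" and d :: nat and K M B :: real
    and S :: "nat \<Rightarrow> complex \<Rightarrow> complex"
  assumes bounded: "bounded_poly_seq d K M P"
    and bij: "bij_betw (S m) {w. 1 < cmod w} (escaping P m)"
    and hol: "S m holomorphic_on {w. 1 < cmod w}"
    and S_inf: "filterlim (S m) at_infinity at_infinity"
    and S_eq: "1 < cmod w \<Longrightarrow> poly (P (Suc m)) (S m w) = S (Suc m) (w ^ degree (P (Suc m)))"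
    and S_bound: "1 < cmod w \<Longrightarrow> cmod (S m w) \<le> B * cmod w"
begin

definition deg :: "nat \<Rightarrow> nat \<Rightarrow> nat" where
  "deg m n = (\<Prod>k\<in>{m<..n}. degree (P k))"

lemma deg_same [simp]: "deg m m = 1"
  by (simp add: deg_def)

lemma deg_Suc: "m \<le> n \<Longrightarrow> deg m (Suc n) = deg m n * degree (P (Suc n))"
  by (simp add: deg_def atLeastSucAtMost_greaterThanAtMost[symmetric] mult.commute)

lemma degree_bounds: "2 \<le> degree (P (Suc m))" "degree (P (Suc m)) \<le> d"
  using bounded_poly_seq_degree[OF bounded, of "Suc m"] by auto

lemma deg_ge: "m \<le> n \<Longrightarrow> 2 ^ (n - m) \<le> deg m n"
proof (induction n rule: dec_induct)
  case (step n)
  have "2 ^ (n - m) * 2 \<le> deg m n * degree (P (Suc n))"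
    using step degree_bounds(1)[of n] by (intro mult_mono) auto
  then show ?case using step by (simp add: deg_Suc Suc_diff_le mult.commute)
qed simp

lemma deg_pos: "m \<le> n \<Longrightarrow> deg m n > 0"
  using deg_ge[of m n] by (meson less_le_trans zero_less_numeral zero_less_power)

lemma open_exterior: "open {w::complex. 1 < cmod w}"
  by (intro open_Collect_less continuous_intros)

lemma S_in: "1 < cmod w \<Longrightarrow> S m w \<in> escaping P m"
  using bij[of m] by (auto simp: bij_betw_def)

lemma S_surj: "z \<in> escaping P m \<Longrightarrow> \<exists>w. 1 < cmod w \<and> z = S m w"
  using bij[of m] by (auto simp: bij_betw_def)

lemma S_inj: "1 < cmod v \<Longrightarrow> 1 < cmod w \<Longrightarrow> S m v = S m w \<longleftrightarrow> v = w"
  using bij[of m] by (auto simp: bij_betw_def dest: inj_onD)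

lemma S_deriv: "1 < cmod w \<Longrightarrow> (S m has_field_derivative deriv (S m) w) (at w)"
  by (rule holomorphic_derivI[OF hol open_exterior]) simp

lemma S_continuous: "1 < cmod w \<Longrightarrow> isCont (S m) w"
  using S_deriv DERIV_isCont by blast

lemma S_deriv_nonzero: "1 < cmod w \<Longrightarrow> deriv (S m) w \<noteq> 0"
  by (rule holomorphic_injective_imp_regular[OF hol open_exterior])
    (use bij[of m] in \<open>auto simp: bij_betw_def\<close>)

lemma exterior_power: "1 < cmod w \<Longrightarrow> n > 0 \<Longrightarrow> 1 < cmod (w ^ n)"
  unfolding norm_power by (rule one_less_power) auto

lemma Q_S: "m \<le> n \<Longrightarrow> 1 < cmod w \<Longrightarrow> Q P m n (S m w) = S n (w ^ deg m n)"
proof (induction n rule: dec_induct)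
  case (step n)
  have "1 < cmod (w ^ deg m n)" using exterior_power step deg_pos by blast
  then show ?case using step by (simp add: Q_Suc S_eq deg_Suc power_mult)
qed simp

lemma Q_S_deriv:
  assumes "m \<le> n" and w: "1 < cmod w"
  shows "deriv (Q P m n) (S m w) * deriv (S m) w =
     deriv (S n) (w ^ deg m n) * (of_nat (deg m n) * w ^ (deg m n - 1))"
proof (rule DERIV_unique)
  show "((\<lambda>w. Q P m n (S m w)) has_field_derivative deriv (Q P m n) (S m w) * deriv (S m) w) (at w)"
    by (rule DERIV_chain2[OF DERIV_Q S_deriv[OF w]])
  have "((\<lambda>w. w ^ deg m n) has_field_derivative of_nat (deg m n) * w ^ (deg m n - 1)) (at w)"
    by (auto intro!: derivative_eq_intros)
  then have "((\<lambda>w. S n (w ^ deg m n)) has_field_derivative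
      deriv (S n) (w ^ deg m n) * (of_nat (deg m n) * w ^ (deg m n - 1))) (at w)"
    by (rule DERIV_chain2[where f = "S n" and g = "\<lambda>w. w ^ deg m n", OF S_deriv[OF exterior_power[OF w deg_pos[OF assms(1)]]]])
  then show "((\<lambda>w. Q P m n (S m w)) has_field_derivative
      deriv (S n) (w ^ deg m n) * (of_nat (deg m n) * w ^ (deg m n - 1))) (at w)"
    by (rule has_field_derivative_transform_within_open[OF _ open_exterior])
      (use w Q_S[OF assms(1)] in auto)
qed

lemma deriv_Q_escaping: "m \<le> n \<Longrightarrow> z \<in> escaping P m \<Longrightarrow> deriv (Q P m n) z \<noteq> 0"
proof
  assume mn: "m \<le> n" and z: "z \<in> escaping P m" and 0: "deriv (Q P m n) z = 0"
  obtain w where w: "1 < cmod w" "z = S m w" using S_surj[OF z] by blast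
  have "deriv (S n) (w ^ deg m n) * (of_nat (deg m n) * w ^ (deg m n - 1)) = 0"
    using Q_S_deriv[OF mn w(1)] 0 w(2) by simp
  moreover have "deriv (S n) (w ^ deg m n) \<noteq> 0"
    by (rule S_deriv_nonzero[OF exterior_power[OF w(1) deg_pos[OF mn]]])
  ultimately show False using deg_pos[OF mn] w(1) by auto
qed

text \<open>The basin has no critical points, and \<open>1 / Q'\<close> vanishes at infinity; so the maximum
  principle carries a lower bound for the derivative from the Julia set to the whole basin.\<close>

lemma deriv_Q_lower_bound_escaping:
  assumes mn: "m < n" and c: "c > 0" and J: "\<And>x. x \<in> julia P m \<Longrightarrow> c \<le> cmod (deriv (Q P m n) x)"
    and z: "z \<in> escaping P m"
  shows "c \<le> cmod (deriv (Q P m n) z)"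
proof -
  let ?p = "pderiv (qpoly P m n)"
  have eq: "deriv (Q P m n) x = poly ?p x" for x by (rule deriv_Q_eq)
  have "degree (qpoly P m n) \<ge> 2 ^ (n - m)" by (rule degree_qpoly_ge[OF bounded]) (use mn in simp)
  moreover have "(2::nat) ^ 1 \<le> 2 ^ (n - m)" using mn by (intro power_increasing) auto
  ultimately have degp: "degree ?p > 0" by (simp add: degree_pderiv)
  have nz: "poly ?p x \<noteq> 0" if "x \<in> closure (escaping P m)" for x
  proof (cases "x \<in> escaping P m")
    case True
    then show ?thesis using deriv_Q_escaping[of m n x] mn by (simp add: eq)
  next
    case False
    then have "x \<in> julia P m" using that julia_eq[OF bounded] by blast
    then show ?thesis using J c unfolding eq by fastforce
  qed
  have "filterlim (poly ?p) at_infinity at_infinity" by (rule filterlim_poly_at_infinity) (use degp in simp_all)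
  then have "\<forall>\<^sub>F x in at_infinity. c \<le> cmod (poly ?p x)"
    using c filterlim_at_infinity[of 0 "poly ?p" at_infinity] by blast
  then obtain b where b: "\<And>x. cmod x \<ge> b \<Longrightarrow> c \<le> cmod (poly ?p x)"
    unfolding eventually_at_infinity by blast
  show ?thesis
  proof (cases "cmod z \<ge> b")
    case True
    then show ?thesis using b by (simp add: eq)
  next
    case False
    define A where "A = escaping P m \<inter> ball 0 b"
    have opA: "open A" unfolding A_def using open_escaping[OF bounded] by auto
    have clA: "closure A \<subseteq> closure (escaping P m)" unfolding A_def by (intro closure_mono) auto
    have "cmod (1 / poly ?p z) \<le> 1 / c"
    proof (rule maximum_modulus_frontier[where S = A and f = "\<lambda>x. 1 / poly ?p x" and \<xi> = z])
      show "(\<lambda>x. 1 / poly ?p x) holomorphic_on interior A"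
        using nz closure_subset opA interior_open clA by (intro holomorphic_intros) blast
      show "continuous_on (closure A) (\<lambda>x. 1 / poly ?p x)"
        using nz clA by (intro continuous_intros) auto
      show "bounded A" unfolding A_def by (rule bounded_subset[OF bounded_ball]) auto
      show "z \<in> A" using z False by (simp add: A_def)
      fix x assume "x \<in> frontier A"
      then have x: "x \<in> closure A" "x \<notin> A" using opA by (auto simp: frontier_def interior_open)
      have "c \<le> cmod (poly ?p x)"
      proof (cases "x \<in> escaping P m")
        case True
        then show ?thesis using x(2) b by (auto simp: A_def)
      next
        case False
        then show ?thesis using x(1) clA J julia_eq[OF bounded] unfolding eq by blast
      qed
      then show "cmod (1 / poly ?p x) \<le> 1 / c" using c by (simp add: norm_divide frac_le)
    qed
    moreover have "cmod (poly ?p z) > 0" using nz[OF subsetD[OF closure_subset z]] by simp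
    ultimately show ?thesis using c by (simp add: norm_divide eq field_simps)
  qed
qed

text \<open>A limit in the basin would be a value \<open>S m v\<close>; the open set of values \<open>S m w\<close> with \<open>w\<close>
  away from the circle is then a neighbourhood that the points \<open>S m (w x)\<close> leave.\<close>

lemma boundary_limit_in_julia:
  assumes F: "F \<noteq> bot" and w: "\<forall>\<^sub>F x in F. 1 < cmod (w x)" and lim: "((\<lambda>x. cmod (w x)) \<longlongrightarrow> 1) F"
    and q: "((\<lambda>x. S m (w x)) \<longlongrightarrow> q) F"
  shows "q \<in> julia P m"
proof -
  have "q \<in> closure (escaping P m)"
    by (rule Lim_in_closed_set[OF closed_closure _ F q])
      (use w S_in closure_subset in \<open>auto elim!: eventually_mono\<close>)
  moreover have "q \<notin> escaping P m"
  proof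
    assume "q \<in> escaping P m"
    then obtain v where v: "1 < cmod v" "q = S m v" using S_surj by blast
    define U where "U = {w. (1 + cmod v) / 2 < cmod w}"
    have opU: "open U" unfolding U_def by (intro open_Collect_less continuous_intros)
    have subU: "U \<subseteq> {w. 1 < cmod w}" using v by (auto simp: U_def)
    have "open (S m ` U)"
      by (rule open_mapping_thm3[OF holomorphic_on_subset[OF hol subU] opU])
        (use bij[of m] subU in \<open>auto simp: bij_betw_def intro: inj_on_subset\<close>)
    moreover have "q \<in> S m ` U" using v by (auto simp: U_def)
    ultimately have "\<forall>\<^sub>F x in F. S m (w x) \<in> S m ` U" using q topological_tendstoD by blast
    moreover have "\<forall>\<^sub>F x in F. cmod (w x) < (1 + cmod v) / 2"
      by (rule order_tendstoD(2)[OF lim]) (use v in simp)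
    ultimately have "\<forall>\<^sub>F x in F. False"
      using w
    proof eventually_elim
      case (elim x)
      then obtain u where u: "u \<in> U" "S m (w x) = S m u" by blast
      then have "w x = u" using S_inj[of "w x" u] elim(3) subU by blast
      then show False using u(1) elim(2) by (simp add: U_def)
    qed
    then show False using F by (simp add: eventually_False)
  qed
  ultimately show ?thesis using julia_eq[OF bounded] by blast
qed

end

locale hyperbolic_boettcher_sequence = boettcher_sequence +
  fixes C \<mu> :: real
  assumes C: "C > 0" and \<mu>: "\<mu> > 1"
    and expanding: "z \<in> julia P m \<Longrightarrow> C * \<mu> ^ i \<le> cmod (deriv (Q P m (m + i)) z)"
begin

lemma expanding_escaping:
  assumes z: "z \<in> escaping P m" and mn: "m \<le> n"
  shows "min C 1 * \<mu> ^ (n - m) \<le> cmod (deriv (Q P m n) z)"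
proof (cases "m = n")
  case True
  then show ?thesis by (simp add: deriv_Q_same)
next
  case False
  have "C * \<mu> ^ (n - m) \<le> cmod (deriv (Q P m n) z)"
    by (rule deriv_Q_lower_bound_escaping[OF _ _ _ z]) (use False mn C \<mu> expanding[of _ m "n - m"] in auto)
  moreover have "min C 1 * \<mu> ^ (n - m) \<le> C * \<mu> ^ (n - m)"
    using \<mu> by (intro mult_right_mono) auto
  ultimately show ?thesis by linarith
qed

text \<open>Cauchy's inequality on discs that stay outside the unit circle; the annulus is chosen such
  that the orbit under the power maps of a point outside the circle and close to it visits the
  annulus.\<close>

lemma S_deriv_annulus_bound:
  "\<exists>C1>0. \<forall>n v. 2 powr (1 / real d) \<le> cmod v \<and> cmod v \<le> 2 \<longrightarrow> cmod (deriv (S n) v) \<le> C1"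
proof -
  have d: "d \<ge> 2" using degree_bounds[of 0] by linarith
  define \<rho> where "\<rho> = (2 powr (1 / real d) - 1) / 2"
  have s: "1 < 2 powr (1 / real d)" using d by simp
  have "2 powr (1 / real d) \<le> 2 powr 1" using d by (intro powr_mono) auto
  then have \<rho>: "\<rho> > 0" "\<rho> \<le> 1/2" using s by (auto simp: \<rho>_def)
  have "0 \<le> cmod (S 0 2)" "cmod (S 0 2) \<le> B * 2" using S_bound[of 2 0] by simp_all
  then have B0: "B \<ge> 0" by linarith
  have "cmod (deriv (S n) v) \<le> (3 * B) / \<rho>"
    if v: "2 powr (1 / real d) \<le> cmod v" "cmod v \<le> 2" for n v
  proof -
    have ann: "1 < cmod x \<and> cmod x \<le> 3" if "dist v x \<le> \<rho>" for x
    proof -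
      have "cmod v - cmod x \<le> \<rho>" "cmod x - cmod v \<le> \<rho>"
        using that norm_triangle_ineq2[of v x] norm_triangle_ineq2[of x v]
        by (auto simp: dist_norm norm_minus_commute)
      moreover have "1 + \<rho> < 2 powr (1 / real d)" using s by (simp add: \<rho>_def field_simps)
      ultimately show ?thesis using v \<rho> by linarith
    qed
    have sub: "cball v \<rho> \<subseteq> {w. 1 < cmod w}" using ann by auto
    have "cmod ((deriv ^^ 1) (S n) v) \<le> fact 1 * (3 * B) / \<rho> ^ 1"
    proof (rule Cauchy_inequality)
      show "S n holomorphic_on ball v \<rho>"
        by (rule holomorphic_on_subset[OF hol]) (use sub ball_subset_cball in blast)
      show "continuous_on (cball v \<rho>) (S n)"
        by (rule holomorphic_on_imp_continuous_on[OF holomorphic_on_subset[OF hol sub]])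
      fix x assume "cmod (v - x) = \<rho>"
      then have x: "1 < cmod x" "cmod x \<le> 3" using ann[of x] by (auto simp: dist_norm)
      have "cmod (S n x) \<le> B * cmod x" using S_bound x by blast
      also have "\<dots> \<le> B * 3" using x B0 by (intro mult_left_mono)
      finally show "cmod (S n x) \<le> 3 * B" by simp
    qed (use \<rho> in simp)
    then show ?thesis by simp
  qed
  moreover have "(3 * B) / \<rho> \<le> 3 * B / \<rho> + 1" "3 * B / \<rho> + 1 > 0"
    using B0 \<rho> by (auto intro: add_nonneg_pos)
  ultimately show ?thesis by (meson order_trans)
qed

text \<open>The radius that the power \<open>deg m n\<close> takes to 2.\<close>

definition radius :: "nat \<Rightarrow> nat \<Rightarrow> real" where
  "radius m n = 2 powr (1 / real (deg m n))"

lemma radius_gt1: "m \<le> n \<Longrightarrow> 1 < radius m n"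
  using deg_pos[of m n] by (simp add: radius_def)

lemma radius_power: "m \<le> n \<Longrightarrow> radius m n ^ deg m n = 2"
  using deg_pos[of m n] by (simp add: radius_def powr_realpow[symmetric] powr_powr)

lemma radius_le: "m \<le> n \<Longrightarrow> radius m n \<le> 1 + 1 / real (deg m n)"
proof (rule ccontr)
  assume mn: "m \<le> n" and "\<not> radius m n \<le> 1 + 1 / real (deg m n)"
  then have lt: "1 + 1 / real (deg m n) < radius m n" by simp
  have "2 \<le> (1 + 1 / real (deg m n)) ^ deg m n"
    using Bernoulli_inequality[of "1 / real (deg m n)" "deg m n"] deg_pos[OF mn]
    by (simp add: order_trans[of "-1" 0])
  also have "\<dots> < radius m n ^ deg m n"
    by (rule power_strict_mono[OF lt]) (use deg_pos[OF mn] in \<open>auto intro: add_nonneg_nonneg\<close>)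
  finally show False using radius_power[OF mn] by simp
qed

lemma radius_decreasing: "m \<le> n \<Longrightarrow> radius m (Suc n) \<le> radius m n"
  unfolding radius_def using deg_pos[of m n] degree_bounds(1)[of n]
  by (intro powr_mono divide_left_mono) (auto simp: deg_Suc)

text \<open>With \<open>w\<close> between two consecutive radii, \<open>w ^ deg m n\<close> lies in a fixed annulus, where
  \<open>S n\<close> has bounded derivative. In the formula for the derivative of \<open>Q m n \<circ> S m = S n \<circ> power\<close>
  the factor \<open>deg m n\<close> cancels against the length of the segment, and the expansion
  of \<open>Q m n\<close> leaves a geometric sequence.\<close>

lemma ray_step:
  obtains c where "c > 0" "\<And>m n e R R'. m \<le> n \<Longrightarrow> cmod e = 1 \<Longrightarrow>
     R \<in> {radius m (Suc n)..radius m n} \<Longrightarrow> R' \<in> {radius m (Suc n)..radius m n} \<Longrightarrow>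
     cmod (S m (of_real R * e) - S m (of_real R' * e)) \<le> c * (1 / \<mu>) ^ (n - m)"
proof -
  obtain C1 where C1: "C1 > 0" "\<And>n v. 2 powr (1 / real d) \<le> cmod v \<Longrightarrow> cmod v \<le> 2 \<Longrightarrow> cmod (deriv (S n) v) \<le> C1"
    using S_deriv_annulus_bound by blast
  define c where "c = 2 * C1 / min C 1"
  have c: "c > 0" using C1 C by (simp add: c_def)
  have main: "cmod (S m (of_real R * e) - S m (of_real R' * e)) \<le> c * (1 / \<mu>) ^ (n - m)"
    if mn: "m \<le> n" and e: "cmod e = 1" and R: "R \<in> {radius m (Suc n)..radius m n}"
      and R': "R' \<in> {radius m (Suc n)..radius m n}" for m n e R R'
  proof -
    let ?D = "deg m n"
    let ?I = "(\<lambda>R. of_real R * e) ` {radius m (Suc n)..radius m n}"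
    have D: "?D > 0" by (rule deg_pos[OF mn])
    define L where "L = c * (1 / \<mu>) ^ (n - m) * real ?D"
    have r1: "1 < radius m (Suc n)" using radius_gt1 mn by simp
    have der: "cmod (deriv (S m) w) \<le> L" and gt: "1 < cmod w" if w: "w \<in> ?I" for w
    proof -
      obtain T where T: "T \<in> {radius m (Suc n)..radius m n}" "w = of_real T * e" using w by blast
      have T1: "1 < T" using T r1 by simp
      have nw: "cmod w = T" using T e T1 by (simp add: norm_mult)
      then show gt: "1 < cmod w" using T1 by simp
      have up: "T ^ ?D \<le> 2"
        using power_mono[of T "radius m n" ?D] T T1 radius_power[OF mn] by simp
      have "2 powr (1 / real d) \<le> 2 powr (1 / real (degree (P (Suc n))))"
        using degree_bounds[of n] by (intro powr_mono divide_left_mono) auto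
      also have "\<dots> = radius m (Suc n) ^ ?D"
        using D mn by (simp add: radius_def powr_realpow[symmetric] powr_powr deg_Suc)
      also have "\<dots> \<le> T ^ ?D" using T r1 by (intro power_mono) auto
      finally have low: "2 powr (1 / real d) \<le> T ^ ?D" .
      have d1: "cmod (deriv (S n) (w ^ ?D)) \<le> C1"
        by (rule C1(2)) (use up low nw in \<open>simp_all add: norm_power\<close>)
      have d2: "min C 1 * \<mu> ^ (n - m) \<le> cmod (deriv (Q P m n) (S m w))"
        by (rule expanding_escaping[OF S_in[OF gt] mn])
      have "min C 1 * \<mu> ^ (n - m) * cmod (deriv (S m) w) \<le> cmod (deriv (Q P m n) (S m w) * deriv (S m) w)"
        unfolding norm_mult by (rule mult_right_mono[OF d2]) simp
      also have "\<dots> = cmod (deriv (S n) (w ^ ?D)) * (real ?D * T ^ (?D - 1))"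
        unfolding Q_S_deriv[OF mn gt] by (simp add: norm_mult norm_power nw)
      also have "\<dots> \<le> C1 * (real ?D * 2)"
      proof (intro mult_mono d1)
        have "T ^ (?D - 1) \<le> T ^ ?D" using T1 by (intro power_increasing) auto
        then show "T ^ (?D - 1) \<le> 2" using up by linarith
      qed (use C1 T1 in auto)
      finally have "min C 1 * \<mu> ^ (n - m) * cmod (deriv (S m) w) \<le> 2 * C1 * real ?D" by simp
      then show "cmod (deriv (S m) w) \<le> L"
        using C \<mu> by (simp add: L_def c_def power_divide pos_le_divide_eq mult.commute mult.left_commute)
    qed
    have "cmod (S m (of_real R * e) - S m (of_real R' * e)) \<le> L * cmod (of_real R * e - of_real R' * e)"
    proof (rule field_differentiable_bound[where S = ?I and f' = "deriv (S m)"])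
      have "linear (\<lambda>R. complex_of_real R * e)"
        by (rule linearI) (simp_all add: algebra_simps scaleR_conv_of_real)
      then show "convex ?I" by (rule convex_linear_image) simp
      fix z assume z: "z \<in> ?I"
      show "(S m has_field_derivative deriv (S m) z) (at z within ?I)"
        using S_deriv[OF gt[OF z]] by (rule has_field_derivative_at_within)
      show "cmod (deriv (S m) z) \<le> L" by (rule der[OF z])
    qed (use R R' in auto)
    also have "cmod (of_real R * e - of_real R' * e) = \<bar>R - R'\<bar>"
      using e by (metis left_diff_distrib mult.right_neutral norm_mult norm_of_real of_real_diff)
    also have "L * \<bar>R - R'\<bar> \<le> L * (1 / real ?D)"
    proof (rule mult_left_mono)
      have "\<bar>R - R'\<bar> \<le> radius m n - radius m (Suc n)" using R R' by auto
      also have "\<dots> \<le> 1 / real ?D" using radius_le[OF mn] r1 by linarith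
      finally show "\<bar>R - R'\<bar> \<le> 1 / real ?D" .
      show "0 \<le> L" using c \<mu> by (simp add: L_def)
    qed
    also have "\<dots> = c * (1 / \<mu>) ^ (n - m)" using D by (simp add: L_def)
    finally show ?thesis .
  qed
  show thesis by (rule that[OF c main])
qed

text \<open>The increments of the preceding lemma add up to a geometric tail, which depends neither on
  the angle nor on the number of steps.\<close>

lemma ray_uniformly_Cauchy:
  assumes \<epsilon>: "\<epsilon> > 0"
  shows "\<exists>\<rho>>1. \<forall>R R' e. 1 < R \<and> R \<le> \<rho> \<and> 1 < R' \<and> R' \<le> \<rho> \<and> cmod e = 1 \<longrightarrow>
     cmod (S m (of_real R * e) - S m (of_real R' * e)) \<le> \<epsilon>"
proof -
  obtain c where c: "c > 0" "\<And>m n e R R'. m \<le> n \<Longrightarrow> cmod e = 1 \<Longrightarrow>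
     R \<in> {radius m (Suc n)..radius m n} \<Longrightarrow> R' \<in> {radius m (Suc n)..radius m n} \<Longrightarrow>
     cmod (S m (of_real R * e) - S m (of_real R' * e)) \<le> c * (1 / \<mu>) ^ (n - m)"
    using ray_step by blast
  define q where "q = 1 / \<mu>"
  have q: "0 < q" "q < 1" using \<mu> by (auto simp: q_def)
  let ?r = "\<lambda>k. radius m (m + k)"
  have step: "cmod (S m (of_real R * e) - S m (of_real R' * e)) \<le> c * q ^ k"
    if "cmod e = 1" "R \<in> {?r (Suc k)..?r k}" "R' \<in> {?r (Suc k)..?r k}" for k e R R'
    using c(2)[of m "m + k" e R R'] that by (simp add: q_def)
  have dec: "?r (Suc k) \<le> ?r k" for k using radius_decreasing[of m "m + k"] by simp
  have tail: "cmod (S m (of_real R * e) - S m (of_real (?r n) * e)) \<le> c * q ^ n / (1 - q) - c * q ^ (n + k) / (1 - q)"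
    if e: "cmod e = 1" and R: "?r (n + k) \<le> R" "R \<le> ?r n" for n k R e
    using R
  proof (induction k arbitrary: R)
    case 0
    then have "R = ?r n" by simp
    then show ?case by simp
  next
    case (Suc k)
    show ?case
    proof (cases "?r (n + k) \<le> R")
      case True
      have "c * q ^ (n + Suc k) / (1 - q) \<le> c * q ^ (n + k) / (1 - q)"
        using q c(1) by (intro divide_right_mono mult_left_mono power_decreasing) auto
      then show ?thesis using Suc.IH[OF True Suc.prems(2)] by linarith
    next
      case False
      have mono: "?r (n + j) \<le> ?r n" for j
        by (induction j) (use dec order_trans in \<open>auto intro: order_trans[OF dec]\<close>)
      have "cmod (S m (of_real R * e) - S m (of_real (?r (n + k)) * e)) \<le> c * q ^ (n + k)"
        by (rule step[OF e]) (use False Suc.prems dec[of "n + k"] in auto)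
      moreover have "cmod (S m (of_real (?r (n + k)) * e) - S m (of_real (?r n) * e))
          \<le> c * q ^ n / (1 - q) - c * q ^ (n + k) / (1 - q)"
        by (rule Suc.IH) (use mono in auto)
      moreover have "c * q ^ (n + k) + (c * q ^ n / (1 - q) - c * q ^ (n + k) / (1 - q)) =
          c * q ^ n / (1 - q) - c * q ^ (n + Suc k) / (1 - q)"
      proof -
        have "c * q ^ (n + k) = (c * q ^ (n + k) * (1 - q)) / (1 - q)" using q by simp
        also have "\<dots> = c * q ^ (n + k) / (1 - q) - c * q ^ (n + Suc k) / (1 - q)"
          by (simp add: diff_divide_distrib[symmetric] algebra_simps)
        finally show ?thesis by linarith
      qed
      ultimately show ?thesis
        using norm_triangle_ineq[of "S m (of_real R * e) - S m (of_real (?r (n + k)) * e)"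
            "S m (of_real (?r (n + k)) * e) - S m (of_real (?r n) * e)"] by simp
    qed
  qed
  have rlim: "?r \<longlonglongrightarrow> 1"
  proof (rule tendsto_sandwich)
    show "\<forall>\<^sub>F k in sequentially. 1 \<le> ?r k" using radius_gt1[of m] by (simp add: less_imp_le)
    show "\<forall>\<^sub>F k in sequentially. ?r k \<le> 1 + (1/2) ^ k"
    proof (intro always_eventually allI)
      fix k
      have "real (2 ^ k) \<le> real (deg m (m + k))" using deg_ge[of m "m + k"] of_nat_le_iff by fastforce
      then have "1 / real (deg m (m + k)) \<le> 1 / 2 ^ k" using deg_pos[of m "m + k"] by (intro divide_left_mono) auto
      then show "?r k \<le> 1 + (1/2) ^ k" using radius_le[of m "m + k"] by (simp add: power_divide)
    qed
    have "(\<lambda>k. 1 + (1/2) ^ k) \<longlonglongrightarrow> 1 + (0::real)" by (intro tendsto_intros LIMSEQ_realpow_zero) auto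
    then show "(\<lambda>k. 1 + (1/2) ^ k :: real) \<longlonglongrightarrow> 1" by simp
  qed auto
  have "(\<lambda>n. c * q ^ n / (1 - q)) \<longlonglongrightarrow> c * 0 / (1 - q)"
    by (intro tendsto_intros LIMSEQ_realpow_zero) (use q in auto)
  then have "\<forall>\<^sub>F n in sequentially. c * q ^ n / (1 - q) < \<epsilon> / 2"
    by (rule order_tendstoD(2)) (use \<epsilon> in simp)
  then obtain n where n: "c * q ^ n / (1 - q) < \<epsilon> / 2"
    using eventually_happens'[OF sequentially_bot] by blast
  have half: "cmod (S m (of_real R * e) - S m (of_real (?r n) * e)) \<le> \<epsilon> / 2"
    if R: "1 < R" "R \<le> ?r n" and e: "cmod e = 1" for R e
  proof -
    have "\<forall>\<^sub>F k in sequentially. ?r k < R" by (rule order_tendstoD(2)[OF rlim R(1)])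
    then have "\<forall>\<^sub>F k in sequentially. ?r (k + n) < R"
      using eventually_sequentially_seg[of "\<lambda>k. ?r k < R" n] by simp
    then obtain k where "?r (k + n) < R" using eventually_happens'[OF sequentially_bot] by blast
    then have "cmod (S m (of_real R * e) - S m (of_real (?r n) * e)) \<le> c * q ^ n / (1 - q) - c * q ^ (n + k) / (1 - q)"
      by (intro tail[OF e _ R(2)]) (simp add: add.commute)
    moreover have "0 \<le> c * q ^ (n + k) / (1 - q)" using c q by simp
    ultimately show ?thesis using n by linarith
  qed
  show ?thesis
  proof (intro exI[of _ "?r n"] conjI allI impI)
    show "1 < ?r n" using radius_gt1[of m] by simp
    fix R R' e assume *: "1 < R \<and> R \<le> ?r n \<and> 1 < R' \<and> R' \<le> ?r n \<and> cmod e = 1"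
    show "cmod (S m (of_real R * e) - S m (of_real R' * e)) \<le> \<epsilon>"
      using norm_triangle_ineq4[of "S m (of_real R * e) - S m (of_real (?r n) * e)"
          "S m (of_real R' * e) - S m (of_real (?r n) * e)"] half[of R e] half[of R' e] * by simp
  qed
qed

lemma ray_lands:
  assumes e: "cmod e = 1"
  shows "\<exists>q\<in>julia P m. ((\<lambda>R. S m (of_real R * e)) \<longlongrightarrow> q) (at_right 1)"
proof -
  define x where "x k = S m (of_real (1 + 1 / real (Suc k)) * e)" for k
  have small: "\<forall>\<^sub>F k in sequentially. 1 + 1 / real (Suc k) \<le> \<rho>" if "\<rho> > 1" for \<rho>
  proof -
    have "(\<lambda>k. 1 + 1 / real (Suc k)) \<longlonglongrightarrow> 1 + 0" by (intro tendsto_intros LIMSEQ_Suc lim_1_over_n)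
    then have "\<forall>\<^sub>F k in sequentially. 1 + 1 / real (Suc k) < \<rho>" using that order_tendstoD(2) by fastforce
    then show ?thesis by eventually_elim simp
  qed
  have "Cauchy x"
  proof (rule metric_CauchyI)
    fix \<epsilon> :: real assume "\<epsilon> > 0"
    then obtain \<rho> where \<rho>: "\<rho> > 1" "\<forall>R R' e. 1 < R \<and> R \<le> \<rho> \<and> 1 < R' \<and> R' \<le> \<rho> \<and> cmod e = 1 \<longrightarrow>
      cmod (S m (of_real R * e) - S m (of_real R' * e)) \<le> \<epsilon> / 2"
      using ray_uniformly_Cauchy[of "\<epsilon> / 2" m] by auto
    obtain N where N: "\<And>k. k \<ge> N \<Longrightarrow> 1 + 1 / real (Suc k) \<le> \<rho>"
      using small[OF \<rho>(1)] unfolding eventually_sequentially by blast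
    have "dist (x i) (x j) < \<epsilon>" if "i \<ge> N" "j \<ge> N" for i j
    proof -
      have "cmod (x i - x j) \<le> \<epsilon> / 2"
        unfolding x_def using N[OF that(1)] N[OF that(2)] e
        by (intro \<rho>(2)[rule_format]) auto
      then show ?thesis using \<open>\<epsilon> > 0\<close> by (simp add: dist_norm)
    qed
    then show "\<exists>N. \<forall>i\<ge>N. \<forall>j\<ge>N. dist (x i) (x j) < \<epsilon>" by blast
  qed
  then obtain q where q: "x \<longlonglongrightarrow> q" using Cauchy_convergent_iff convergent_def by blast
  have lim: "((\<lambda>R. S m (of_real R * e)) \<longlongrightarrow> q) (at_right 1)"
  proof (rule tendstoI)
    fix \<epsilon> :: real assume \<epsilon>: "\<epsilon> > 0"
    then obtain \<rho> where \<rho>: "\<rho> > 1" "\<forall>R R' e. 1 < R \<and> R \<le> \<rho> \<and> 1 < R' \<and> R' \<le> \<rho> \<and> cmod e = 1 \<longrightarrow>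
      cmod (S m (of_real R * e) - S m (of_real R' * e)) \<le> \<epsilon> / 2"
      using ray_uniformly_Cauchy[of "\<epsilon> / 2" m] by auto
    have le: "dist (S m (of_real R * e)) q \<le> \<epsilon> / 2" if R: "1 < R" "R < \<rho>" for R
    proof (rule tendsto_upperbound[OF tendsto_dist[OF tendsto_const q]])
      show "\<forall>\<^sub>F k in sequentially. dist (S m (of_real R * e)) (x k) \<le> \<epsilon> / 2"
        using small[OF \<rho>(1)]
      proof eventually_elim
        case (elim k)
        then show ?case unfolding x_def dist_norm using R e by (intro \<rho>(2)[rule_format]) auto
      qed
    qed simp
    have "\<forall>\<^sub>F R in at_right 1. R \<in> {1<..<\<rho>}" using \<rho>(1) by (rule eventually_at_right_real)
    then show "\<forall>\<^sub>F R in at_right 1. dist (S m (of_real R * e)) q < \<epsilon>"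
      by eventually_elim (use le \<epsilon> in force)
  qed
  have ev: "\<forall>\<^sub>F R in at_right (1::real). cmod (of_real R * e) = R \<and> 1 < R"
    unfolding eventually_at_right_field using e by (intro exI[of _ 2]) (auto simp: norm_mult)
  have "q \<in> julia P m"
  proof (rule boundary_limit_in_julia[OF _ _ _ lim])
    show "\<forall>\<^sub>F R in at_right 1. 1 < cmod (complex_of_real R * e)" using ev by eventually_elim simp
    have "((\<lambda>R::real. R) \<longlongrightarrow> 1) (at_right 1)" by (simp add: tendsto_ident_at)
    then show "((\<lambda>R. cmod (complex_of_real R * e)) \<longlongrightarrow> 1) (at_right 1)"
      by (rule Lim_transform_eventually) (use ev in eventually_elim, simp)
  qed simp
  then show ?thesis using lim by blast
qed

text \<open>Basin points that converge to \<open>x\<close> have angles that accumulate at some angle; as rays converge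
  uniformly in the angle, the ray of this angle lands at \<open>x\<close>.\<close>

lemma julia_point_is_landing_point:
  assumes x: "x \<in> julia P m"
  shows "\<exists>e. cmod e = 1 \<and> ((\<lambda>R. S m (of_real R * e)) \<longlongrightarrow> x) (at_right 1)"
proof -
  have xc: "x \<in> closure (escaping P m)" "x \<notin> escaping P m" using x julia_eq[OF bounded] by auto
  then obtain z where z: "\<And>k. z k \<in> escaping P m" "z \<longlonglongrightarrow> x" unfolding closure_sequential by blast
  have "\<forall>k. \<exists>w. 1 < cmod w \<and> z k = S m w" using z S_surj by blast
  then obtain w where w: "\<And>k. 1 < cmod (w k)" "\<And>k. z k = S m (w k)" by metis
  obtain b where b: "\<And>v. cmod v \<ge> b \<Longrightarrow> cmod x + 1 \<le> cmod (S m v)"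
  proof -
    have "cmod x + 1 > 0" by (simp add: add_nonneg_pos)
    then have "\<forall>\<^sub>F v in at_infinity. cmod x + 1 \<le> cmod (S m v)"
      using S_inf[of m] filterlim_at_infinity[of 0 "S m" at_infinity] by blast
    then show thesis using that unfolding eventually_at_infinity by blast
  qed
  have "\<forall>\<^sub>F k in sequentially. cmod (z k) < cmod x + 1"
    using order_tendstoD(2)[OF tendsto_norm[OF z(2)]] by simp
  then obtain N where N: "\<And>k. k \<ge> N \<Longrightarrow> cmod (z k) < cmod x + 1" unfolding eventually_sequentially by blast
  have "w (k + N) \<in> cball 0 b" for k
    using N[of "k + N"] b[of "w (k + N)"] w(2)[of "k + N"] by (force simp: not_le[symmetric])
  then obtain v s where vs: "strict_mono s" "((\<lambda>k. w (k + N)) \<circ> s) \<longlonglongrightarrow> v"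
    using compact_cball[of 0 b] unfolding compact_def by metis
  define y where "y k = w (s k + N)" for k
  have y: "y \<longlonglongrightarrow> v" using vs(2) by (simp add: y_def[abs_def] o_def)
  have y1: "1 < cmod (y k)" for k using w by (simp add: y_def)
  have Sy: "(\<lambda>k. S m (y k)) \<longlonglongrightarrow> x"
  proof -
    have "(\<lambda>k. z (k + N)) \<longlonglongrightarrow> x" using z(2) by (rule LIMSEQ_ignore_initial_segment)
    then have "((\<lambda>k. z (k + N)) \<circ> s) \<longlonglongrightarrow> x" by (rule LIMSEQ_subseq_LIMSEQ[OF _ vs(1)])
    then show ?thesis by (simp add: o_def w(2) y_def)
  qed
  have v1: "cmod v = 1"
  proof (rule ccontr)
    assume "cmod v \<noteq> 1"
    moreover have "1 \<le> cmod v"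
      by (rule LIMSEQ_le_const[OF tendsto_norm[OF y]]) (use y1 less_imp_le in blast)
    ultimately have "1 < cmod v" by simp
    then have "(\<lambda>k. S m (y k)) \<longlonglongrightarrow> S m v" using isCont_tendsto_compose[OF S_continuous y] by blast
    then have "x = S m v" using LIMSEQ_unique Sy by blast
    then show False using xc(2) S_in \<open>1 < cmod v\<close> by blast
  qed
  obtain q where q: "((\<lambda>R. S m (of_real R * v)) \<longlongrightarrow> q) (at_right 1)" using ray_lands[OF v1] by blast
  have "dist x q \<le> \<epsilon>" if \<epsilon>: "\<epsilon> > 0" for \<epsilon>
  proof -
    obtain \<rho> where \<rho>: "\<rho> > 1" "\<forall>R R' e. 1 < R \<and> R \<le> \<rho> \<and> 1 < R' \<and> R' \<le> \<rho> \<and> cmod e = 1 \<longrightarrow>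
      cmod (S m (of_real R * e) - S m (of_real R' * e)) \<le> \<epsilon> / 2"
      using ray_uniformly_Cauchy[of "\<epsilon> / 2" m] \<epsilon> by auto
    define e where "e k = y k / of_real (cmod (y k))" for k
    have y0: "cmod (y k) \<noteq> 0" for k using y1[of k] by linarith
    have e1: "cmod (e k) = 1" for k using y0[of k] by (simp add: e_def norm_divide)
    have ye: "y k = of_real (cmod (y k)) * e k" for k using y0[of k] by (simp add: e_def)
    have "e \<longlonglongrightarrow> v / of_real (cmod v)"
      unfolding e_def by (intro tendsto_intros y) (use v1 in simp)
    then have elim: "e \<longlonglongrightarrow> v" using v1 by simp
    have "(\<lambda>k. S m (of_real \<rho> * e k)) \<longlonglongrightarrow> S m (of_real \<rho> * v)"
      by (rule isCont_tendsto_compose[OF S_continuous]) (use \<rho> v1 elim in \<open>auto simp: norm_mult intro!: tendsto_intros\<close>)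
    then have "(\<lambda>k. dist (S m (y k)) (S m (of_real \<rho> * e k))) \<longlonglongrightarrow> dist x (S m (of_real \<rho> * v))"
      by (intro tendsto_intros Sy)
    moreover have "\<forall>\<^sub>F k in sequentially. dist (S m (y k)) (S m (of_real \<rho> * e k)) \<le> \<epsilon> / 2"
    proof -
      have "(\<lambda>k. cmod (y k)) \<longlonglongrightarrow> 1" using tendsto_norm[OF y] v1 by simp
      then have "\<forall>\<^sub>F k in sequentially. cmod (y k) < \<rho>" using order_tendstoD(2) \<rho>(1) by blast
      then show ?thesis
      proof eventually_elim
        case (elim k)
        then show ?case
          using \<rho> y1[of k] e1[of k] \<rho>(2)[rule_format, of "cmod (y k)" \<rho> "e k"] ye[of k]
          by (simp add: dist_norm)
      qed
    qed
    ultimately have 1: "dist x (S m (of_real \<rho> * v)) \<le> \<epsilon> / 2"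
      by (rule tendsto_upperbound) simp
    have 2: "dist (S m (of_real \<rho> * v)) q \<le> \<epsilon> / 2"
    proof (rule tendsto_upperbound[OF tendsto_dist[OF tendsto_const q]])
      have "\<forall>\<^sub>F R in at_right 1. R \<in> {1<..<\<rho>}" using \<rho>(1) by (rule eventually_at_right_real)
      then show "\<forall>\<^sub>F R in at_right 1. dist (S m (of_real \<rho> * v)) (S m (of_real R * v)) \<le> \<epsilon> / 2"
        by eventually_elim (use \<rho> v1 in \<open>auto simp: dist_norm\<close>)
    qed simp
    show ?thesis using 1 2 dist_triangle[of x q "S m (of_real \<rho> * v)"] by simp
  qed
  then have "dist x q \<le> 0" by (rule field_le_epsilon[of _ 0, simplified])
  then have "x = q" by simp
  then show ?thesis using q v1 by blast
qed

lemma julia_nonempty: "julia P m \<noteq> {}"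
  using ray_lands[of 1 m] by auto

end

section \<open>Openness of hyperbolicity\<close>

text \<open>The other roots \<open>y\<close> satisfy \<open>\<bar>x - y\<bar> \<le> 2 \<bar>z - y\<bar>\<close>; insert this in the product formula
  for \<open>p' x\<close>.\<close>

lemma nearest_root_estimate:
  fixes p :: "complex poly"
  assumes p: "p \<noteq> 0" and sq: "rsquarefree p" and x: "poly p x = 0"
    and near: "\<And>y. poly p y = 0 \<Longrightarrow> cmod (z - x) \<le> cmod (z - y)"
  shows "cmod (z - x) * cmod (poly (pderiv p) x) \<le> 2 ^ degree p * cmod (poly p z)"
proof -
  define X where "X = {y. poly p y = 0}"
  have fin: "finite X" unfolding X_def using poly_roots_finite[OF p] .
  define g where "g = smult (lead_coeff p) (\<Prod>y\<in>X - {x}. [:-y, 1:])"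
  have dec: "p = smult (lead_coeff p) (\<Prod>y\<in>X. [:-y, 1:])"
    unfolding X_def using complex_poly_decompose_rsquarefree[OF sq] by simp
  also have "(\<Prod>y\<in>X. [:-y, 1:]) = [:-x, 1:] * (\<Prod>y\<in>X - {x}. [:-y, 1:])"
    by (rule prod.remove[OF fin]) (use x in \<open>simp add: X_def\<close>)
  finally have pg: "p = [:-x, 1:] * g" unfolding g_def by (simp add: mult.left_commute)
  have pd: "poly (pderiv p) x = poly g x"
    unfolding pg pderiv_mult by (simp add: pderiv_pCons del: mult_pCons_left)
  have gx: "poly g w = lead_coeff p * (\<Prod>y\<in>X - {x}. w - y)" for w
    unfolding g_def by (simp add: poly_prod)
  have card: "card (X - {x}) \<le> degree p"
    using card_mono[OF fin, of "X - {x}"] card_poly_roots_bound[OF p] unfolding X_def by auto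
  have "(\<Prod>y\<in>X - {x}. cmod (x - y)) \<le> (\<Prod>y\<in>X - {x}. 2 * cmod (z - y))"
  proof (rule prod_mono)
    fix y assume "y \<in> X - {x}"
    then have "cmod (z - x) \<le> cmod (z - y)" using near by (simp add: X_def)
    moreover have "cmod (x - y) \<le> cmod (x - z) + cmod (z - y)"
      using norm_triangle_ineq[of "x - z" "z - y"] by simp
    ultimately show "0 \<le> cmod (x - y) \<and> cmod (x - y) \<le> 2 * cmod (z - y)"
      by (simp add: norm_minus_commute)
  qed
  also have "\<dots> = 2 ^ card (X - {x}) * (\<Prod>y\<in>X - {x}. cmod (z - y))"
    by (simp add: prod.distrib)
  also have "\<dots> \<le> 2 ^ degree p * (\<Prod>y\<in>X - {x}. cmod (z - y))"
    by (intro mult_right_mono power_increasing card prod_nonneg) auto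
  finally have 1: "(\<Prod>y\<in>X - {x}. cmod (x - y)) \<le> 2 ^ degree p * (\<Prod>y\<in>X - {x}. cmod (z - y))" .
  have "cmod (z - x) * cmod (poly (pderiv p) x) =
      cmod (z - x) * cmod (lead_coeff p) * (\<Prod>y\<in>X - {x}. cmod (x - y))"
    unfolding pd gx by (simp add: norm_mult prod_norm)
  also have "\<dots> \<le> cmod (z - x) * cmod (lead_coeff p) * (2 ^ degree p * (\<Prod>y\<in>X - {x}. cmod (z - y)))"
    by (intro mult_left_mono 1) simp
  also have "\<dots> = 2 ^ degree p * (cmod (z - x) * cmod (poly g z))"
    unfolding gx by (simp add: norm_mult prod_norm mult_ac)
  also have "cmod (z - x) * cmod (poly g z) = cmod (poly p z)"
  proof -
    have "poly p z = (z - x) * poly g z" by (subst pg) (simp add: algebra_simps)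
    then show ?thesis by (simp add: norm_mult)
  qed
  finally show ?thesis .
qed

lemma entire_deriv_bound:
  fixes f :: "complex \<Rightarrow> complex"
  assumes f: "f holomorphic_on UNIV" and B: "\<And>z. cmod z \<le> R + 1 \<Longrightarrow> cmod (f z) \<le> B" and z: "cmod z \<le> R"
  shows "cmod (deriv f z) \<le> B"
proof -
  have "cmod ((deriv ^^ 1) f z) \<le> fact 1 * B / 1 ^ 1"
  proof (rule Cauchy_inequality)
    show "f holomorphic_on ball z 1" "continuous_on (cball z 1) f"
      using f holomorphic_on_imp_continuous_on holomorphic_on_subset by blast+
    fix x assume "cmod (z - x) = 1"
    then have "cmod x \<le> R + 1" using z norm_triangle_ineq2[of x z] by (simp add: norm_minus_commute)
    then show "cmod (f x) \<le> B" by (rule B)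
  qed simp
  then show ?thesis by simp
qed

lemma entire_Lipschitz:
  fixes f :: "complex \<Rightarrow> complex"
  assumes f: "f holomorphic_on UNIV" and B: "\<And>z. cmod z \<le> R + 1 \<Longrightarrow> cmod (f z) \<le> B"
    and zw: "cmod z \<le> R" "cmod w \<le> R"
  shows "cmod (f z - f w) \<le> B * cmod (z - w)"
proof (rule field_differentiable_bound[where S = "cball 0 R" and f' = "deriv f"])
  fix x assume x: "x \<in> cball (0::complex) R"
  show "(f has_field_derivative deriv f x) (at x within cball 0 R)"
    using holomorphic_derivI[OF f open_UNIV UNIV_I] by (rule has_field_derivative_at_within)
  show "cmod (deriv f x) \<le> B" by (rule entire_deriv_bound[OF f B]) (use x in auto)
qed (use zw in auto)

lemma poly_norm_le:
  fixes p :: "complex poly"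
  assumes "degree p \<le> d" "\<And>i. cmod (coeff p i) \<le> c" "cmod z \<le> R"
  shows "cmod (poly p z) \<le> real (Suc d) * (c * max 1 R ^ d)"
proof -
  have c: "c \<ge> 0" using assms(2)[of 0] norm_ge_zero order_trans by blast
  have "poly p z = (\<Sum>i\<le>d. coeff p i * z ^ i)"
    unfolding poly_altdef using assms(1)
    by (intro sum.mono_neutral_left) (auto simp: coeff_eq_0)
  also have "cmod \<dots> \<le> (\<Sum>i\<le>d. c * max 1 R ^ d)"
  proof (rule order_trans[OF norm_sum sum_mono])
    fix i assume "i \<in> {..d}"
    then have "cmod z ^ i \<le> max 1 R ^ d"
      using assms(3) by (intro order_trans[OF power_mono[of "cmod z" "max 1 R"] power_increasing]) auto
    then show "cmod (coeff p i * z ^ i) \<le> c * max 1 R ^ d"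
      unfolding norm_mult norm_power using assms(2) c by (intro mult_mono) auto
  qed
  finally show ?thesis by simp
qed

lemma bounded_poly_seq_coeff:
  assumes P: "bounded_poly_seq d K M P" and "m \<ge> 1"
  shows "cmod (coeff (P m) i) \<le> max K M"
proof -
  consider "i < degree (P m)" | "i = degree (P m)" | "i > degree (P m)" by linarith
  then show ?thesis using assms by cases (auto simp: bounded_poly_seq_def coeff_eq_0 le_max_iff_disj)
qed

lemma Q_bounded:
  assumes P: "bounded_poly_seq d K M P"
  shows "\<exists>B. \<forall>n z. cmod z \<le> R \<longrightarrow> cmod (Q P n (n + N) z) \<le> B"
proof (induction N)
  case 0
  then show ?case by auto
next
  case (Suc N)
  then obtain B where B: "\<And>n z. cmod z \<le> R \<Longrightarrow> cmod (Q P n (n + N) z) \<le> B" by blast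
  have "cmod (Q P n (n + Suc N) z) \<le> real (Suc d) * (max K M * max 1 B ^ d)" if "cmod z \<le> R" for n z
  proof -
    have "cmod (poly (P (Suc (n + N))) (Q P n (n + N) z)) \<le> real (Suc d) * (max K M * max 1 B ^ d)"
      by (rule poly_norm_le[OF _ _ B[OF that]])
        (use bounded_poly_seq_degree[OF P, of "Suc (n + N)"] bounded_poly_seq_coeff[OF P, of "Suc (n + N)"] in auto)
    then show ?thesis by (simp add: Q_Suc)
  qed
  then show ?case by blast
qed

text \<open>For a fixed number of steps the composition depends continuously on the parameter, uniformly
  in the time at which it starts.\<close>

lemma Q_uniformly_continuous_in_parameter:
  assumes \<Lambda>: "open \<Lambda>" and fam: "analytic_family \<Lambda> P" and l: "l \<in> \<Lambda>" and "\<epsilon> > 0"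
  shows "\<exists>\<delta>>0. ball l \<delta> \<subseteq> \<Lambda> \<and> (\<forall>x\<in>ball l \<delta>. \<forall>n z. cmod z \<le> R \<longrightarrow>
     cmod (Q (P x) n (n + N) z - Q (P l) n (n + N) z) \<le> \<epsilon>)"
  using \<open>\<epsilon> > 0\<close>
proof (induction N arbitrary: \<epsilon>)
  case 0
  then show ?case using \<Lambda> l openE by (metis (no_types, lifting) Q_same add.right_neutral
      diff_self less_imp_le norm_zero)
next
  case (Suc N)
  obtain \<delta>0 L d K M where \<delta>0: "\<delta>0 > 0" "L > 0" "ball l \<delta>0 \<subseteq> \<Lambda>"
    and bd: "\<And>x. x \<in> ball l \<delta>0 \<Longrightarrow> bounded_poly_seq d K M (P x)"
    and lip: "\<And>x y m n. x \<in> ball l \<delta>0 \<Longrightarrow> y \<in> ball l \<delta>0 \<Longrightarrow> m \<ge> 1 \<Longrightarrow>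
        cmod (coeff (P x m) n - coeff (P y m) n) \<le> L * norm (x - y)"
    using analytic_family_coeff_Lipschitz[OF \<Lambda> fam l] by metis
  have ll: "l \<in> ball l \<delta>0" using \<delta>0 by simp
  obtain B where B: "\<And>n z. cmod z \<le> R \<Longrightarrow> cmod (Q (P l) n (n + N) z) \<le> B"
    using Q_bounded[OF bd[OF ll]] by blast
  obtain B1 where B1: "\<And>n z. cmod z \<le> (B + 1) + 1 \<Longrightarrow> cmod (Q (P l) n (n + 1) z) \<le> B1"
    using Q_bounded[OF bd[OF ll]] by blast
  define \<epsilon>' where "\<epsilon>' = min 1 (\<epsilon> / 2 / (max B1 1))"
  have \<epsilon>': "\<epsilon>' > 0" "\<epsilon>' \<le> 1" "B1 * \<epsilon>' \<le> \<epsilon> / 2"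
  proof -
    show p: "\<epsilon>' > 0" "\<epsilon>' \<le> 1" using Suc.prems by (auto simp: \<epsilon>'_def)
    have "B1 * \<epsilon>' \<le> max B1 1 * \<epsilon>'" using p by (intro mult_right_mono) auto
    also have "\<dots> \<le> max B1 1 * (\<epsilon> / 2 / max B1 1)" by (intro mult_left_mono) (auto simp: \<epsilon>'_def)
    finally show "B1 * \<epsilon>' \<le> \<epsilon> / 2" by simp
  qed
  obtain \<delta>1 where \<delta>1: "\<delta>1 > 0" "\<And>x n z. x \<in> ball l \<delta>1 \<Longrightarrow> cmod z \<le> R \<Longrightarrow>
     cmod (Q (P x) n (n + N) z - Q (P l) n (n + N) z) \<le> \<epsilon>'"
    using Suc.IH[OF \<epsilon>'(1)] by blast
  define G where "G = real (Suc d) * (L * max 1 (B + 1) ^ d)"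
  have G: "G > 0" unfolding G_def using \<delta>0(2) by (intro mult_pos_pos) auto
  define \<delta> where "\<delta> = min \<delta>0 (min \<delta>1 (\<epsilon> / 2 / G))"
  have "cmod (Q (P x) n (n + Suc N) z - Q (P l) n (n + Suc N) z) \<le> \<epsilon>"
    if x: "x \<in> ball l \<delta>" and z: "cmod z \<le> R" for x n z
  proof -
    have x0: "x \<in> ball l \<delta>0" "x \<in> ball l \<delta>1" and nx: "norm (x - l) \<le> \<epsilon> / 2 / G"
      using x by (auto simp: \<delta>_def dist_norm norm_minus_commute)
    let ?u = "Q (P x) n (n + N) z" and ?v = "Q (P l) n (n + N) z"
    let ?p = "P x (Suc (n + N))" and ?q = "P l (Suc (n + N))"
    have uv: "cmod (?u - ?v) \<le> \<epsilon>'" by (rule \<delta>1(2)[OF x0(2) z])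
    have v: "cmod ?v \<le> B" by (rule B[OF z])
    have u: "cmod ?u \<le> B + 1" using norm_triangle_sub[of ?u ?v] uv v \<epsilon>'(2) by linarith
    have "cmod (poly (?p - ?q) ?u) \<le> real (Suc d) * ((L * norm (x - l)) * max 1 (B + 1) ^ d)"
    proof (rule poly_norm_le[OF _ _ u])
      show "degree (?p - ?q) \<le> d"
        using bounded_poly_seq_degree[OF bd[OF x0(1)], of "Suc (n + N)"]
          bounded_poly_seq_degree[OF bd[OF ll], of "Suc (n + N)"] by (intro degree_diff_le) auto
      show "cmod (coeff (?p - ?q) i) \<le> L * norm (x - l)" for i
        using lip[OF x0(1) ll, of "Suc (n + N)" i] by simp
    qed
    also have "\<dots> = G * norm (x - l)" by (simp add: G_def)
    also have "\<dots> \<le> G * (\<epsilon> / 2 / G)" using nx G by (intro mult_left_mono) auto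
    finally have 1: "cmod (poly ?p ?u - poly ?q ?u) \<le> \<epsilon> / 2" using G by simp
    have "cmod (Q (P l) (n + N) (n + N + 1) ?u - Q (P l) (n + N) (n + N + 1) ?v) \<le> B1 * cmod (?u - ?v)"
      by (rule entire_Lipschitz[OF holomorphic_Q B1 u]) (use v in auto)
    also have "\<dots> \<le> B1 * \<epsilon>'"
      using uv order_trans[OF norm_ge_zero B1[of 0 "0"]] v norm_ge_zero[of ?v]
      by (intro mult_left_mono) auto
    finally have 2: "cmod (poly ?q ?u - poly ?q ?v) \<le> \<epsilon> / 2" using \<epsilon>'(3) by (simp add: Q_step)
    have "cmod (poly ?p ?u - poly ?q ?v) \<le> \<epsilon> / 2 + \<epsilon> / 2"
      using norm_triangle_ineq[of "poly ?p ?u - poly ?q ?u" "poly ?q ?u - poly ?q ?v"] 1 2 by simp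
    then show ?thesis by (simp add: Q_Suc)
  qed
  moreover have "\<delta> > 0" "ball l \<delta> \<subseteq> \<Lambda>" using \<delta>0 \<delta>1 G Suc.prems by (auto simp: \<delta>_def)
  ultimately show ?case by blast
qed

context hyperbolic_boettcher_sequence
begin

text \<open>Points at distance at least \<open>\<rho>\<close> from the basin move in \<open>N\<close> steps to points at distance at least
  \<open>2 \<rho>\<close>.
  Otherwise there is a Julia point \<open>y\<close> close to the image of \<open>z\<close>; its preimages are simple and one
  of them is close to \<open>z\<close>, so that the expansion near this preimage is effective.\<close>

lemma inner_set_expands:
  fixes \<rho> :: real
  defines "r \<equiv> escape_radius d K M"
  assumes big: "4 \<le> C * \<mu> ^ N"
    and L: "\<And>n z w. cmod z \<le> r \<Longrightarrow> cmod w \<le> r \<Longrightarrow>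
        cmod (deriv (Q P n (n + N)) z - deriv (Q P n (n + N)) w) \<le> B2 * cmod (z - w)"
    and \<rho>: "\<rho> > 0" "B2 * 2 ^ (d ^ N) * \<rho> \<le> 4" and B2: "B2 \<ge> 0"
    and z: "ball z \<rho> \<inter> escaping P n = {}"
  shows "ball (Q P n (n + N) z) (2 * \<rho>) \<inter> escaping P (n + N) = {}"
proof (rule ccontr)
  let ?f = "Q P n (n + N)"
  assume ne: "ball (?f z) (2 * \<rho>) \<inter> escaping P (n + N) \<noteq> {}"
  have "z \<in> ball z \<rho>" using \<rho> by simp
  then have zn: "z \<notin> escaping P n" using z by blast
  then have fz: "?f z \<notin> escaping P (n + N)" by (simp add: escaping_Q_iff)
  have zr: "cmod z \<le> r" unfolding r_def using not_escaping_bound[OF bounded zn] by simp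
  have "ball (?f z) (2 * \<rho>) \<inter> frontier (escaping P (n + N)) \<noteq> {}"
  proof (rule connected_Int_frontier[OF _ ne])
    have "?f z \<in> ball (?f z) (2 * \<rho>) - escaping P (n + N)" using fz \<rho> by simp
    then show "ball (?f z) (2 * \<rho>) - escaping P (n + N) \<noteq> {}" by blast
  qed simp
  moreover have "frontier (escaping P (n + N)) = julia P (n + N)"
    unfolding julia_eq[OF bounded] frontier_def using open_escaping[OF bounded] by (simp add: interior_open)
  ultimately obtain y where y: "y \<in> julia P (n + N)" "cmod (?f z - y) < 2 * \<rho>"
    by (auto simp: dist_norm)
  define p where "p = qpoly P n (n + N) - [:y:]"
  have pz: "poly p w = ?f w - y" for w by (simp add: p_def poly_qpoly)
  have pd: "poly (pderiv p) w = deriv ?f w" for w by (simp add: p_def deriv_Q_eq pderiv_diff pderiv_pCons)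
  have rootJ: "w \<in> julia P n" if "poly p w = 0" for w
    using that y julia_Q_iff[OF bounded, of n "n + N" w] by (simp add: pz)
  have exp: "4 \<le> cmod (deriv ?f w)" if "w \<in> julia P n" for w
    using expanding[OF that, of N] big by linarith
  have degq: "2 ^ N \<le> degree (qpoly P n (n + N))" "degree (qpoly P n (n + N)) \<le> d ^ N"
    using degree_qpoly_ge[OF bounded, of n "n + N"] degree_qpoly_le[OF bounded, of n "n + N"] by simp_all
  have q0: "degree (qpoly P n (n + N)) > 0" using degq(1) by (meson less_le_trans zero_less_numeral zero_less_power)
  have degp: "degree p = degree (qpoly P n (n + N))"
    unfolding p_def diff_conv_add_uminus using q0 by (intro degree_add_eq_left) simp
  then have p0: "p \<noteq> 0" using q0 by auto
  have sq: "rsquarefree p"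
    unfolding rsquarefree_roots using rootJ exp pd by (metis norm_zero not_numeral_le_zero)
  have fin: "finite {w. poly p w = 0}" by (rule poly_roots_finite[OF p0])
  have "\<exists>w. poly p w = 0"
    using fundamental_theorem_of_algebra[of p] constant_degree[of p] degp q0 by auto
  then obtain x where x: "poly p x = 0" "\<And>w. poly p w = 0 \<Longrightarrow> cmod (z - x) \<le> cmod (z - w)"
    using ex_is_arg_min_if_finite[OF fin, of "\<lambda>w. cmod (z - w)"]
    by (auto simp: is_arg_min_linorder)
  have xJ: "x \<in> julia P n" by (rule rootJ[OF x(1)])
  have xr: "cmod x \<le> r" unfolding r_def using julia_bound[OF bounded xJ] by simp
  have "cmod (z - x) * 4 \<le> cmod (z - x) * cmod (poly (pderiv p) x)"
    unfolding pd by (intro mult_left_mono exp xJ) simp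
  also have "\<dots> \<le> 2 ^ degree p * cmod (poly p z)" by (rule nearest_root_estimate[OF p0 sq x])
  also have "\<dots> \<le> 2 ^ (d ^ N) * (2 * \<rho>)"
    using y(2) degq(2) by (intro mult_mono power_increasing) (simp_all add: degp pz)
  finally have zx: "cmod (z - x) \<le> 2 ^ (d ^ N) * \<rho> / 2" by argo
  then have "B2 * cmod (z - x) \<le> B2 * (2 ^ (d ^ N) * \<rho> / 2)" by (rule mult_left_mono[OF _ B2])
  also have "\<dots> \<le> 2" using \<rho>(2) by simp
  finally have small: "B2 * cmod (z - x) \<le> 2" .
  let ?g = "\<lambda>w. ?f w - deriv ?f x * w"
  have "cmod (?g z - ?g x) \<le> 2 * cmod (z - x)"
  proof (rule field_differentiable_bound[where S = "closed_segment x z" and f' = "\<lambda>w. deriv ?f w - deriv ?f x"])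
    fix w assume w: "w \<in> closed_segment x z"
    show "(?g has_field_derivative deriv ?f w - deriv ?f x) (at w within closed_segment x z)"
      by (auto intro!: derivative_eq_intros has_field_derivative_at_within[OF DERIV_Q])
    have "w \<in> cball 0 r"
      using w closed_segment_subset[of x "cball 0 r" z] xr zr by auto
    then have "cmod (deriv ?f w - deriv ?f x) \<le> B2 * cmod (w - x)" using L xr by simp
    also have "\<dots> \<le> B2 * cmod (z - x)"
      using segment_bound(1)[OF w] B2 by (intro mult_left_mono) (auto simp: norm_minus_commute)
    finally show "cmod (deriv ?f w - deriv ?f x) \<le> 2" using small by linarith
  qed auto
  moreover have "?g z - ?g x = (?f z - y) - deriv ?f x * (z - x)"
    using x(1) by (simp add: pz algebra_simps)
  moreover have "cmod (deriv ?f x * (z - x)) - cmod (?f z - y) \<le> cmod ((?f z - y) - deriv ?f x * (z - x))"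
    using norm_triangle_ineq2[of "deriv ?f x * (z - x)" "?f z - y"] by (simp add: norm_minus_commute)
  moreover have "4 * cmod (z - x) \<le> cmod (deriv ?f x * (z - x))"
    unfolding norm_mult by (rule mult_right_mono[OF exp[OF xJ]]) simp
  ultimately have "2 * cmod (z - x) < 2 * \<rho>" using y(2) by simp
  then have "x \<in> ball z \<rho>" by (simp add: dist_norm)
  moreover have "x \<in> closure (escaping P n)" using xJ julia_eq[OF bounded] by blast
  ultimately show False using z by (metis open_ball open_Int_closure_eq_empty empty_iff IntI)
qed

text \<open>By the preceding lemma the points at distance at least \<open>\<rho>\<close> from the basin have bounded orbits
  also under the perturbed sequence. So a point of the perturbed Julia set is within \<open>2 \<rho>\<close> of the
  unperturbed basin, on which \<open>N\<close> steps expand at least by 4; the perturbed sequence still expands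
  by 2 there.\<close>

lemma hyperbolic_perturbation:
  "\<exists>N \<epsilon>. \<epsilon> > 0 \<and> (\<forall>P'. bounded_poly_seq d K M P' \<longrightarrow>
     (\<forall>k\<in>{1, N}. \<forall>n z. cmod z \<le> escape_radius d K M + 3 \<longrightarrow>
        cmod (Q P' n (n + k) z - Q P n (n + k) z) \<le> \<epsilon>) \<longrightarrow> hyperbolic P')"
proof -
  define r where "r = escape_radius d K M"
  define c where "c = min C 1"
  have c: "0 < c" "c \<le> 1" using C by (auto simp: c_def)
  obtain N0 where N0: "4 / c < \<mu> ^ N0" using real_arch_pow[OF \<mu>] by blast
  define N where "N = Suc N0"
  have "4 / c \<le> \<mu> ^ N" using N0 \<mu> power_increasing[of N0 N \<mu>] unfolding N_def by linarith
  then have cN: "4 \<le> c * \<mu> ^ N" using c by (simp add: field_simps)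
  moreover have "c * \<mu> ^ N \<le> C * \<mu> ^ N" using \<mu> by (intro mult_right_mono) (auto simp: c_def)
  ultimately have CN: "4 \<le> C * \<mu> ^ N" by linarith
  obtain Ba where Ba: "\<And>n z. cmod z \<le> (r + 3) + 1 \<Longrightarrow> cmod (Q P n (n + 1) z) \<le> Ba"
    using Q_bounded[OF bounded] by blast
  obtain Bb where Bb: "\<And>n z. cmod z \<le> (r + 3) + 1 \<Longrightarrow> cmod (Q P n (n + N) z) \<le> Bb"
    using Q_bounded[OF bounded] by blast
  define B2 where "B2 = max 1 (max Ba Bb)"
  have B2: "B2 \<ge> 1" by (simp add: B2_def)
  have "cmod (Q P n (n + k) z) \<le> B2" if "k \<in> {1, N}" "cmod z \<le> (r + 3) + 1" for k n z
    using Ba[OF that(2), of n] Bb[OF that(2), of n] that(1) by (auto simp: B2_def le_max_iff_disj)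
  then have "cmod (deriv (Q P n (n + k)) z) \<le> B2" if "k \<in> {1, N}" "cmod z \<le> r + 3" for k n z
    by (intro entire_deriv_bound[OF holomorphic_Q _ that(2)]) (use that(1) in blast)
  then have Lip: "cmod (deriv (Q P n (n + k)) z - deriv (Q P n (n + k)) w) \<le> B2 * cmod (z - w)"
    if "k \<in> {1, N}" "cmod z \<le> r + 2" "cmod w \<le> r + 2" for k n z w
    by (intro entire_Lipschitz[where R = "r + 2"] holomorphic_deriv[OF holomorphic_Q open_UNIV] that)
      (use that(1) in auto)
  \<comment> \<open>So small that derivatives change by at most \<open>c / 4\<close> over a distance of \<open>2 \<rho>\<close> and that the
    nearest root, known to a factor of \<open>2 ^ (d ^ N)\<close>, lies where the expansion is effective.\<close>
  define \<rho> where "\<rho> = c / (8 * B2 * 2 ^ (d ^ N))"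
  have \<rho>: "\<rho> > 0" "2 * \<rho> \<le> 1" "2 * \<rho> * B2 \<le> c / 4" "B2 * 2 ^ (d ^ N) * \<rho> \<le> 4"
  proof -
    show "\<rho> > 0" using c B2 by (simp add: \<rho>_def)
    have e: "8 * B2 * 2 ^ (d ^ N) * \<rho> = c" using B2 by (simp add: \<rho>_def)
    have "1 * B2 \<le> 2 ^ (d ^ N) * B2" using B2 by (intro mult_right_mono) auto
    then have "8 * B2 * \<rho> \<le> 8 * B2 * 2 ^ (d ^ N) * \<rho>" using \<open>\<rho> > 0\<close> by (simp add: mult.commute)
    then have 8: "8 * B2 * \<rho> \<le> c" using e by simp
    then show "2 * \<rho> * B2 \<le> c / 4" by (simp add: mult.commute mult.left_commute)
    have "8 * 1 * \<rho> \<le> 8 * B2 * \<rho>" using B2 \<open>\<rho> > 0\<close> by (intro mult_right_mono) auto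
    then show "2 * \<rho> \<le> 1" using 8 c by linarith
    show "B2 * 2 ^ (d ^ N) * \<rho> \<le> 4" using e c by simp
  qed
  define \<epsilon> where "\<epsilon> = min \<rho> (c / 4)"
  have \<epsilon>: "\<epsilon> > 0" "\<epsilon> \<le> \<rho>" "\<epsilon> \<le> c / 4" using \<rho> c by (auto simp: \<epsilon>_def)
  have "hyperbolic P'" if P': "bounded_poly_seq d K M P'"
    and close: "\<And>k n z. k \<in> {1, N} \<Longrightarrow> cmod z \<le> r + 3 \<Longrightarrow> cmod (Q P' n (n + k) z - Q P n (n + k) z) \<le> \<epsilon>"
    for P'
  proof -
    have dclose: "cmod (deriv (Q P' n (n + k)) z - deriv (Q P n (n + k)) z) \<le> \<epsilon>"
      if k: "k \<in> {1, N}" and z: "cmod z \<le> r + 2" for k n z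
    proof -
      have "deriv (\<lambda>z. Q P' n (n + k) z - Q P n (n + k) z) z =
          deriv (Q P' n (n + k)) z - deriv (Q P n (n + k)) z"
        by (rule DERIV_imp_deriv[OF DERIV_diff[OF DERIV_Q DERIV_Q]])
      moreover have "cmod (deriv (\<lambda>z. Q P' n (n + k) z - Q P n (n + k) z) z) \<le> \<epsilon>"
        by (rule entire_deriv_bound[OF _ _ z]) (use close[OF k] in \<open>auto intro!: holomorphic_intros holomorphic_Q\<close>)
      ultimately show ?thesis by simp
    qed
    \<comment> \<open>The inner set at distance \<open>\<rho>\<close> is mapped into itself by \<open>N\<close> steps of the perturbation.\<close>
    have inner: "ball (Q P' n (n + k * N) z) \<rho> \<inter> escaping P (n + k * N) = {}"
      if "ball z \<rho> \<inter> escaping P n = {}" for n k z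
    proof (induction k)
      case 0
      then show ?case using that by simp
    next
      case (Suc k)
      let ?n = "n + k * N" let ?u = "Q P' n (n + k * N) z"
      have A: "ball (Q P ?n (?n + N) ?u) (2 * \<rho>) \<inter> escaping P (?n + N) = {}"
        by (rule inner_set_expands[OF CN Lip \<rho>(1,4) _ Suc]) (use B2 r_def N_def in auto)
      have "cmod ?u \<le> r + 3"
      proof -
        have "?u \<in> ball ?u \<rho>" using \<rho>(1) by simp
        then have "?u \<notin> escaping P ?n" using Suc by blast
        then show ?thesis using not_escaping_bound[OF bounded] unfolding r_def by fastforce
      qed
      then have "dist (Q P' ?n (?n + N) ?u) (Q P ?n (?n + N) ?u) \<le> \<rho>"
        using close[of N ?u ?n] \<epsilon>(2) by (simp add: dist_norm)
      then have sub: "ball (Q P' ?n (?n + N) ?u) \<rho> \<subseteq> ball (Q P ?n (?n + N) ?u) (2 * \<rho>)"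
        by (simp add: ball_subset_ball_iff)
      have eq1: "Q P' ?n (?n + N) ?u = Q P' n (?n + N) z"
        by (rule Q_trans[symmetric]) auto
      have eq2: "?n + N = n + Suc k * N" by simp
      have "ball (Q P' ?n (?n + N) ?u) \<rho> \<inter> escaping P (?n + N) = {}" using A sub by blast
      then show ?case unfolding eq1 unfolding eq2 .
    qed
    have notesc: "z \<notin> escaping P' n" if z: "ball z \<rho> \<inter> escaping P n = {}" for n z
    proof
      assume "z \<in> escaping P' n"
      then have "\<forall>\<^sub>F j in sequentially. r \<le> cmod (Q P' n j z)"
        unfolding escaping_def filterlim_at_top by blast
      then obtain J where J: "\<And>j. j \<ge> J \<Longrightarrow> r \<le> cmod (Q P' n j z)" unfolding eventually_sequentially by blast
      have "n + J * N \<ge> J" by (simp add: N_def)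
      then have "r \<le> cmod (Q P' n (n + J * N) z)" by (rule J)
      moreover have "Q P' n (n + J * N) z \<notin> escaping P (n + J * N)"
        using inner[OF z, of J] \<rho>(1) by (auto simp: disjoint_iff)
      ultimately show False using not_escaping_bound[OF bounded] unfolding r_def by fastforce
    qed
    have near: "\<exists>a\<in>escaping P n. cmod (z - a) < 2 * \<rho>" if z: "z \<in> julia P' n" for z n
    proof (rule ccontr)
      assume "\<not> ?thesis"
      then have far: "\<And>a. a \<in> escaping P n \<Longrightarrow> 2 * \<rho> \<le> dist z a" by (force simp: dist_norm)
      have "w \<notin> escaping P' n" if w: "w \<in> ball z \<rho>" for w
      proof (rule notesc)
        have "a \<notin> escaping P n" if "dist w a < \<rho>" for a
          using far[of a] dist_triangle[of z a w] w that by force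
        then show "ball w \<rho> \<inter> escaping P n = {}" by auto
      qed
      then have "ball z \<rho> \<inter> escaping P' n = {}" by blast
      then have "ball z \<rho> \<inter> closure (escaping P' n) = {}" by (simp add: open_Int_closure_eq_empty)
      moreover have "z \<in> ball z \<rho> \<inter> closure (escaping P' n)"
        using z \<rho>(1) unfolding julia_eq[OF P'] by simp
      ultimately show False by blast
    qed
    have lower: "cmod (deriv (Q P n (n + k)) a) - c / 2 \<le> cmod (deriv (Q P' n (n + k)) z)"
      if k: "k \<in> {1, N}" and z: "z \<in> julia P' n" and a: "cmod (z - a) < 2 * \<rho>" for k n z a
    proof -
      have zr: "cmod z \<le> r" using julia_bound[OF P' z] unfolding r_def by simp
      have ar: "cmod a \<le> r + 2" using norm_triangle_sub[of a z] zr a \<rho>(2) by (simp add: norm_minus_commute)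
      have "cmod (deriv (Q P n (n + k)) a - deriv (Q P n (n + k)) z) \<le> B2 * cmod (a - z)"
        by (rule Lip[OF k ar]) (use zr in simp)
      also have "\<dots> \<le> B2 * (2 * \<rho>)" using a B2 by (intro mult_left_mono) (auto simp: norm_minus_commute)
      also have "\<dots> \<le> c / 4" using \<rho>(3) by (simp add: mult.commute)
      finally have 1: "cmod (deriv (Q P n (n + k)) a - deriv (Q P n (n + k)) z) \<le> c / 4" .
      have 2: "cmod (deriv (Q P' n (n + k)) z - deriv (Q P n (n + k)) z) \<le> c / 4"
        using dclose[OF k, of z n] zr \<epsilon>(3) by force
      show ?thesis
        using norm_triangle_sub[of "deriv (Q P n (n + k)) a" "deriv (Q P n (n + k)) z"]
          norm_triangle_sub[of "deriv (Q P n (n + k)) z" "deriv (Q P' n (n + k)) z"] 1 2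
        by (simp add: norm_minus_commute)
    qed
    have blockN: "2 \<le> cmod (deriv (Q P' n (n + N)) z)" if z: "z \<in> julia P' n" for z n
    proof -
      obtain a where a: "a \<in> escaping P n" "cmod (z - a) < 2 * \<rho>" using near[OF z] by blast
      show ?thesis
        using lower[OF _ z a(2), of N] expanding_escaping[OF a(1), of "n + N"] cN c by (simp add: c_def)
    qed
    have block1: "c / 2 \<le> cmod (deriv (Q P' n (n + 1)) z)" if z: "z \<in> julia P' n" for z n
    proof -
      obtain a where a: "a \<in> escaping P n" "cmod (z - a) < 2 * \<rho>" using near[OF z] by blast
      have "c \<le> c * \<mu>" using c \<mu> by simp
      then show ?thesis
        using lower[OF _ z a(2), of 1] expanding_escaping[OF a(1), of "n + 1"] by (simp add: c_def)
    qed
    have inJ: "Q P' n (n + k) z \<in> julia P' (n + k)" if "z \<in> julia P' n" for n k z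
      using that julia_Q_iff[OF P', of n "n + k" z] by simp
    have blocks: "2 ^ k \<le> cmod (deriv (Q P' n (n + k * N)) z)" if z: "z \<in> julia P' n" for z n k
    proof (induction k)
      case (Suc k)
      have "deriv (Q P' n (n + Suc k * N)) z =
          deriv (Q P' (n + k * N) (n + k * N + N)) (Q P' n (n + k * N) z) * deriv (Q P' n (n + k * N)) z"
        using deriv_Q_trans[of n "n + k * N" "n + Suc k * N" P' z] by (simp add: add.commute add.left_commute)
      then show ?case
        using mult_mono[OF blockN[OF inJ[OF z, of "k * N"]] Suc] by (simp add: norm_mult)
    qed (simp add: deriv_Q_same)
    have singles: "(c / 2) ^ s \<le> cmod (deriv (Q P' n (n + s)) z)" if z: "z \<in> julia P' n" for z n s
    proof (induction s)
      case (Suc s)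
      have "deriv (Q P' n (n + Suc s)) z =
          deriv (Q P' (n + s) (n + s + 1)) (Q P' n (n + s) z) * deriv (Q P' n (n + s)) z"
        using deriv_Q_trans[of n "n + s" "n + Suc s" P' z] by simp
      then show ?case
        using mult_mono[OF block1[OF inJ[OF z, of s]] Suc] c by (simp add: norm_mult)
    qed (simp add: deriv_Q_same)
    define \<nu> where "\<nu> = 2 powr (1 / real N)"
    have N1: "N \<ge> 1" by (simp add: N_def)
    have \<nu>: "\<nu> > 1" "\<nu> ^ N = 2" using N1 by (simp_all add: \<nu>_def powr_realpow[symmetric] powr_powr)
    have "(c / 2) ^ N / 2 * \<nu> ^ i \<le> cmod (deriv (Q P' m (m + i)) z)" if z: "z \<in> julia P' m" for i m z
    proof -
      \<comment> \<open>Blocks of \<open>N\<close> steps double the derivative; fewer than \<open>N\<close> single steps remain.\<close>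
      define k s where "k = i div N" and "s = i mod N"
      have i: "i = k * N + s" and sN: "s < N" using N1 by (simp_all add: k_def s_def)
      have "\<nu> ^ i = 2 ^ k * \<nu> ^ s" unfolding i power_add by (simp add: \<nu>(2) mult.commute[of k N] power_mult)
      also have "\<dots> \<le> 2 ^ k * 2"
        using power_increasing[of s N \<nu>] sN \<nu> by simp
      finally have "(c / 2) ^ N / 2 * \<nu> ^ i \<le> (c / 2) ^ N / 2 * (2 ^ k * 2)"
        by (rule mult_left_mono) (use c in simp)
      also have "\<dots> = (c / 2) ^ N * 2 ^ k" by simp
      also have "\<dots> \<le> (c / 2) ^ s * 2 ^ k"
        using c sN by (intro mult_right_mono power_decreasing) auto
      also have "\<dots> \<le> cmod (deriv (Q P' (m + k * N) (m + k * N + s)) (Q P' m (m + k * N) z)) *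
          cmod (deriv (Q P' m (m + k * N)) z)"
        by (intro mult_mono singles[OF inJ[OF z]] blocks[OF z]) auto
      also have "\<dots> = cmod (deriv (Q P' m (m + i)) z)"
        using deriv_Q_trans[of m "m + k * N" "m + i" P' z] by (simp add: i norm_mult add.assoc)
      finally show ?thesis .
    qed
    moreover have "(c / 2) ^ N / 2 > 0" using c by simp
    ultimately show ?thesis unfolding hyperbolic_def using \<nu>(1) by blast
  qed
  then show ?thesis using \<epsilon>(1) unfolding r_def by blast
qed

end

lemma boettcher_sequenceI:
  assumes "bounded_poly_seq d K M P" and e: "\<And>m. exterior_inverse (\<phi> m) (escaping P m) (S m)"
    and "\<And>m w. 1 < cmod w \<Longrightarrow> poly (P (Suc m)) (S m w) = S (Suc m) (w ^ degree (P (Suc m)))"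
    and "\<And>m w. 1 < cmod w \<Longrightarrow> cmod (S m w) \<le> B * cmod w"
  shows "boettcher_sequence P d K M B S"
  using assms unfolding boettcher_sequence_def exterior_inverse_def by blast

text \<open>Every parameter in the component carries Boettcher maps, so that \<open>hyperbolic_perturbation\<close>
  applies to it; the ball that it gives is connected and hence stays in the component.\<close>

lemma hyperbolic_component_open:
  assumes \<Lambda>: "open \<Lambda>" and fam: "analytic_family \<Lambda> P" and comp: "hyperbolic_component \<Lambda> P \<Omega>"
    and bf: "boettcher_family \<Lambda> \<Omega> P \<phi>"
  shows "open \<Omega>"
proof -
  have \<Omega>: "\<Omega> \<subseteq> hyperbolic_parameters \<Lambda> P"
    using comp unfolding hyperbolic_component_def by (rule in_components_subset)
  then have \<Omega>\<Lambda>: "\<Omega> \<subseteq> \<Lambda>" by (auto simp: hyperbolic_parameters_def)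
  obtain S where S: "\<And>l m. l \<in> \<Omega> \<Longrightarrow> exterior_inverse (\<phi> l m) (escaping (P l) m) (S l m)"
    "\<And>l m w. l \<in> \<Omega> \<Longrightarrow> 1 < cmod w \<Longrightarrow>
       poly (P l (Suc m)) (S l m w) = S l (Suc m) (w ^ degree (P l (Suc m)))"
    "\<And>l. l \<in> \<Omega> \<Longrightarrow> \<exists>\<delta>>0. \<exists>d K M B. ball l \<delta> \<subseteq> \<Lambda> \<and> (\<forall>x\<in>ball l \<delta>. bounded_poly_seq d K M (P x)) \<and>
       (\<forall>x\<in>ball l \<delta> \<inter> \<Omega>. \<forall>m w. 1 < cmod w \<longrightarrow> cmod (S x m w) \<le> B * cmod w)"
    using boettcher_family_inverse[OF \<Lambda> fam \<Omega>\<Lambda> bf] by metis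
  have "\<exists>e>0. ball l e \<subseteq> \<Omega>" if l: "l \<in> \<Omega>" for l
  proof -
    obtain \<delta> d K M B where \<delta>: "\<delta> > 0" "ball l \<delta> \<subseteq> \<Lambda>" "\<forall>x\<in>ball l \<delta>. bounded_poly_seq d K M (P x)"
       "\<forall>x\<in>ball l \<delta> \<inter> \<Omega>. \<forall>m w. 1 < cmod w \<longrightarrow> cmod (S x m w) \<le> B * cmod w"
      using S(3)[OF l] by blast
    have ll: "l \<in> ball l \<delta>" using \<delta>(1) by simp
    obtain C \<mu> where C: "C > 0" "\<mu> > 1" "\<And>i m z. z \<in> julia (P l) m \<Longrightarrow>
        C * \<mu> ^ i \<le> cmod (deriv (Q (P l) m (m + i)) z)"
      using \<Omega> l unfolding hyperbolic_parameters_def hyperbolic_def by blast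
    interpret hyperbolic_boettcher_sequence "P l" d K M B "S l" C \<mu>
      unfolding hyperbolic_boettcher_sequence_def hyperbolic_boettcher_sequence_axioms_def
      using C \<delta> ll l S by (intro conjI boettcher_sequenceI[where \<phi> = "\<phi> l"]) auto
    obtain N \<epsilon> where N: "\<epsilon> > 0" "\<forall>P'. bounded_poly_seq d K M P' \<longrightarrow>
     (\<forall>k\<in>{1, N}. \<forall>n z. cmod z \<le> escape_radius d K M + 3 \<longrightarrow>
        cmod (Q P' n (n + k) z - Q (P l) n (n + k) z) \<le> \<epsilon>) \<longrightarrow> hyperbolic P'"
      using hyperbolic_perturbation by blast
    have l': "l \<in> \<Lambda>" using l \<Omega>\<Lambda> by blast
    obtain \<delta>1 where \<delta>1: "\<delta>1 > 0" "\<forall>x\<in>ball l \<delta>1. \<forall>n z. cmod z \<le> escape_radius d K M + 3 \<longrightarrow>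
        cmod (Q (P x) n (n + 1) z - Q (P l) n (n + 1) z) \<le> \<epsilon>"
      using Q_uniformly_continuous_in_parameter[OF \<Lambda> fam l' N(1)] by blast
    obtain \<delta>2 where \<delta>2: "\<delta>2 > 0" "\<forall>x\<in>ball l \<delta>2. \<forall>n z. cmod z \<le> escape_radius d K M + 3 \<longrightarrow>
        cmod (Q (P x) n (n + N) z - Q (P l) n (n + N) z) \<le> \<epsilon>"
      using Q_uniformly_continuous_in_parameter[OF \<Lambda> fam l' N(1)] by blast
    define e where "e = min \<delta> (min \<delta>1 \<delta>2)"
    have e: "e > 0" using \<delta>(1) \<delta>1(1) \<delta>2(1) by (simp add: e_def)
    have "hyperbolic (P x)" if x: "x \<in> ball l e" for x
    proof (rule N(2)[rule_format])
      have x': "x \<in> ball l \<delta>" "x \<in> ball l \<delta>1" "x \<in> ball l \<delta>2" using x by (auto simp: e_def)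
      show "bounded_poly_seq d K M (P x)" using \<delta>(3) x'(1) by blast
      fix k n z assume "k \<in> {1, N}" "cmod z \<le> escape_radius d K M + 3"
      then show "cmod (Q (P x) n (n + k) z - Q (P l) n (n + k) z) \<le> \<epsilon>"
        using \<delta>1(2) \<delta>2(2) x' by blast
    qed
    then have "ball l e \<subseteq> hyperbolic_parameters \<Lambda> P"
      using \<delta>(2) by (auto simp: hyperbolic_parameters_def e_def)
    then have "ball l e \<subseteq> \<Omega>"
      
    proof (rule components_maximal[OF comp[unfolded hyperbolic_component_def] connected_ball])
      have "l \<in> \<Omega> \<inter> ball l e" using l e by simp
      then show "\<Omega> \<inter> ball l e \<noteq> {}" by blast
    qed
    then show ?thesis using e by blast
  qed
  then show ?thesis unfolding open_contains_ball by blast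
qed

section \<open>Extension of the motion from the basins to the Julia sets\<close>

text \<open>The family over the component, in the coordinates of the inverse Boettcher maps \<open>S l m\<close>. All
  bounds are locally uniform in the parameter and uniform in the time.\<close>

locale boettcher_motion =
  fixes P :: "linf \<Rightarrow> nat \<Rightarrow> complex poly" and S :: "linf \<Rightarrow> nat \<Rightarrow> complex \<Rightarrow> complex"
    and \<Omega> :: "linf set" and l0 :: linf
  assumes open_\<Omega>: "open \<Omega>" and connected_\<Omega>: "connected \<Omega>" and l0: "l0 \<in> \<Omega>"
    and locally_uniform: "l \<in> \<Omega> \<Longrightarrow> \<exists>\<delta>>0. \<exists>d K M B. B > 0 \<and> ball l \<delta> \<subseteq> \<Omega> \<and>
       (\<forall>x\<in>ball l \<delta>. boettcher_sequence (P x) d K M B (S x))"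
    and hyperbolic: "l \<in> \<Omega> \<Longrightarrow> hyperbolic (P l)"
    and degree_constant: "l \<in> \<Omega> \<Longrightarrow> degree (P l (Suc m)) = degree (P l0 (Suc m))"
    and S_holomorphic: "1 < cmod w \<Longrightarrow> frechet_holomorphic_on (\<lambda>l. S l m w) \<Omega>"
begin

lemma hyperbolic_boettcher:
  assumes "l \<in> \<Omega>"
  obtains d K M B C \<mu> where "hyperbolic_boettcher_sequence (P l) d K M B (S l) C \<mu>"
proof -
  obtain \<delta> d K M B where "\<delta> > 0" "\<forall>x\<in>ball l \<delta>. boettcher_sequence (P x) d K M B (S x)"
    using locally_uniform[OF assms] by blast
  then have "boettcher_sequence (P l) d K M B (S l)" by simp
  moreover obtain C \<mu> where "C > 0" "\<mu> > 1" "\<forall>i m. \<forall>z\<in>julia (P l) m. C * \<mu> ^ i \<le> cmod (deriv (Q (P l) m (m + i)) z)"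
    using hyperbolic[OF assms] unfolding hyperbolic_def by blast
  ultimately show thesis
    using that[of d K M B C \<mu>]
    unfolding hyperbolic_boettcher_sequence_def hyperbolic_boettcher_sequence_axioms_def by blast
qed

lemma bounded_seq: "l \<in> \<Omega> \<Longrightarrow> \<exists>d K M. bounded_poly_seq d K M (P l)"
  using hyperbolic_boettcher unfolding hyperbolic_boettcher_sequence_def boettcher_sequence_def by metis

lemma S_facts:
  assumes "l \<in> \<Omega>"
  shows S_in: "1 < cmod w \<Longrightarrow> S l m w \<in> escaping (P l) m"
    and S_surj: "z \<in> escaping (P l) m \<Longrightarrow> \<exists>w. 1 < cmod w \<and> z = S l m w"
    and S_inj: "1 < cmod v \<Longrightarrow> 1 < cmod w \<Longrightarrow> S l m v = S l m w \<longleftrightarrow> v = w"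
    and S_eq: "1 < cmod w \<Longrightarrow> poly (P l (Suc m)) (S l m w) = S l (Suc m) (w ^ degree (P l0 (Suc m)))"
    and S_inf: "filterlim (S l m) at_infinity at_infinity"
    and S_bound: "\<exists>B>0. \<forall>w. 1 < cmod w \<longrightarrow> cmod (S l m w) \<le> B * cmod w"
    and S_hol: "S l m holomorphic_on {w. 1 < cmod w}"
    and julia_not_escaping: "z \<in> julia (P l) m \<Longrightarrow> z \<notin> escaping (P l) m"
    and open_esc: "open (escaping (P l) m)"
proof -
  obtain d K M B C \<mu> where "hyperbolic_boettcher_sequence (P l) d K M B (S l) C \<mu>"
    using hyperbolic_boettcher[OF assms] .
  then interpret hyperbolic_boettcher_sequence "P l" d K M B "S l" C \<mu> .
  show "1 < cmod w \<Longrightarrow> S l m w \<in> escaping (P l) m" by (rule S_in)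
  show "z \<in> escaping (P l) m \<Longrightarrow> \<exists>w. 1 < cmod w \<and> z = S l m w" by (rule S_surj)
  show "1 < cmod v \<Longrightarrow> 1 < cmod w \<Longrightarrow> S l m v = S l m w \<longleftrightarrow> v = w" by (rule S_inj)
  show "1 < cmod w \<Longrightarrow> poly (P l (Suc m)) (S l m w) = S l (Suc m) (w ^ degree (P l0 (Suc m)))"
    using S_eq degree_constant[OF assms] by simp
  show "filterlim (S l m) at_infinity at_infinity" by (rule S_inf)
  show "S l m holomorphic_on {w. 1 < cmod w}" by (rule hol)
  have "cmod (S l m w) \<le> max B 1 * cmod w" if "1 < cmod w" for w
    by (rule order_trans[OF S_bound[OF that] mult_right_mono]) auto
  then show "\<exists>B>0. \<forall>w. 1 < cmod w \<longrightarrow> cmod (S l m w) \<le> B * cmod w"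
    by (intro exI[of _ "max B 1"]) auto
  show "z \<in> julia (P l) m \<Longrightarrow> z \<notin> escaping (P l) m" using julia_eq[OF bounded] by blast
  show "open (escaping (P l) m)" by (rule open_escaping[OF bounded])
qed

lemma landing:
  assumes "l \<in> \<Omega>"
  shows ray_lands: "cmod e = 1 \<Longrightarrow> \<exists>q\<in>julia (P l) m. ((\<lambda>R. S l m (of_real R * e)) \<longlongrightarrow> q) (at_right 1)"
    and julia_landing: "x \<in> julia (P l) m \<Longrightarrow>
          \<exists>e. cmod e = 1 \<and> ((\<lambda>R. S l m (of_real R * e)) \<longlongrightarrow> x) (at_right 1)"
    and landing_in_julia: "cmod e = 1 \<Longrightarrow> ((\<lambda>R. S l m (of_real R * e)) \<longlongrightarrow> x) (at_right 1) \<Longrightarrow>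
          x \<in> julia (P l) m"
    and julia_nonempty: "julia (P l) m \<noteq> {}"
proof -
  obtain d K M B C \<mu> where "hyperbolic_boettcher_sequence (P l) d K M B (S l) C \<mu>"
    using hyperbolic_boettcher[OF assms] .
  then interpret hyperbolic_boettcher_sequence "P l" d K M B "S l" C \<mu> .
  show *: "\<And>e. cmod e = 1 \<Longrightarrow> \<exists>q\<in>julia (P l) m. ((\<lambda>R. S l m (of_real R * e)) \<longlongrightarrow> q) (at_right 1)"
    by (rule ray_lands)
  show "x \<in> julia (P l) m \<Longrightarrow> \<exists>e. cmod e = 1 \<and> ((\<lambda>R. S l m (of_real R * e)) \<longlongrightarrow> x) (at_right 1)"
    by (rule julia_point_is_landing_point)
  show "x \<in> julia (P l) m" if "cmod e = 1" "((\<lambda>R. S l m (of_real R * e)) \<longlongrightarrow> x) (at_right 1)"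
    using *[OF that(1)] tendsto_unique[OF trivial_limit_at_right_real that(2)] by blast
  show "julia (P l) m \<noteq> {}" by (rule julia_nonempty)
qed

lemma julia_forward:
  "l \<in> \<Omega> \<Longrightarrow> m \<le> n \<Longrightarrow> x \<in> julia (P l) m \<Longrightarrow> Q (P l) m n x \<in> julia (P l) n"
  using bounded_seq julia_Q_iff by blast

definition annulus :: "real \<Rightarrow> complex set" where
  "annulus \<rho> = {w. 1 < cmod w \<and> cmod w \<le> \<rho>}"

lemma local_distortion:
  assumes l: "l \<in> \<Omega>" and \<rho>: "\<rho> > 1"
  shows "\<exists>\<delta> c. \<delta> > 0 \<and> c > 0 \<and> ball l \<delta> \<subseteq> \<Omega> \<and>
     (\<forall>x\<in>ball l \<delta>. \<forall>v\<in>annulus \<rho>. \<forall>w\<in>annulus \<rho>.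
       cmod (S x m v - S x m w) ^ 3 \<le> c * cmod (S l m v - S l m w) \<and>
       cmod (S l m v - S l m w) ^ 3 \<le> c * cmod (S x m v - S x m w))"
proof -
  obtain \<delta> d K M B where \<delta>: "\<delta> > 0" "B > 0" "ball l \<delta> \<subseteq> \<Omega>"
      "\<forall>x\<in>ball l \<delta>. boettcher_sequence (P x) d K M B (S x)"
    using locally_uniform[OF l] by blast
  have *: "cmod (S x m v - S x m w) ^ 3 \<le> (3 * (B * \<rho>))\<^sup>2 * cmod (S l m v - S l m w) \<and>
       cmod (S l m v - S l m w) ^ 3 \<le> (3 * (B * \<rho>))\<^sup>2 * cmod (S x m v - S x m w)"
    if x: "x \<in> ball l (\<delta>/2)" and vw: "v \<in> annulus \<rho>" "w \<in> annulus \<rho>" for x v w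
  proof (cases "v = w")
    case False
    have h: "frechet_holomorphic_on (\<lambda>l. S l m u) (ball l \<delta>)" if "u \<in> annulus \<rho>" for u
      by (rule frechet_holomorphic_on_subset[OF S_holomorphic \<delta>(3)]) (use that in \<open>simp add: annulus_def\<close>)
    have b: "cmod (S y m u) \<le> B * \<rho>" if "u \<in> annulus \<rho>" "y \<in> ball l \<delta>" for u y
    proof -
      have "cmod (S y m u) \<le> B * cmod u"
        using \<delta>(4) that by (auto simp: annulus_def intro: boettcher_sequence.S_bound)
      also have "\<dots> \<le> B * \<rho>" using that \<delta>(2) by (intro mult_left_mono) (auto simp: annulus_def)
      finally show ?thesis .
    qed
    have ne: "S y m v \<noteq> S y m w" if "y \<in> ball l \<delta>" for y
      using S_inj[of y v w m] that \<delta>(3) vw False by (auto simp: annulus_def)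
    have B0: "B * \<rho> > 0" using \<delta>(2) \<rho> by simp
    show ?thesis
      using disjoint_holomorphic_distortion[OF h[OF vw(1)] h[OF vw(2)] b[OF vw(1)] b[OF vw(2)] ne B0 x] by blast
  qed simp
  have sub: "ball l (\<delta>/2) \<subseteq> \<Omega>" using \<delta>(1,3) subset_ball[of "\<delta>/2" \<delta> l] by auto
  have "(3 * (B * \<rho>))\<^sup>2 > 0" "\<delta> / 2 > 0" using \<delta> \<rho> by simp_all
  then show ?thesis using sub * by blast
qed

text \<open>Uniform continuity of \<open>S l' m \<circ> (S l m)\<inverse>\<close> on the image of an annulus at the unit circle.\<close>

definition dominated :: "linf \<Rightarrow> linf \<Rightarrow> nat \<Rightarrow> real \<Rightarrow> bool" where
  "dominated l l' m \<rho> \<longleftrightarrow> (\<forall>\<epsilon>>0. \<exists>\<eta>>0. \<forall>v\<in>annulus \<rho>. \<forall>w\<in>annulus \<rho>.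
     cmod (S l m v - S l m w) < \<eta> \<longrightarrow> cmod (S l' m v - S l' m w) < \<epsilon>)"

lemma dominated_trans: "dominated l l' m \<rho> \<Longrightarrow> dominated l' l'' m \<rho> \<Longrightarrow> dominated l l'' m \<rho>"
  unfolding dominated_def by meson

lemma dominatedI:
  assumes "c > 0" "\<And>v w. v \<in> annulus \<rho> \<Longrightarrow> w \<in> annulus \<rho> \<Longrightarrow>
     cmod (S l' m v - S l' m w) ^ 3 \<le> c * cmod (S l m v - S l m w)"
  shows "dominated l l' m \<rho>"
  unfolding dominated_def
proof (intro allI impI)
  fix \<epsilon> :: real assume \<epsilon>: "\<epsilon> > 0"
  have "cmod (S l' m v - S l' m w) < \<epsilon>"
    if "v \<in> annulus \<rho>" "w \<in> annulus \<rho>" "cmod (S l m v - S l m w) < \<epsilon> ^ 3 / c" for v w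
  proof -
    have "cmod (S l' m v - S l' m w) ^ 3 \<le> c * cmod (S l m v - S l m w)" by (rule assms(2)[OF that(1,2)])
    also have "\<dots> < c * (\<epsilon> ^ 3 / c)" using that(3) assms(1) by (rule mult_strict_left_mono)
    finally have "cmod (S l' m v - S l' m w) ^ 3 < \<epsilon> ^ 3" using assms(1) by simp
    then show ?thesis by (rule power_less_imp_less_base) (use \<epsilon> in simp)
  qed
  then show "\<exists>\<eta>>0. \<forall>v\<in>annulus \<rho>. \<forall>w\<in>annulus \<rho>.
      cmod (S l m v - S l m w) < \<eta> \<longrightarrow> cmod (S l' m v - S l' m w) < \<epsilon>"
    using \<epsilon> assms(1) by (intro exI[of _ "\<epsilon> ^ 3 / c"]) auto
qed

text \<open>Near each parameter, distances in the parameter-dependent annuli are comparable up to a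
  third power; continuation along the connected \<open>\<Omega>\<close> leaves uniform equivalence.\<close>

lemma dominated_all:
  assumes l: "l \<in> \<Omega>" and l': "l' \<in> \<Omega>" and \<rho>: "\<rho> > 1"
  shows "dominated l l' m \<rho>"
proof (rule connected_induction_simple[where P = "\<lambda>x. dominated l x m \<rho>", OF connected_\<Omega> l l'])
  show "dominated l l m \<rho>" unfolding dominated_def by blast
  fix a assume a: "a \<in> \<Omega>"
  obtain \<delta> c where \<delta>0: "\<delta> > 0" "c > 0" "ball a \<delta> \<subseteq> \<Omega>"
      "\<forall>x\<in>ball a \<delta>. \<forall>v\<in>annulus \<rho>. \<forall>w\<in>annulus \<rho>.
       cmod (S x m v - S x m w) ^ 3 \<le> c * cmod (S a m v - S a m w) \<and>
       cmod (S a m v - S a m w) ^ 3 \<le> c * cmod (S x m v - S x m w)"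
    using local_distortion[OF a \<rho>, of m] by blast
  note \<delta> = \<delta>0(1-3) \<delta>0(4)[rule_format]
  have 1: "dominated x a m \<rho>" "dominated a x m \<rho>" if "x \<in> ball a \<delta>" for x
    using \<delta>(4)[OF that] by (auto intro!: dominatedI[OF \<delta>(2)])
  have "\<forall>x\<in>ball a \<delta>. \<forall>y\<in>ball a \<delta>. dominated l x m \<rho> \<longrightarrow> dominated l y m \<rho>"
    using dominated_trans[OF dominated_trans[OF _ 1(1)] 1(2)] by simp
  moreover have "openin (top_of_set \<Omega>) (ball a \<delta>)" "a \<in> ball a \<delta>"
    using \<delta> open_\<Omega> by (simp_all add: openin_open_eq)
  ultimately show "\<exists>T. openin (top_of_set \<Omega>) T \<and> a \<in> T \<and>
      (\<forall>x\<in>T. \<forall>y\<in>T. dominated l x m \<rho> \<longrightarrow> dominated l y m \<rho>)" by blast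
qed

definition coord :: "nat \<Rightarrow> complex \<Rightarrow> complex" where
  "coord m z = the_inv_into {w. 1 < cmod w} (S l0 m) z"

lemma coord_S: "1 < cmod w \<Longrightarrow> coord m (S l0 m w) = w"
  unfolding coord_def using S_inj[OF l0] by (intro the_inv_into_f_f inj_onI) auto

lemma coord: "z \<in> escaping (P l0) m \<Longrightarrow> 1 < cmod (coord m z) \<and> S l0 m (coord m z) = z"
  using S_surj[OF l0] coord_S by force

text \<open>A radius such that the image of the annulus contains all points of the basin near the Julia
  set.\<close>

definition reach :: "nat \<Rightarrow> real" where
  "reach m = (SOME \<rho>. \<rho> > 1 \<and> (\<exists>r. (\<forall>x\<in>julia (P l0) m. cmod x < r) \<and>
     (\<forall>w. 1 < cmod w \<longrightarrow> cmod (S l0 m w) < r \<longrightarrow> w \<in> annulus \<rho>)))"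

lemma reach: "reach m > 1"
  "\<exists>r. (\<forall>x\<in>julia (P l0) m. cmod x < r) \<and>
     (\<forall>w. 1 < cmod w \<longrightarrow> cmod (S l0 m w) < r \<longrightarrow> w \<in> annulus (reach m))"
proof -
  obtain d K M where b: "bounded_poly_seq d K M (P l0)" using bounded_seq[OF l0] by blast
  let ?r = "escape_radius d K M"
  have "?r > 0" using escape_radius_ge[OF b] by linarith
  then have "\<forall>\<^sub>F w in at_infinity. ?r \<le> cmod (S l0 m w)"
    using S_inf[OF l0, of m] filterlim_at_infinity[of 0 "S l0 m" at_infinity] by blast
  then obtain \<beta> where \<beta>: "\<And>w. \<beta> \<le> cmod w \<Longrightarrow> ?r \<le> cmod (S l0 m w)"
    unfolding eventually_at_infinity by blast
  have "w \<in> annulus (max \<beta> 2)" if "1 < cmod w" "cmod (S l0 m w) < ?r" for w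
    using that \<beta>[of w] by (cases "\<beta> \<le> cmod w") (auto simp: annulus_def)
  then have "\<exists>\<rho>>1. \<exists>r. (\<forall>x\<in>julia (P l0) m. cmod x < r) \<and>
     (\<forall>w. 1 < cmod w \<longrightarrow> cmod (S l0 m w) < r \<longrightarrow> w \<in> annulus \<rho>)"
    using julia_bound[OF b] by (intro exI[of _ "max \<beta> 2"] conjI exI[of _ ?r]) auto
  from someI_ex[OF this, folded reach_def] show "reach m > 1"
    "\<exists>r. (\<forall>x\<in>julia (P l0) m. cmod x < r) \<and>
     (\<forall>w. 1 < cmod w \<longrightarrow> cmod (S l0 m w) < r \<longrightarrow> w \<in> annulus (reach m))"
    by (simp_all only:)
qed

abbreviation collar :: "nat \<Rightarrow> complex set" where
  "collar m \<equiv> S l0 m ` annulus (reach m)"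

lemma in_closure_collar: "w \<in> annulus (reach m) \<Longrightarrow> S l0 m w \<in> closure (collar m)"
  using closure_subset[of "collar m"] by blast

lemma extension_exists:
  assumes l: "l \<in> \<Omega>"
  shows "\<exists>h. continuous_on (closure (collar m)) h \<and> (\<forall>w\<in>annulus (reach m). h (S l0 m w) = S l m w)"
proof -
  have uc: "uniformly_continuous_on (collar m) (\<lambda>z. S l m (coord m z))"
    unfolding uniformly_continuous_on_def
  proof (intro allI impI)
    fix \<epsilon> :: real assume "\<epsilon> > 0"
    then obtain \<eta> where \<eta>: "\<eta> > 0" "\<forall>v\<in>annulus (reach m). \<forall>w\<in>annulus (reach m).
       cmod (S l0 m v - S l0 m w) < \<eta> \<longrightarrow> cmod (S l m v - S l m w) < \<epsilon>"
      using dominated_all[OF l0 l reach(1), of m m] unfolding dominated_def by blast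
    then show "\<exists>\<eta>>0. \<forall>x\<in>collar m. \<forall>x'\<in>collar m. dist x' x < \<eta> \<longrightarrow>
        dist (S l m (coord m x')) (S l m (coord m x)) < \<epsilon>"
      using coord_S by (intro exI[of _ \<eta>]) (auto simp: dist_norm annulus_def)
  qed
  show ?thesis
  proof (rule uniformly_continuous_on_extension_on_closure[OF uc])
    fix g assume g: "uniformly_continuous_on (closure (collar m)) g"
      "\<And>x. x \<in> collar m \<Longrightarrow> S l m (coord m x) = g x"
    have "g (S l0 m w) = S l m w" if "w \<in> annulus (reach m)" for w
      using g(2)[of "S l0 m w"] coord_S[of w m] that by (simp add: annulus_def)
    then show ?thesis using uniformly_continuous_imp_continuous[OF g(1)] by blast
  qed
qed

definition boundary_map :: "linf \<Rightarrow> nat \<Rightarrow> complex \<Rightarrow> complex" where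
  "boundary_map l m = (SOME h. continuous_on (closure (collar m)) h \<and>
     (\<forall>w\<in>annulus (reach m). h (S l0 m w) = S l m w))"

lemma boundary_map:
  assumes "l \<in> \<Omega>"
  shows "continuous_on (closure (collar m)) (boundary_map l m)"
    and "w \<in> annulus (reach m) \<Longrightarrow> boundary_map l m (S l0 m w) = S l m w"
  using someI_ex[OF extension_exists[OF assms, of m]] unfolding boundary_map_def by blast+

lemma eventually_ray_in_annulus:
  assumes "cmod e = 1" "\<rho> > 1"
  shows "\<forall>\<^sub>F R in at_right 1. of_real R * e \<in> annulus \<rho>"
proof -
  have "\<forall>\<^sub>F R in at_right 1. R \<in> {1<..<\<rho>}" using assms(2) by (rule eventually_at_right_real)
  then show ?thesis by eventually_elim (use assms(1) in \<open>auto simp: annulus_def norm_mult\<close>)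
qed

lemma julia_in_closure_collar: "x \<in> julia (P l0) m \<Longrightarrow> x \<in> closure (collar m)"
proof -
  assume "x \<in> julia (P l0) m"
  then obtain e where e: "cmod e = 1" "((\<lambda>R. S l0 m (of_real R * e)) \<longlongrightarrow> x) (at_right 1)"
    using julia_landing[OF l0] by blast
  have "\<forall>\<^sub>F R in at_right 1. S l0 m (of_real R * e) \<in> closure (collar m)"
    using eventually_ray_in_annulus[OF e(1) reach(1)]
    by eventually_elim (rule in_closure_collar)
  then show ?thesis by (rule Lim_in_closed_set[OF closed_closure _ _ e(2)]) simp
qed

lemma boundary_map_limit:
  assumes l: "l \<in> \<Omega>" and x: "x \<in> julia (P l0) m" and w: "\<forall>\<^sub>F k in F. w k \<in> annulus (reach m)"
    and lim: "((\<lambda>k. S l0 m (w k)) \<longlongrightarrow> x) F"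
  shows "((\<lambda>k. S l m (w k)) \<longlongrightarrow> boundary_map l m x) F"
proof -
  have "((\<lambda>k. boundary_map l m (S l0 m (w k))) \<longlongrightarrow> boundary_map l m x) F"
    by (rule continuous_on_tendsto_compose[OF boundary_map(1)[OF l] lim julia_in_closure_collar[OF x]])
      (use w in eventually_elim, rule in_closure_collar)
  then show ?thesis
    by (rule Lim_transform_eventually) (use w in eventually_elim, rule boundary_map(2)[OF l])
qed

lemma boundary_map_ray:
  assumes "l \<in> \<Omega>" and x: "x \<in> julia (P l0) m" and e: "cmod e = 1"
    and "((\<lambda>R. S l0 m (of_real R * e)) \<longlongrightarrow> x) (at_right 1)"
  shows "((\<lambda>R. S l m (of_real R * e)) \<longlongrightarrow> boundary_map l m x) (at_right 1)"
  by (rule boundary_map_limit[OF assms(1,2) eventually_ray_in_annulus[OF e reach(1)] assms(4)])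

lemma boundary_map_in_julia:
  assumes l: "l \<in> \<Omega>" and x: "x \<in> julia (P l0) m"
  shows "boundary_map l m x \<in> julia (P l) m"
proof -
  obtain e where e: "cmod e = 1" "((\<lambda>R. S l0 m (of_real R * e)) \<longlongrightarrow> x) (at_right 1)"
    using julia_landing[OF l0 x] by blast
  show ?thesis by (rule landing_in_julia[OF l e(1) boundary_map_ray[OF l x e]])
qed

lemma boundary_map_surj:
  assumes l: "l \<in> \<Omega>" and y: "y \<in> julia (P l) m"
  shows "\<exists>x\<in>julia (P l0) m. boundary_map l m x = y"
proof -
  obtain e where e: "cmod e = 1" "((\<lambda>R. S l m (of_real R * e)) \<longlongrightarrow> y) (at_right 1)"
    using julia_landing[OF l y] by blast
  obtain x where x: "x \<in> julia (P l0) m" "((\<lambda>R. S l0 m (of_real R * e)) \<longlongrightarrow> x) (at_right 1)"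
    using ray_lands[OF l0 e(1)] by blast
  show ?thesis
    using x(1) tendsto_unique[OF trivial_limit_at_right_real boundary_map_ray[OF l x(1) e(1) x(2)] e(2)] by blast
qed

text \<open>By uniform continuity in the opposite direction, rays that come together for \<open>l\<close> do so for
  \<open>l0\<close>.\<close>

lemma ray_limit_reflected:
  assumes l: "l \<in> \<Omega>" and x: "x \<in> julia (P l0) m" and e: "cmod e = 1"
    and lim: "((\<lambda>R. S l m (of_real R * e)) \<longlongrightarrow> boundary_map l m x) (at_right 1)"
  shows "((\<lambda>R. S l0 m (of_real R * e)) \<longlongrightarrow> x) (at_right 1)"
proof -
  obtain f where f: "cmod f = 1" "((\<lambda>R. S l0 m (of_real R * f)) \<longlongrightarrow> x) (at_right 1)"
    using julia_landing[OF l0 x] by blast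
  have "((\<lambda>R. S l m (of_real R * e) - S l m (of_real R * f)) \<longlongrightarrow>
      boundary_map l m x - boundary_map l m x) (at_right 1)"
    by (intro tendsto_diff lim boundary_map_ray[OF l x f])
  then have z: "((\<lambda>R. S l m (of_real R * e) - S l m (of_real R * f)) \<longlongrightarrow> 0) (at_right 1)" by simp
  have "((\<lambda>R. S l0 m (of_real R * e) - S l0 m (of_real R * f)) \<longlongrightarrow> 0) (at_right 1)"
  proof (rule tendstoI)
    have two: "(1::real) < 2" by simp
    fix \<epsilon> :: real assume "\<epsilon> > 0"
    then obtain \<eta> where \<eta>: "\<eta> > 0" "\<forall>v\<in>annulus 2. \<forall>w\<in>annulus 2.
       cmod (S l m v - S l m w) < \<eta> \<longrightarrow> cmod (S l0 m v - S l0 m w) < \<epsilon>"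
      using dominated_all[OF l l0, of 2 m] unfolding dominated_def by auto
    have "\<forall>\<^sub>F R in at_right 1. cmod (S l m (of_real R * e) - S l m (of_real R * f)) < \<eta>"
      using tendstoD[OF z \<eta>(1)] by (simp add: dist_norm)
    then show "\<forall>\<^sub>F R in at_right 1. dist (S l0 m (of_real R * e) - S l0 m (of_real R * f)) 0 < \<epsilon>"
      using eventually_ray_in_annulus[OF e two] eventually_ray_in_annulus[OF f(1) two]
      by eventually_elim (use \<eta>(2) in auto)
  qed
  from tendsto_add[OF this f(2)] show ?thesis by simp
qed

lemma boundary_map_inj:
  assumes l: "l \<in> \<Omega>" and x: "x \<in> julia (P l0) m" and y: "y \<in> julia (P l0) m"
    and eq: "boundary_map l m x = boundary_map l m y"
  shows "x = y"
proof -
  obtain e where e: "cmod e = 1" "((\<lambda>R. S l0 m (of_real R * e)) \<longlongrightarrow> x) (at_right 1)"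
    using julia_landing[OF l0 x] by blast
  have "((\<lambda>R. S l m (of_real R * e)) \<longlongrightarrow> boundary_map l m y) (at_right 1)"
    using boundary_map_ray[OF l x e] eq by simp
  then show ?thesis
    using tendsto_unique[OF trivial_limit_at_right_real e(2) ray_limit_reflected[OF l y e(1)]] by blast
qed

text \<open>The boundary map is the limit of the motion along a ray, and the distortion estimate makes the
  convergence locally uniform in the parameter.\<close>

lemma boundary_map_holomorphic:
  assumes x: "x \<in> julia (P l0) m"
  shows "frechet_holomorphic_on (\<lambda>l. boundary_map l m x) \<Omega>"
proof -
  obtain e where e: "cmod e = 1" "((\<lambda>R. S l0 m (of_real R * e)) \<longlongrightarrow> x) (at_right 1)"
    using julia_landing[OF l0 x] by blast
  define R where "R k = 1 + 1 / real (Suc k)" for k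
  define w where "w k = of_real (R k) * e" for k
  have R: "filterlim R (at_right 1) sequentially"
    unfolding filterlim_at
  proof (intro conjI)
    have "(\<lambda>k. 1 + 1 / real (Suc k)) \<longlonglongrightarrow> 1 + 0" by (intro tendsto_intros LIMSEQ_Suc lim_1_over_n)
    then show "R \<longlonglongrightarrow> 1" by (simp add: R_def[abs_def])
  qed (simp add: R_def)
  have lim: "(\<lambda>k. S l m (w k)) \<longlonglongrightarrow> boundary_map l m x" if "l \<in> \<Omega>" for l
    unfolding w_def using filterlim_compose[OF boundary_map_ray[OF that x e] R] .
  have "cmod (w k) = R k" for k
    by (simp only: w_def norm_mult norm_of_real e(1)) (simp add: R_def)
  then have w2: "w k \<in> annulus 2" for k by (simp add: R_def annulus_def)
  show ?thesis
  proof (rule frechet_holomorphic_uniform_limit)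
    show "frechet_holomorphic_on (\<lambda>l. S l m (w k)) \<Omega>" for k
      by (rule S_holomorphic) (use w2[of k] in \<open>simp add: annulus_def\<close>)
    fix l assume l: "l \<in> \<Omega>"
    have two: "(1::real) < 2" by simp
    obtain \<delta> c where \<delta>0: "\<delta> > 0" "c > 0" "ball l \<delta> \<subseteq> \<Omega>"
      "\<forall>x\<in>ball l \<delta>. \<forall>v\<in>annulus 2. \<forall>w\<in>annulus 2.
       cmod (S x m v - S x m w) ^ 3 \<le> c * cmod (S l m v - S l m w) \<and>
       cmod (S l m v - S l m w) ^ 3 \<le> c * cmod (S x m v - S x m w)"
      using local_distortion[OF l two, of m] by blast
    note \<delta> = \<delta>0(1-3) \<delta>0(4)[rule_format]
    have est: "cmod (S y m (w k) - boundary_map y m x) ^ 3 \<le> c * cmod (S l m (w k) - boundary_map l m x)"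
      if y: "y \<in> ball l \<delta>" for y k
    proof (rule LIMSEQ_le)
      have y\<Omega>: "y \<in> \<Omega>" using y \<delta>(3) by blast
      show "(\<lambda>j. cmod (S y m (w k) - S y m (w j)) ^ 3) \<longlonglongrightarrow> cmod (S y m (w k) - boundary_map y m x) ^ 3"
        by (intro tendsto_intros lim y\<Omega>)
      show "(\<lambda>j. c * cmod (S l m (w k) - S l m (w j))) \<longlonglongrightarrow> c * cmod (S l m (w k) - boundary_map l m x)"
        by (intro tendsto_intros lim l)
      show "\<exists>N. \<forall>j\<ge>N. cmod (S y m (w k) - S y m (w j)) ^ 3 \<le> c * cmod (S l m (w k) - S l m (w j))"
        using \<delta>(4)[OF y w2 w2] by blast
    qed
    have "uniform_limit (ball l \<delta>) (\<lambda>k y. S y m (w k)) (\<lambda>y. boundary_map y m x) sequentially"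
    proof (rule uniform_limitI)
      fix \<epsilon> :: real assume \<epsilon>: "\<epsilon> > 0"
      have "(\<lambda>k. c * cmod (S l m (w k) - boundary_map l m x)) \<longlonglongrightarrow> c * cmod (boundary_map l m x - boundary_map l m x)"
        by (intro tendsto_intros lim l)
      then have "\<forall>\<^sub>F k in sequentially. c * cmod (S l m (w k) - boundary_map l m x) < \<epsilon> ^ 3"
        by (rule order_tendstoD(2)) (use \<epsilon> in simp)
      then show "\<forall>\<^sub>F k in sequentially. \<forall>y\<in>ball l \<delta>. dist (S y m (w k)) (boundary_map y m x) < \<epsilon>"
      proof eventually_elim
        case (elim k)
        show ?case
        proof
          fix y assume "y \<in> ball l \<delta>"
          then have "cmod (S y m (w k) - boundary_map y m x) ^ 3 < \<epsilon> ^ 3" by (intro le_less_trans[OF est elim])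
          then have "cmod (S y m (w k) - boundary_map y m x) < \<epsilon>"
            by (rule power_less_imp_less_base) (use \<epsilon> in simp)
          then show "dist (S y m (w k)) (boundary_map y m x) < \<epsilon>" by (simp add: dist_norm)
        qed
      qed
    qed
    then show "\<exists>\<delta>>0. ball l \<delta> \<subseteq> \<Omega> \<and>
       uniform_limit (ball l \<delta>) (\<lambda>k y. S y m (w k)) (\<lambda>y. boundary_map y m x) sequentially"
      using \<delta>(1,3) by blast
  qed
qed

lemma boundary_map_conjugates:
  assumes l: "l \<in> \<Omega>" and x: "x \<in> julia (P l0) m"
  shows "boundary_map l (Suc m) (poly (P l0 (Suc m)) x) = poly (P l (Suc m)) (boundary_map l m x)"
proof -
  let ?D = "degree (P l0 (Suc m))"
  obtain e where e: "cmod e = 1" "((\<lambda>R. S l0 m (of_real R * e)) \<longlongrightarrow> x) (at_right 1)"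
    using julia_landing[OF l0 x] by blast
  have ev: "\<forall>\<^sub>F R in at_right 1. 1 < cmod (of_real R * e)"
    using eventually_ray_in_annulus[OF e(1), of 2] by simp (elim eventually_mono, simp add: annulus_def)
  have push: "((\<lambda>R. S k (Suc m) ((of_real R * e) ^ ?D)) \<longlongrightarrow> poly (P k (Suc m)) y) (at_right 1)"
    if k: "k \<in> \<Omega>" and "((\<lambda>R. S k m (of_real R * e)) \<longlongrightarrow> y) (at_right 1)" for k y
  proof -
    have "((\<lambda>R. poly (P k (Suc m)) (S k m (of_real R * e))) \<longlongrightarrow> poly (P k (Suc m)) y) (at_right 1)"
      by (intro tendsto_intros that)
    then show ?thesis
      by (rule Lim_transform_eventually) (use ev in eventually_elim, simp add: S_eq[OF k])
  qed
  have "poly (P l0 (Suc m)) x \<in> julia (P l0) (Suc m)"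
    using julia_forward[OF l0, of m "Suc m" x] x by (simp add: Q_step)
  moreover have "\<forall>\<^sub>F R in at_right 1. (of_real R * e) ^ ?D \<in> annulus (reach (Suc m))"
  proof -
    have "((\<lambda>R::real. cmod ((of_real R * e) ^ ?D)) \<longlongrightarrow> cmod ((of_real 1 * e) ^ ?D)) (at_right 1)"
      by (intro tendsto_intros)
    then have lt: "\<forall>\<^sub>F R in at_right 1. cmod ((of_real R * e) ^ ?D) < reach (Suc m)"
      by (rule order_tendstoD(2)) (use e reach(1) in \<open>simp add: norm_power\<close>)
    have D0: "?D > 0"
    proof -
      obtain d K M where "bounded_poly_seq d K M (P l0)" using bounded_seq[OF l0] by blast
      then show ?thesis using bounded_poly_seq_degree[of d K M "P l0" "Suc m"] by auto
    qed
    show ?thesis using lt ev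
      by eventually_elim (use D0 in \<open>auto simp: annulus_def norm_power intro: one_less_power\<close>)
  qed
  ultimately have "((\<lambda>R. S l (Suc m) ((of_real R * e) ^ ?D)) \<longlongrightarrow>
      boundary_map l (Suc m) (poly (P l0 (Suc m)) x)) (at_right 1)"
    by (rule boundary_map_limit[OF l _ _ push[OF l0 e(2)]])
  then show ?thesis
    by (rule tendsto_unique[OF trivial_limit_at_right_real _ push[OF l boundary_map_ray[OF l x e]]])
qed

definition motion :: "linf \<Rightarrow> nat \<Rightarrow> complex \<Rightarrow> complex" where
  "motion l m z = (if z \<in> escaping (P l0) m then S l m (coord m z) else boundary_map l m z)"

abbreviation carrier_set :: "linf \<Rightarrow> nat \<Rightarrow> complex set" where
  "carrier_set l m \<equiv> escaping (P l) m \<union> julia (P l) m"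

lemma motion_S: "l \<in> \<Omega> \<Longrightarrow> 1 < cmod w \<Longrightarrow> motion l m (S l0 m w) = S l m w"
  by (simp add: motion_def S_in[OF l0] coord_S)

lemma motion_julia: "x \<in> julia (P l0) m \<Longrightarrow> motion l m x = boundary_map l m x"
  using julia_not_escaping[OF l0] by (simp add: motion_def)

lemma motion_escaping: "l \<in> \<Omega> \<Longrightarrow> z \<in> escaping (P l0) m \<Longrightarrow> motion l m z \<in> escaping (P l) m"
  using coord S_in by (simp add: motion_def)

lemma motion_image_julia: "l \<in> \<Omega> \<Longrightarrow> motion l m ` julia (P l0) m = julia (P l) m"
  using boundary_map_in_julia boundary_map_surj motion_julia by (fastforce simp: image_iff)

lemma motion_image_escaping: "l \<in> \<Omega> \<Longrightarrow> motion l m ` escaping (P l0) m = escaping (P l) m"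
proof (intro equalityI subsetI)
  fix y assume l: "l \<in> \<Omega>" and "y \<in> escaping (P l) m"
  then obtain w where w: "1 < cmod w" "y = S l m w" using S_surj by blast
  then show "y \<in> motion l m ` escaping (P l0) m"
    using motion_S[OF l w(1), of m] S_in[OF l0 w(1), of m] by (metis imageI)
qed (use motion_escaping in auto)

lemma motion_inj: "l \<in> \<Omega> \<Longrightarrow> inj_on (motion l m) (carrier_set l0 m)"
proof (rule inj_onI)
  fix x y assume l: "l \<in> \<Omega>" and x: "x \<in> carrier_set l0 m" and y: "y \<in> carrier_set l0 m"
    and eq: "motion l m x = motion l m y"
  have esc: "z \<in> escaping (P l0) m \<longleftrightarrow> motion l m z \<in> escaping (P l) m" if "z \<in> carrier_set l0 m" for z
    using that motion_escaping[OF l] motion_julia boundary_map_in_julia[OF l] julia_not_escaping[OF l] by auto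
  show "x = y"
  proof (cases "x \<in> escaping (P l0) m")
    case True
    then have "y \<in> escaping (P l0) m" using esc[OF x] esc[OF y] True eq by simp
    then have "S l m (coord m x) = S l m (coord m y)" using True eq by (simp add: motion_def)
    then have "coord m x = coord m y" using S_inj[OF l] coord True \<open>y \<in> escaping (P l0) m\<close> by blast
    then show ?thesis using coord True \<open>y \<in> escaping (P l0) m\<close> by metis
  next
    case False
    then have "x \<in> julia (P l0) m" "y \<in> julia (P l0) m" using esc[OF x] esc[OF y] x y eq by auto
    then show ?thesis using boundary_map_inj[OF l] eq motion_julia by simp
  qed
qed

lemma motion_holomorphic:
  assumes "x \<in> carrier_set l0 m"
  shows "frechet_holomorphic_on (\<lambda>l. motion l m x) \<Omega>"
proof (cases "x \<in> escaping (P l0) m")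
  case True
  then show ?thesis using S_holomorphic coord by (simp add: motion_def)
next
  case False
  then show ?thesis using boundary_map_holomorphic assms by (simp add: motion_def)
qed

lemma motion_l0: "x \<in> carrier_set l0 m \<Longrightarrow> motion l0 m x = x"
proof (cases "x \<in> escaping (P l0) m")
  case True
  then show ?thesis by (simp add: motion_def coord)
next
  case False
  assume "x \<in> carrier_set l0 m"
  then have x: "x \<in> julia (P l0) m" using False by blast
  obtain e where e: "cmod e = 1" "((\<lambda>R. S l0 m (of_real R * e)) \<longlongrightarrow> x) (at_right 1)"
    using julia_landing[OF l0 x] by blast
  show ?thesis
    using tendsto_unique[OF trivial_limit_at_right_real boundary_map_ray[OF l0 x e] e(2)] motion_julia[OF x] by simp
qed

lemma coord_continuous: "continuous_on (escaping (P l0) m) (coord m)"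
proof -
  have inj: "inj_on (S l0 m) {w. 1 < cmod w}" using S_inj[OF l0] by (auto intro: inj_onI)
  have op: "open {w::complex. 1 < cmod w}" by (intro open_Collect_less continuous_intros)
  obtain g where g: "g holomorphic_on S l0 m ` {w. 1 < cmod w}" "\<And>w. w \<in> {w. 1 < cmod w} \<Longrightarrow> g (S l0 m w) = w"
    using holomorphic_has_inverse[OF S_hol[OF l0] op inj] by metis
  have im: "S l0 m ` {w. 1 < cmod w} = escaping (P l0) m" using S_in[OF l0] S_surj[OF l0] by blast
  have "continuous_on (escaping (P l0) m) g" using holomorphic_on_imp_continuous_on[OF g(1)] im by simp
  then show ?thesis
  proof (rule continuous_on_eq)
    fix z assume "z \<in> escaping (P l0) m"
    then show "g z = coord m z" using g(2)[of "coord m z"] coord[of z m] by simp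
  qed
qed

text \<open>Near a Julia point the motion coincides with the continuous extension from the collar, and on
  the open basin it is a composition of continuous maps.\<close>

lemma motion_continuous:
  assumes l: "l \<in> \<Omega>"
  shows "continuous_on (carrier_set l0 m) (motion l m)"
proof -
  let ?A = "escaping (P l0) m" and ?J = "julia (P l0) m"
  obtain r where r: "\<forall>x\<in>?J. cmod x < r"
     "\<forall>w. 1 < cmod w \<longrightarrow> cmod (S l0 m w) < r \<longrightarrow> w \<in> annulus (reach m)" using reach(2) by blast
  have cA: "continuous_on ?A (motion l m)"
  proof (rule continuous_on_eq)
    show "continuous_on ?A (\<lambda>z. S l m (coord m z))"
      by (rule continuous_on_compose2[OF holomorphic_on_imp_continuous_on[OF S_hol[OF l]] coord_continuous])
        (use coord in auto)
  qed (simp add: motion_def)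
  have near: "z \<in> closure (collar m) \<and> motion l m z = boundary_map l m z"
    if z: "z \<in> (?A \<union> ?J) \<inter> ball 0 r" for z
  proof (cases "z \<in> ?A")
    case True
    then have c: "coord m z \<in> annulus (reach m)" using r(2) coord[OF True] z by simp
    show ?thesis
      using in_closure_collar[OF c] boundary_map(2)[OF l c] coord[OF True] True by (simp add: motion_def)
  next
    case False
    then show ?thesis using z julia_in_closure_collar motion_julia by blast
  qed
  have cN: "continuous_on ((?A \<union> ?J) \<inter> ball 0 r) (motion l m)"
    by (rule continuous_on_eq[OF continuous_on_subset[OF boundary_map(1)[OF l]]])
      (use near in auto)
  show ?thesis
    unfolding continuous_on_eq_continuous_within
  proof
    fix x assume x: "x \<in> ?A \<union> ?J"
    show "continuous (at x within ?A \<union> ?J) (motion l m)"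
    proof (cases "x \<in> ?A")
      case True
      then have "isCont (motion l m) x"
        using cA continuous_on_eq_continuous_at[OF open_esc[OF l0]] by blast
      then show ?thesis by (rule continuous_at_imp_continuous_at_within)
    next
      case False
      then have xr: "x \<in> ball 0 r" using x r(1) by simp
      have "at x within ?A \<union> ?J = at x within (?A \<union> ?J) \<inter> ball 0 r"
        by (rule at_within_nhd[OF xr open_ball]) blast
      then show ?thesis using cN x xr unfolding continuous_on_eq_continuous_within by simp
    qed
  qed
qed

lemma motion_at_infinity:
  assumes l: "l \<in> \<Omega>"
  shows "\<exists>r. \<forall>z. r < cmod z \<longrightarrow> R < cmod (motion l m z)"
proof -
  obtain d K M where b: "bounded_poly_seq d K M (P l0)" using bounded_seq[OF l0] by blast
  obtain B where B: "B > 0" "\<forall>w. 1 < cmod w \<longrightarrow> cmod (S l0 m w) \<le> B * cmod w" using S_bound[OF l0] by blast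
  have "\<bar>R\<bar> + 1 > 0" by simp
  then have "\<forall>\<^sub>F w in at_infinity. \<bar>R\<bar> + 1 \<le> cmod (S l m w)"
    using S_inf[OF l, of m] filterlim_at_infinity[of 0 "S l m" at_infinity] by blast
  then obtain \<beta> where \<beta>: "\<And>w. \<beta> \<le> cmod w \<Longrightarrow> \<bar>R\<bar> + 1 \<le> cmod (S l m w)"
    unfolding eventually_at_infinity by blast
  have "R < cmod (motion l m z)" if z: "max (escape_radius d K M) (B * \<beta>) < cmod z" for z
  proof -
    have zA: "z \<in> escaping (P l0) m" by (rule outside_escape_radius[OF b]) (use z in simp)
    have "B * \<beta> < B * cmod (coord m z)" using B(2) coord[OF zA] z by force
    then have "\<beta> \<le> cmod (coord m z)" using B(1) by simp
    then show ?thesis using \<beta>[of "coord m z"] zA by (simp add: motion_def)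
  qed
  then show ?thesis by blast
qed

lemma three_julia_points:
  "\<exists>x\<in>julia (P l0) m. \<exists>y\<in>julia (P l0) m. \<exists>z\<in>julia (P l0) m. x \<noteq> y \<and> y \<noteq> z \<and> x \<noteq> z"
proof -
  obtain d K M B C \<mu> where "hyperbolic_boettcher_sequence (P l0) d K M B (S l0) C \<mu>"
    using hyperbolic_boettcher[OF l0] .
  then interpret h: hyperbolic_boettcher_sequence "P l0" d K M B "S l0" C \<mu> .
  have pos: "0 < C * \<mu> ^ 2" using h.C h.\<mu> by simp
  show ?thesis
  proof (rule julia_three_points[OF h.bounded julia_nonempty[OF l0]])
    fix z assume "z \<in> julia (P l0) m"
    then have "C * \<mu> ^ 2 \<le> cmod (deriv (Q (P l0) m (m + 2)) z)" by (rule h.expanding)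
    then show "deriv (Q (P l0) m (m + 2)) z \<noteq> 0" using pos by auto
  qed
qed

end

section \<open>Uniqueness of conjugating motions of the Julia sets\<close>

text \<open>The polynomial \<open>(p y - p z) / (y - z)\<close> in two variables.\<close>

definition difference_quotient :: "complex poly \<Rightarrow> complex \<Rightarrow> complex \<Rightarrow> complex" where
  "difference_quotient p y z = (\<Sum>j\<le>degree p. coeff p j * (\<Sum>i<j. z ^ (j - Suc i) * y ^ i))"

lemma poly_diff_eq: "poly p y - poly p z = (y - z) * difference_quotient p y z"
proof -
  have "poly p y - poly p z = (\<Sum>j\<le>degree p. coeff p j * (y ^ j - z ^ j))"
    unfolding poly_altdef by (simp add: sum_subtractf algebra_simps)
  also have "\<dots> = (\<Sum>j\<le>degree p. (y - z) * (coeff p j * (\<Sum>i<j. z ^ (j - Suc i) * y ^ i)))"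
    by (rule sum.cong) (simp_all add: power_diff_sumr2 mult_ac)
  finally show ?thesis by (simp add: difference_quotient_def sum_distrib_left)
qed

lemma difference_quotient_diagonal: "difference_quotient p x x = poly (pderiv p) x"
proof (rule DERIV_unique)
  have "((\<lambda>y. \<Sum>j\<le>degree p. coeff p j * y ^ j) has_field_derivative
      (\<Sum>j\<le>degree p. coeff p j * (of_nat j * x ^ (j - Suc 0)))) (at x)"
    by (auto intro!: derivative_eq_intros sum.cong)
  moreover have "(\<Sum>i<j. x ^ (j - Suc i) * x ^ i) = of_nat j * x ^ (j - Suc 0)" for j
  proof -
    have "(\<Sum>i<j. x ^ (j - Suc i) * x ^ i) = (\<Sum>i<j. x ^ (j - Suc 0))"
      by (rule sum.cong) (auto simp: power_add[symmetric])
    then show ?thesis by simp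
  qed
  ultimately show "(poly p has_field_derivative difference_quotient p x x) (at x)"
    by (simp add: difference_quotient_def poly_altdef[abs_def])
qed (rule poly_DERIV)

text \<open>Cauchy's inequality for the coefficient of order \<open>k\<close>: the quotient has a removable
  singularity, and the maximum principle holds for the unit disc.\<close>

lemma bounded_quotient_limit:
  assumes g: "g holomorphic_on ball 0 s" and s: "s > 1"
    and b: "\<And>t. t \<in> ball 0 s \<Longrightarrow> cmod (g t) \<le> B"
    and lim: "((\<lambda>t. g t / t ^ k) \<longlongrightarrow> L) (at 0)"
  shows "cmod L \<le> B"
proof -
  define q where "q = (\<lambda>t. if t = 0 then L else g t / t ^ k)"
  have holq: "q holomorphic_on ball 0 s"
  proof (rule no_isolated_singularity[where K = "{0}"])
    show hol: "q holomorphic_on ball 0 s - {0}"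
    proof (rule holomorphic_transform)
      show "(\<lambda>t. g t / t ^ k) holomorphic_on ball 0 s - {0}"
        by (intro holomorphic_intros holomorphic_on_subset[OF g]) auto
    qed (simp add: q_def)
    show "continuous_on (ball 0 s) q"
      unfolding continuous_on_eq_continuous_at[OF open_ball]
    proof
      fix t :: complex assume t: "t \<in> ball 0 s"
      show "isCont q t"
      proof (cases "t = 0")
        case True
        have "(q \<longlongrightarrow> L) (at 0)"
          by (rule Lim_transform_eventually[OF lim]) (simp add: eventually_at_filter q_def)
        then show ?thesis using True by (simp add: isCont_def q_def)
      next
        case False
        have "open (ball 0 s - {0::complex})" by (intro open_Diff) auto
        then show ?thesis
          using t False holomorphic_on_imp_continuous_on[OF hol] continuous_on_eq_continuous_at by blast
      qed
    qed
  qed auto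
  have "cmod (q 0) \<le> B"
  proof (rule maximum_modulus_frontier[where S = "ball 0 1" and f = q and \<xi> = 0])
    show "q holomorphic_on interior (ball 0 1)"
      by (rule holomorphic_on_subset[OF holq]) (use s in auto)
    have "cball 0 1 \<subseteq> ball (0::complex) s" using s by auto
    then show "continuous_on (closure (ball 0 1)) q"
      using holomorphic_on_imp_continuous_on[OF holomorphic_on_subset[OF holq]] by simp
    fix t :: complex assume "t \<in> frontier (ball 0 1)"
    then have t: "cmod t = 1" by simp
    then have "t \<noteq> 0" by auto
    then show "cmod (q t) \<le> B" using b[of t] t s by (simp add: q_def norm_divide norm_power)
  qed auto
  then show ?thesis by (simp add: q_def)
qed

text \<open>On a complex line through \<open>l0\<close> let the difference of two orbits at time \<open>m\<close> vanish at \<open>l0\<close> to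
  order \<open>k\<close>, with leading coefficient \<open>a\<close>. By the recursion, the difference at time \<open>n\<close> has the
  leading coefficient \<open>a\<close> times the derivative of \<open>Q m n\<close> at \<open>x\<close>. Expansion makes it unbounded
  in \<open>n\<close>, but Cauchy's inequality bounds it, as all orbits are bounded.\<close>

lemma bounded_orbits_unique:
  fixes y z :: "linf \<Rightarrow> nat \<Rightarrow> complex"
  assumes hol: "\<And>n. n \<ge> m \<Longrightarrow> frechet_holomorphic_on (\<lambda>l. y l n) (ball l0 \<delta>)"
      "\<And>n. n \<ge> m \<Longrightarrow> frechet_holomorphic_on (\<lambda>l. z l n) (ball l0 \<delta>)"
    and bd: "\<And>l n. l \<in> ball l0 \<delta> \<Longrightarrow> n \<ge> m \<Longrightarrow> cmod (y l n) \<le> R"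
      "\<And>l n. l \<in> ball l0 \<delta> \<Longrightarrow> n \<ge> m \<Longrightarrow> cmod (z l n) \<le> R"
    and rec: "\<And>l n. l \<in> ball l0 \<delta> \<Longrightarrow> n \<ge> m \<Longrightarrow> y l (Suc n) = poly (P l (Suc n)) (y l n)"
      "\<And>l n. l \<in> ball l0 \<delta> \<Longrightarrow> n \<ge> m \<Longrightarrow> z l (Suc n) = poly (P l (Suc n)) (z l n)"
    and init: "y l0 m = x" "z l0 m = x"
    and co: "\<And>n j. frechet_holomorphic_on (\<lambda>l. coeff (P l (Suc n)) j) (ball l0 \<delta>)"
    and deg: "\<And>l n. l \<in> ball l0 \<delta> \<Longrightarrow> degree (P l (Suc n)) = degree (P l0 (Suc n))"
    and exp: "C > 0" "\<mu> > 1" "\<And>i. C * \<mu> ^ i \<le> cmod (deriv (Q (P l0) m (m + i)) x)"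
    and l: "l \<in> ball l0 \<delta>"
  shows "y l m = z l m"
proof (rule ccontr)
  assume ne: "y l m \<noteq> z l m"
  define v where "v = l - l0"
  have v0: "v \<noteq> 0" using ne init by (auto simp: v_def)
  define s where "s = \<delta> / norm v"
  have nv: "norm v < \<delta>" using l by (simp add: v_def dist_norm norm_minus_commute)
  then have s: "s > 1" using v0 by (simp add: s_def)
  have line: "l0 + cscale t v \<in> ball l0 \<delta>" if "t \<in> ball 0 s" for t
  proof -
    have "norm (cscale t v) \<le> norm t * norm v" by (rule norm_cscale_le)
    also have "\<dots> < s * norm v" using that v0 by (intro mult_strict_right_mono) auto
    also have "\<dots> = \<delta>" using v0 by (simp add: s_def)
    finally show ?thesis by (simp add: dist_norm)
  qed
  define Y where "Y n t = y (l0 + cscale t v) n" for n t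
  define Z where "Z n t = z (l0 + cscale t v) n" for n t
  have holY: "Y n holomorphic_on ball 0 s" and holZ: "Z n holomorphic_on ball 0 s" if "n \<ge> m" for n
    unfolding Y_def[abs_def] Z_def[abs_def]
    using hol(1)[OF that] hol(2)[OF that] line unfolding frechet_holomorphic_on_def
    by (auto intro!: cfrechet_differentiable_along_line)
  define g where "g n t = Y n t - Z n t" for n t
  have holg: "g n holomorphic_on ball 0 s" if "n \<ge> m" for n
    unfolding g_def[abs_def] by (intro holomorphic_intros holY[OF that] holZ[OF that])
  have s0: "(0::complex) \<in> ball 0 s" "(1::complex) \<in> ball 0 s" using s by auto
  have gm0: "g m 0 = 0" using init by (simp add: g_def Y_def Z_def)
  have nc: "\<not> g m constant_on ball 0 s"
  proof
    assume "g m constant_on ball 0 s"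
    then have "g m 1 = g m 0" using s0 unfolding constant_on_def by metis
    moreover have "g m 1 = y l m - z l m" by (simp add: g_def Y_def Z_def v_def)
    ultimately show False using ne gm0 by simp
  qed
  obtain G r k where G: "0 < k" "0 < r" "ball 0 r \<subseteq> ball (0::complex) s" "G holomorphic_on ball 0 r"
      "\<forall>t\<in>ball 0 r. g m t = (t - 0) ^ k * G t \<and> G t \<noteq> 0"
  proof (rule holomorphic_factor_zero_nonconstant[OF holg[OF order_refl] open_ball connected_ball s0(1) gm0 nc])
    fix G r and k :: nat
    assume h: "0 < k" "0 < r" "ball 0 r \<subseteq> ball (0::complex) s" "G holomorphic_on ball 0 r"
      and h': "\<And>t. t \<in> ball 0 r \<Longrightarrow> g m t = (t - 0) ^ k * G t" "\<And>t. t \<in> ball 0 r \<Longrightarrow> G t \<noteq> 0"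
    show thesis by (rule that[OF h]) (use h' in blast)
  qed
  have orb: "y l0 n = Q (P l0) m n x" "z l0 n = Q (P l0) m n x" if "n \<ge> m" for n
  proof -
    have c: "l0 \<in> ball l0 \<delta>" using le_less_trans[OF norm_ge_zero nv] by simp
    show "y l0 n = Q (P l0) m n x"
      using that by (induction n rule: dec_induct) (simp_all add: init rec[OF c] Q_Suc)
    show "z l0 n = Q (P l0) m n x"
      using that by (induction n rule: dec_induct) (simp_all add: init rec[OF c] Q_Suc)
  qed
  have lim: "((\<lambda>t. g n t / t ^ k) \<longlongrightarrow> deriv (Q (P l0) m n) x * G 0) (at 0)" if "n \<ge> m" for n
    using that
  proof (induction n rule: dec_induct)
    case base
    have "isCont G 0"
      using holomorphic_on_imp_continuous_on[OF G(4)] G(2) continuous_on_eq_continuous_at[OF open_ball]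
      by (metis centre_in_ball)
    then have "(G \<longlongrightarrow> G 0) (at 0)" by (simp add: isCont_def)
    moreover have "\<forall>\<^sub>F t in at 0. G t = g m t / t ^ k"
      using eventually_at_ball'[OF G(2), of 0 UNIV]
      by (rule eventually_mono) (use G(5) in auto)
    ultimately show ?case by (simp add: deriv_Q_same Lim_transform_eventually)
  next
    case (step n)
    let ?p = "\<lambda>t. P (l0 + cscale t v) (Suc n)"
    let ?x = "Q (P l0) m n x"
    have tY: "(Y n \<longlongrightarrow> ?x) (at 0)" and tZ: "(Z n \<longlongrightarrow> ?x) (at 0)"
    proof -
      have "isCont (Y n) 0" "isCont (Z n) 0"
        using holomorphic_on_imp_continuous_on[OF holY] holomorphic_on_imp_continuous_on[OF holZ]
          continuous_on_eq_continuous_at[OF open_ball] s0(1) step(1) by blast+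
      then show "(Y n \<longlongrightarrow> ?x) (at 0)" "(Z n \<longlongrightarrow> ?x) (at 0)"
        using orb[OF step(1)] by (simp_all add: isCont_def Y_def Z_def)
    qed
    have tc: "((\<lambda>t. coeff (?p t) j) \<longlongrightarrow> coeff (P l0 (Suc n)) j) (at 0)" for j
    proof -
      have "(\<lambda>t. coeff (?p t) j) holomorphic_on ball 0 s"
        by (rule cfrechet_differentiable_along_line)
          (use co[of n j] line in \<open>auto simp: frechet_holomorphic_on_def\<close>)
      then have "isCont (\<lambda>t. coeff (?p t) j) 0"
        using holomorphic_on_imp_continuous_on continuous_on_eq_continuous_at[OF open_ball] s0(1) by blast
      then show ?thesis by (simp add: isCont_def)
    qed
    let ?q = "P l0 (Suc n)"
    have "((\<lambda>t. \<Sum>j\<le>degree ?q. coeff (?p t) j * (\<Sum>i<j. Z n t ^ (j - Suc i) * Y n t ^ i)) \<longlongrightarrow>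
        difference_quotient ?q ?x ?x) (at 0)"
      unfolding difference_quotient_def by (intro tendsto_intros tc tY tZ)
    then have "((\<lambda>t. g n t / t ^ k * (\<Sum>j\<le>degree ?q. coeff (?p t) j * (\<Sum>i<j. Z n t ^ (j - Suc i) * Y n t ^ i)))
        \<longlongrightarrow> deriv (Q (P l0) m n) x * G 0 * difference_quotient ?q ?x ?x) (at 0)"
      by (intro tendsto_mult step.IH)
    moreover have "\<forall>\<^sub>F t in at 0. g n t / t ^ k * (\<Sum>j\<le>degree ?q. coeff (?p t) j * (\<Sum>i<j. Z n t ^ (j - Suc i) * Y n t ^ i))
        = g (Suc n) t / t ^ k"
    proof -
      have "\<forall>\<^sub>F t in at (0::complex). t \<in> ball 0 s" by (rule eventually_at_in_open'[OF open_ball s0(1)])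
      then show ?thesis
      proof eventually_elim
        case (elim t)
        have "g (Suc n) t = poly (?p t) (Y n t) - poly (?p t) (Z n t)"
          using rec[OF line[OF elim] step(1)] by (simp add: g_def Y_def Z_def)
        also have "\<dots> = g n t * difference_quotient (?p t) (Y n t) (Z n t)"
          by (simp add: poly_diff_eq g_def)
        finally show ?case by (simp add: difference_quotient_def deg[OF line[OF elim]])
      qed
    qed
    ultimately have "((\<lambda>t. g (Suc n) t / t ^ k) \<longlongrightarrow>
        deriv (Q (P l0) m n) x * G 0 * difference_quotient ?q ?x ?x) (at 0)"
      by (rule Lim_transform_eventually)
    moreover have "deriv (Q (P l0) m (Suc n)) x = poly (pderiv ?q) ?x * deriv (Q (P l0) m n) x"
    proof -
      have "Q (P l0) n (Suc n) = poly ?q" by (simp add: Q_step fun_eq_iff)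
      then have "deriv (Q (P l0) n (Suc n)) ?x = poly (pderiv ?q) ?x"
        by (simp add: DERIV_imp_deriv[OF poly_DERIV])
      then show ?thesis using deriv_Q_trans[of m n "Suc n" "P l0" x] step(1) by simp
    qed
    ultimately show ?case by (simp add: difference_quotient_diagonal mult_ac)
  qed
  have b: "cmod (deriv (Q (P l0) m n) x * G 0) \<le> R + R" if "n \<ge> m" for n
  proof (rule bounded_quotient_limit[OF holg[OF that] s _ lim[OF that]])
    fix t :: complex assume "t \<in> ball 0 s"
    from line[OF this] show "cmod (g n t) \<le> R + R"
      unfolding g_def Y_def Z_def
      by (intro order_trans[OF norm_triangle_ineq4 add_mono] bd that)
  qed
  have G0: "cmod (G 0) > 0" using G(5) G(2) by simp
  obtain i where i: "(R + R + 1) / (C * cmod (G 0)) < \<mu> ^ i" using real_arch_pow[OF exp(2)] by blast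
  have "R + R + 1 < C * \<mu> ^ i * cmod (G 0)" using i exp(1) G0 by (simp add: pos_divide_less_eq mult_ac)
  also have "\<dots> \<le> cmod (deriv (Q (P l0) m (m + i)) x * G 0)"
    unfolding norm_mult by (rule mult_right_mono[OF exp(3)]) simp
  also have "\<dots> \<le> R + R" by (rule b) simp
  finally show False by simp
qed

text \<open>Near a parameter at which \<open>\<sigma>\<close> is infinite, \<open>\<sigma>\<close> is large or infinite, so that it nowhere
  agrees with the locally bounded \<open>f\<close>. Near all other parameters \<open>\<sigma>\<close> is finite, and the identity
  theorem for complex-valued functions applies.\<close>

lemma sphere_valued_identity:
  assumes U: "open U" "connected U" and \<sigma>: "sphere_frechet_holomorphic_on \<sigma> U"
    and f: "frechet_holomorphic_on f U" and a: "a \<in> U" and l: "l \<in> U"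
    and eq: "\<forall>\<^sub>F x in nhds a. \<sigma> x = Some (f x)"
  shows "\<sigma> l = Some (f l)"
proof -
  let ?P = "\<lambda>c. \<forall>\<^sub>F x in nhds c. \<sigma> x = Some (f x)"
  have "?P l"
  proof (rule connected_induction_simple[where P = ?P, OF U(2) a l eq])
    fix c assume c: "c \<in> U"
    have fin: "\<exists>T. openin (top_of_set U) T \<and> c \<in> T \<and> (\<forall>x\<in>T. \<forall>y\<in>T. ?P x \<longrightarrow> ?P y)"
      if ev: "\<forall>\<^sub>F x in nhds c. \<sigma> x \<noteq> None"
    proof -
      have "\<forall>\<^sub>F x in nhds c. x \<in> U \<and> \<sigma> x \<noteq> None"
        using eventually_nhds_in_open[OF U(1) c] ev by eventually_elim simp
      then obtain r where r: "r > 0" "\<And>x. dist x c < r \<Longrightarrow> x \<in> U \<and> \<sigma> x \<noteq> None"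
        unfolding eventually_nhds_metric by blast
      define h where "h x = the (\<sigma> x)" for x
      have \<sigma>h: "\<sigma> x = Some (h x)" if "x \<in> ball c r" for x
        using r(2)[of x] that by (auto simp: h_def dist_commute)
      have hb: "frechet_holomorphic_on h (ball c r)"
        unfolding frechet_holomorphic_on_def
      proof
        fix x assume x: "x \<in> ball c r"
        then have "x \<in> U" using r(2)[of x] by (simp add: dist_commute)
        show "cfrechet_differentiable h x"
        proof (rule cfrechet_differentiable_of_sphere)
          show "sphere_valued_differentiable cfrechet_differentiable \<sigma> x"
            using \<sigma> \<open>x \<in> U\<close> unfolding sphere_frechet_holomorphic_on_def by blast
          show "\<forall>\<^sub>F y in nhds x. \<sigma> y = Some (h y)"
            using eventually_nhds_in_open[OF open_ball x] by (rule eventually_mono) (rule \<sigma>h)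
        qed
      qed
      have sub: "ball c r \<subseteq> U" using r(2) by (auto simp: dist_commute)
      have fb: "frechet_holomorphic_on f (ball c r)" by (rule frechet_holomorphic_on_subset[OF f sub])
      have "?P y" if x: "x \<in> ball c r" and y: "y \<in> ball c r" and e: "?P x" for x y
      proof -
        have e': "\<forall>\<^sub>F u in nhds x. h u = f u"
          using e by (rule eventually_mono) (simp add: h_def)
        show ?thesis
          using eventually_nhds_in_open[OF open_ball y]
          by (rule eventually_mono) (use frechet_identity_ball[OF hb fb x e'] \<sigma>h in simp)
      qed
      moreover have "openin (top_of_set U) (ball c r)" "c \<in> ball c r"
        using sub U(1) r(1) by (simp_all add: openin_open_eq)
      ultimately show ?thesis by blast
    qed
    have "sphere_valued_differentiable cfrechet_differentiable \<sigma> c"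
      using \<sigma> c unfolding sphere_frechet_holomorphic_on_def by blast
    then show "\<exists>T. openin (top_of_set U) T \<and> c \<in> T \<and> (\<forall>x\<in>T. \<forall>y\<in>T. ?P x \<longrightarrow> ?P y)"
      unfolding sphere_valued_differentiable_def
    proof (elim disjE conjE)
      assume "\<forall>\<^sub>F x in nhds c. \<sigma> x \<noteq> None"
      then show ?thesis by (rule fin)
    next
      define s where "s x = the (sphere_inverse (\<sigma> x))" for x
      assume n0: "\<forall>\<^sub>F x in nhds c. \<sigma> x \<noteq> Some 0"
        and "cfrechet_differentiable (\<lambda>x. the (sphere_inverse (\<sigma> x))) c"
      then have "isCont s c" unfolding s_def[abs_def] by (intro cfrechet_differentiable_imp_isCont)
      then have cs: "(s \<longlongrightarrow> s c) (nhds c)" by (simp add: continuous_at tendsto_at_iff_tendsto_nhds)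
      have sN: "\<sigma> x = None \<Longrightarrow> s x = 0" for x by (simp add: s_def sphere_inverse_def)
      have sS: "\<sigma> x = Some z \<Longrightarrow> z \<noteq> 0 \<Longrightarrow> s x = inverse z" for x z
        by (simp add: s_def sphere_inverse_def)
      show ?thesis
      proof (cases "s c = 0")
        case False
        then have "\<forall>\<^sub>F x in nhds c. s x \<noteq> 0" using cs by (intro tendsto_imp_eventually_ne) auto
        then have "\<forall>\<^sub>F x in nhds c. \<sigma> x \<noteq> None" by (rule eventually_mono) (use sN in blast)
        then show ?thesis by (rule fin)
      next
        case True
        have "isCont f c" using f c cfrechet_differentiable_imp_isCont unfolding frechet_holomorphic_on_def by blast
        then have "(f \<longlongrightarrow> f c) (nhds c)" by (simp add: continuous_at tendsto_at_iff_tendsto_nhds)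
        from tendsto_mult[OF cs this] have "((\<lambda>x. s x * f x) \<longlongrightarrow> 0) (nhds c)" using True by simp
        then have "\<forall>\<^sub>F x in nhds c. s x * f x \<noteq> 1" by (intro tendsto_imp_eventually_ne) auto
        with n0 eventually_nhds_in_open[OF U(1) c]
        have "\<forall>\<^sub>F x in nhds c. x \<in> U \<and> \<sigma> x \<noteq> Some (f x)"
        proof eventually_elim
          case (elim x)
          show ?case
          proof (intro conjI notI)
            show "x \<in> U" using elim by blast
            assume "\<sigma> x = Some (f x)"
            moreover from this have "f x \<noteq> 0" using elim by auto
            ultimately show False using sS[of x "f x"] elim by simp
          qed
        qed
        then obtain T where T: "open T" "c \<in> T" "\<And>x. x \<in> T \<Longrightarrow> x \<in> U \<and> \<sigma> x \<noteq> Some (f x)"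
          unfolding eventually_nhds by blast
        have "\<not> ?P x" if "x \<in> T" for x using T(3)[OF that] eventually_nhds_x_imp_x by blast
        moreover have "openin (top_of_set U) T" using T U(1) by (auto simp: openin_open_eq)
        ultimately show ?thesis using T(2) by blast
      qed
    qed
  qed
  then show ?thesis by (rule eventually_nhds_x_imp_x)
qed

section \<open>Motions on the sphere given by motions in the plane\<close>

lemma topspace_sphere: "topspace sphere_top = UNIV"
  by (simp add: UNIV_option_conv)

lemma limitin_sphere_iff:
  assumes "\<forall>\<^sub>F x in F. g x = Some (f x)"
  shows "limitin sphere_top g (Some q) F \<longleftrightarrow> (f \<longlongrightarrow> q) F"
proof
  assume L: "limitin sphere_top g (Some q) F"
  show "(f \<longlongrightarrow> q) F"
  proof (rule topological_tendstoI)
    fix V assume "open V" "q \<in> V"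
    then have "openin sphere_top (Some ` V)" "Some q \<in> Some ` V" by (auto simp: openin_sphere_iff)
    then have "\<forall>\<^sub>F x in F. g x \<in> Some ` V" using L unfolding limitin_def by blast
    then show "\<forall>\<^sub>F x in F. f x \<in> V" using assms by eventually_elim auto
  qed
next
  assume f: "(f \<longlongrightarrow> q) F"
  show "limitin sphere_top g (Some q) F"
    unfolding limitin_def
  proof (intro conjI allI impI)
    fix U assume U: "openin sphere_top U \<and> Some q \<in> U"
    obtain V where V: "open V" "q \<in> V" "Some ` V \<subseteq> U"
    proof -
      consider V where "open V" "U = Some ` V" | C where "compact C" "U = insert None (Some ` (- C))"
        using U unfolding openin_sphere_iff by blast
      then show thesis
      proof cases
        case 1
        then show ?thesis using that[of V] U by blast
      next
        case 2
        then show ?thesis using that[of "- C"] U compact_imp_closed[OF 2(1)] by (auto simp: open_Compl)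
      qed
    qed
    have "\<forall>\<^sub>F x in F. f x \<in> V" using f V topological_tendstoD by blast
    then show "\<forall>\<^sub>F x in F. g x \<in> U" using assms by eventually_elim (use V(3) in auto)
  qed simp
qed

lemma continuous_map_sphere:
  assumes X: "X \<subseteq> insert None (Some ` A)" and t: "continuous_on A t"
    and inf: "\<And>R. \<exists>r. \<forall>z. r < cmod z \<longrightarrow> R < cmod (t z)"
  shows "continuous_map (subtopology sphere_top X) sphere_top (map_option t)"
  unfolding continuous_map
proof (intro conjI allI impI)
  fix U assume "openin sphere_top U"
  then consider V where "open V" "U = Some ` V" | C where "compact C" "U = insert None (Some ` (- C))"
    unfolding openin_sphere_iff by blast
  then have "\<exists>T. openin sphere_top T \<and> {x \<in> X. map_option t x \<in> U} = T \<inter> X"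
  proof cases
    case 1
    then obtain W where W: "open W" "W \<inter> A = t -` V \<inter> A"
      using t unfolding continuous_on_open_invariant by blast
    have "{x \<in> X. map_option t x \<in> U} = Some ` W \<inter> X"
      using X W(2) 1(2) by (auto simp: image_iff)
    moreover have "openin sphere_top (Some ` W)" using W(1) by (auto simp: openin_sphere_iff)
    ultimately show ?thesis by blast
  next
    case 2
    have "open (- C)" using compact_imp_closed[OF 2(1)] by (simp add: open_Compl)
    then obtain W where W: "open W" "W \<inter> A = t -` (- C) \<inter> A"
      using t unfolding continuous_on_open_invariant by blast
    obtain R where R: "\<And>c. c \<in> C \<Longrightarrow> cmod c \<le> R"
      using compact_imp_bounded[OF 2(1)] unfolding bounded_iff by blast
    obtain r where r: "\<And>z. r < cmod z \<Longrightarrow> R < cmod (t z)" using inf by blast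
    define T where "T = insert None (Some ` (- (- W \<inter> cball 0 r)))"
    have "compact (- W \<inter> cball 0 r)" using W(1) by (intro closed_Int_compact) auto
    then have "openin sphere_top T" unfolding openin_sphere_iff T_def by blast
    moreover have "t z \<notin> C \<longleftrightarrow> z \<in> W \<or> r < cmod z" if "z \<in> A" for z
      using that W(2) r[of z] R[of "t z"] by fastforce
    then have "{x \<in> X. map_option t x \<in> U} = T \<inter> X"
      using X by (auto simp: T_def 2(2) image_iff)
    ultimately show ?thesis by blast
  qed
  then show "openin (subtopology sphere_top X) {x \<in> topspace (subtopology sphere_top X). map_option t x \<in> U}"
    by (simp add: openin_subtopology topspace_sphere del: topspace_Alexandroff_compactification)
qed (simp add: topspace_sphere del: topspace_Alexandroff_compactification)

text \<open>The infimum ranges over a ball that is not compact; but \<open>f\<close> and \<open>g\<close> are continuous at its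
  centre, so the chordal distance keeps half of its central value on a small ball.\<close>

lemma sphere_separation:
  fixes f g :: "linf \<Rightarrow> complex"
  assumes f: "isCont f l0" and g: "isCont g l0" and ne: "f l0 \<noteq> g l0"
  shows "\<exists>r>0. \<forall>r'. 0 < r' \<and> r' < r \<longrightarrow> (INF l\<in>ball l0 r'. sphere_dist (Some (f l)) (Some (g l))) > 0"
proof -
  define k where "k l = cmod (f l - g l) / (sqrt (1 + (cmod (f l))\<^sup>2) * sqrt (1 + (cmod (g l))\<^sup>2))" for l
  have pos: "0 < sqrt (1 + (cmod z)\<^sup>2)" for z by (simp add: add_pos_nonneg)
  have k1: "k l \<le> 1" for l
  proof -
    let ?a = "cmod (f l)" and ?b = "cmod (g l)"
    have "(cmod (f l - g l))\<^sup>2 \<le> (?a + ?b)\<^sup>2" by (intro power_mono norm_triangle_ineq4) simp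
    also have "\<dots> \<le> (1 + ?a\<^sup>2) * (1 + ?b\<^sup>2)"
      using zero_le_power2[of "?a * ?b - 1"] by (simp add: power2_eq_square algebra_simps)
    finally have "cmod (f l - g l) \<le> sqrt ((1 + ?a\<^sup>2) * (1 + ?b\<^sup>2))" by (rule real_le_rsqrt)
    then show ?thesis using pos by (simp add: k_def real_sqrt_mult divide_le_eq_1)
  qed
  have k0: "k l0 > 0" using ne pos by (simp add: k_def)
  have "isCont k l0"
    unfolding k_def[abs_def] using pos by (intro continuous_intros f g) (auto simp: less_imp_neq[THEN not_sym])
  then have "\<forall>\<^sub>F l in nhds l0. k l0 / 2 < k l"
    using k0 by (intro order_tendstoD(1)) (auto simp: continuous_at tendsto_at_iff_tendsto_nhds)
  then obtain r where r: "r > 0" "\<And>l. dist l l0 < r \<Longrightarrow> k l0 / 2 < k l"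
    unfolding eventually_nhds_metric by blast
  have low: "2 * arcsin (k l0 / 2) \<le> sphere_dist (Some (f l)) (Some (g l))" if "l \<in> ball l0 r'" "r' < r" for l r'
  proof -
    have "k l0 / 2 < k l" using r(2)[of l] that by (simp add: dist_commute)
    then have "arcsin (k l0 / 2) \<le> arcsin (k l)" using k0 k1[of l] by (intro arcsin_le_arcsin) auto
    then show ?thesis by (simp add: k_def)
  qed
  have "0 < arcsin (k l0 / 2)"
    using arcsin_less_mono[of 0 "k l0 / 2"] k0 k1[of l0] by simp
  then have "(INF l\<in>ball l0 r'. sphere_dist (Some (f l)) (Some (g l))) > 0" if "0 < r'" "r' < r" for r'
    by (intro less_le_trans[OF _ cINF_greatest[OF _ low[OF _ that(2)]]]) (use that in auto)
  then show ?thesis using r(1) by blast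
qed

lemma sphere_dist_commute: "sphere_dist (Some z) (Some w) = sphere_dist (Some w) (Some z)"
  by (simp add: norm_minus_commute mult.commute)

text \<open>A motion of a set of finite points and possibly infinity which fixes infinity. Three finite
  points serve for the condition on separation.\<close>

lemma holomorphic_motion_planar:
  assumes \<Lambda>': "open \<Lambda>'" "connected \<Lambda>'" "l0 \<in> \<Lambda>'" and X: "X \<subseteq> insert None (Some ` A)"
    and cont: "\<And>l. l \<in> \<Lambda>' \<Longrightarrow> continuous_on A (t l)" and inj: "\<And>l. l \<in> \<Lambda>' \<Longrightarrow> inj_on (t l) A"
    and inf: "\<And>l R. l \<in> \<Lambda>' \<Longrightarrow> \<exists>r. \<forall>z. r < cmod z \<longrightarrow> R < cmod (t l z)"
    and hol: "\<And>z. z \<in> A \<Longrightarrow> frechet_holomorphic_on (\<lambda>l. t l z) \<Lambda>'"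
    and id: "\<And>z. z \<in> A \<Longrightarrow> t l0 z = z"
    and abc: "Some a \<in> X" "Some b \<in> X" "Some c \<in> X" "a \<noteq> b" "b \<noteq> c" "a \<noteq> c"
  shows "holomorphic_motion X \<Lambda>' l0 (\<lambda>l. map_option (t l))"
  unfolding holomorphic_motion_def
proof (intro conjI \<Lambda>' ballI)
  have XA: "z \<in> A" if "Some z \<in> X" for z using X that by blast
  show "continuous_map (subtopology sphere_top X) sphere_top (map_option (t l))" if "l \<in> \<Lambda>'" for l
    by (rule continuous_map_sphere[OF X cont[OF that] inf[OF that]])
  show "inj_on (map_option (t l)) X" if "l \<in> \<Lambda>'" for l
  proof (rule inj_onI)
    fix x y assume "x \<in> X" "y \<in> X" "map_option (t l) x = map_option (t l) y"
    then show "x = y" using inj_onD[OF inj[OF that]] XA by (cases x; cases y) auto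
  qed
  show "sphere_frechet_holomorphic_on (\<lambda>l. map_option (t l) x) \<Lambda>'" if "x \<in> X" for x
  proof (cases x)
    case None
    then show ?thesis by (simp add: sphere_frechet_holomorphic_const_None)
  next
    case (Some z)
    then show ?thesis
      using hol[OF XA[of z]] that unfolding sphere_frechet_holomorphic_on_def frechet_holomorphic_on_def
      by (auto intro: sphere_valued_differentiable_Some)
  qed
  show "map_option (t l0) x = x" if "x \<in> X" for x using that id XA by (cases x) auto
  have ct: "isCont (\<lambda>l. t l z) l0" if "Some z \<in> X" for z
    using hol[OF XA[OF that]] \<Lambda>'(3) cfrechet_differentiable_imp_isCont
    unfolding frechet_holomorphic_on_def by blast
  define S where "S r z w \<longleftrightarrow> (\<forall>r'. 0 < r' \<and> r' < r \<longrightarrow>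
      (INF l\<in>ball l0 r'. sphere_dist (Some (t l z)) (Some (t l w))) > 0)" for r z w
  have sep: "\<exists>r>0. S r z w" if "Some z \<in> X" "Some w \<in> X" "z \<noteq> w" for z w
    unfolding S_def by (rule sphere_separation[OF ct[OF that(1)] ct[OF that(2)]]) (use id XA that in simp)
  obtain r1 where r1: "r1 > 0" "S r1 a b" using sep abc by blast
  obtain r2 where r2: "r2 > 0" "S r2 b c" using sep abc by blast
  obtain r3 where r3: "r3 > 0" "S r3 a c" using sep abc by blast
  obtain r0 where r0: "r0 > 0" "ball l0 r0 \<subseteq> \<Lambda>'" using \<Lambda>' openE by blast
  define r where "r = min r0 (min r1 (min r2 r3))"
  have S: "S r a b" "S r b c" "S r a c" using r1 r2 r3 by (auto simp: S_def r_def)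
  have sym: "S r z w \<Longrightarrow> S r w z" for z w unfolding S_def by (simp only: sphere_dist_commute)
  show "\<exists>x1\<in>X. \<exists>x2\<in>X. \<exists>x3\<in>X. x1 \<noteq> x2 \<and> x2 \<noteq> x3 \<and> x1 \<noteq> x3 \<and>
        (\<exists>r>0. ball l0 r \<subseteq> \<Lambda>' \<and> (\<forall>r'. 0 < r' \<and> r' < r \<longrightarrow>
           (\<forall>x\<in>{x1, x2, x3}. \<forall>y\<in>{x1, x2, x3}. x \<noteq> y \<longrightarrow>
              (INF l\<in>ball l0 r'. sphere_dist (map_option (t l) x) (map_option (t l) y)) > 0)))"
  proof (rule bexI[of _ "Some a"], rule bexI[of _ "Some b"], rule bexI[of _ "Some c"],
      intro conjI exI[of _ r] allI impI)
    show "r > 0" "ball l0 r \<subseteq> \<Lambda>'" using r0 r1 r2 r3 by (auto simp: r_def)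
    fix r' assume r': "0 < r' \<and> r' < r"
    have g: "(INF l\<in>ball l0 r'. sphere_dist (map_option (t l) (Some z)) (map_option (t l) (Some w))) > 0"
      if "S r z w" for z w using that r' unfolding S_def by simp
    show "\<forall>x\<in>{Some a, Some b, Some c}. \<forall>y\<in>{Some a, Some b, Some c}. x \<noteq> y \<longrightarrow>
              (INF l\<in>ball l0 r'. sphere_dist (map_option (t l) x) (map_option (t l) y)) > 0"
      using g[OF S(1)] g[OF S(2)] g[OF S(3)] g[OF sym[OF S(1)]] g[OF sym[OF S(2)]] g[OF sym[OF S(3)]]
      by blast
  qed (use abc in auto)
qed

section \<open>The motion over the hyperbolic component\<close>

lemma exterior_inverse_inv_into:
  assumes e: "exterior_inverse f A \<psi>"
  shows "inv_into (insert None (Some ` A)) f None = None"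
    and "1 < cmod w \<Longrightarrow> inv_into (insert None (Some ` A)) f (Some w) = Some (\<psi> w)"
proof -
  have fN: "f None = None" and im: "\<psi> ` {w. 1 < cmod w} = A" and fS: "\<And>w. 1 < cmod w \<Longrightarrow> f (Some (\<psi> w)) = Some w"
    using e by (auto simp: exterior_inverse_def bij_betw_def)
  have A: "\<exists>w. 1 < cmod w \<and> z = \<psi> w \<and> f (Some z) = Some w" if "z \<in> A" for z
    using that im fS by blast
  have inj: "inj_on f (insert None (Some ` A))"
  proof (rule inj_onI)
    fix x y assume "x \<in> insert None (Some ` A)" "y \<in> insert None (Some ` A)" "f x = f y"
    then show "x = y" using A fN by (cases x; cases y) fastforce+
  qed
  show "inv_into (insert None (Some ` A)) f None = None" by (rule inv_into_f_eq[OF inj _ fN]) simp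
  show "inv_into (insert None (Some ` A)) f (Some w) = Some (\<psi> w)" if "1 < cmod w"
    by (rule inv_into_f_eq[OF inj _ fS[OF that]]) (use im that in blast)
qed

lemma holomorphic_motion_cong:
  assumes m: "holomorphic_motion X U l0 \<tau>" and eq: "\<And>l x. l \<in> U \<Longrightarrow> x \<in> X \<Longrightarrow> \<tau>' l x = \<tau> l x"
  shows "holomorphic_motion X U l0 \<tau>'"
proof -
  note h = m[unfolded holomorphic_motion_def]
  have U: "open U" "connected U" "l0 \<in> U" using h by blast+
  show ?thesis
    unfolding holomorphic_motion_def
  proof (intro conjI U ballI)
    fix l assume l: "l \<in> U"
    have "continuous_map (subtopology sphere_top X) sphere_top (\<tau> l)" using h l by blast
    then show "continuous_map (subtopology sphere_top X) sphere_top (\<tau>' l)"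
      by (rule continuous_map_eq) (simp add: eq[OF l])
    have "inj_on (\<tau> l) X" using h l by blast
    then show "inj_on (\<tau>' l) X" using inj_on_cong[of X "\<tau>' l" "\<tau> l"] eq[OF l] by blast
  next
    fix x assume x: "x \<in> X"
    have s: "sphere_frechet_holomorphic_on (\<lambda>l. \<tau> l x) U" using h x by blast
    show "sphere_frechet_holomorphic_on (\<lambda>l. \<tau>' l x) U"
      unfolding sphere_frechet_holomorphic_on_def
    proof
      fix l assume l: "l \<in> U"
      have ev: "\<forall>\<^sub>F k in nhds l. \<tau>' k x = \<tau> k x"
        using eventually_nhds_in_open[OF U(1) l] by (rule eventually_mono) (rule eq[OF _ x])
      have e1: "\<forall>\<^sub>F k in nhds l. the (\<tau> k x) = the (\<tau>' k x)"
        "\<forall>\<^sub>F k in nhds l. the (sphere_inverse (\<tau> k x)) = the (sphere_inverse (\<tau>' k x))"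
        using ev by (rule eventually_mono, simp)+
      have "sphere_valued_differentiable cfrechet_differentiable (\<lambda>l. \<tau> l x) l"
        using s l unfolding sphere_frechet_holomorphic_on_def by blast
      then show "sphere_valued_differentiable cfrechet_differentiable (\<lambda>l. \<tau>' l x) l"
        unfolding sphere_valued_differentiable_def
        using cfrechet_differentiable_cong[OF e1(1)] cfrechet_differentiable_cong[OF e1(2)]
          eventually_elim2[OF _ ev, of "\<lambda>k. \<tau> k x \<noteq> None" "\<lambda>k. \<tau>' k x \<noteq> None"]
          eventually_elim2[OF _ ev, of "\<lambda>k. \<tau> k x \<noteq> Some 0" "\<lambda>k. \<tau>' k x \<noteq> Some 0"] by auto
    qed
    have "\<tau> l0 x = x" using h x by blast
    then show "\<tau>' l0 x = x" using eq[OF U(3) x] by simp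
  next
    obtain x1 x2 x3 r where x: "x1 \<in> X" "x2 \<in> X" "x3 \<in> X" "x1 \<noteq> x2" "x2 \<noteq> x3" "x1 \<noteq> x3"
      and r: "r > 0" "ball l0 r \<subseteq> U" "\<forall>r'. 0 < r' \<and> r' < r \<longrightarrow>
           (\<forall>x\<in>{x1, x2, x3}. \<forall>y\<in>{x1, x2, x3}. x \<noteq> y \<longrightarrow>
              (INF l\<in>ball l0 r'. sphere_dist (\<tau> l x) (\<tau> l y)) > 0)" using h by blast
    have inf: "(INF l\<in>ball l0 r'. sphere_dist (\<tau>' l x) (\<tau>' l y)) > 0"
      if "0 < r'" "r' < r" "x \<in> {x1, x2, x3}" "y \<in> {x1, x2, x3}" "x \<noteq> y" for r' x y
    proof -
      have eq': "(INF l\<in>ball l0 r'. sphere_dist (\<tau>' l x) (\<tau>' l y)) = (INF l\<in>ball l0 r'. sphere_dist (\<tau> l x) (\<tau> l y))"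
      proof (rule INF_cong[OF refl])
        fix l assume "l \<in> ball l0 r'"
        then have "l \<in> U" using r(2) that(2) by auto
        moreover have "x \<in> X" "y \<in> X" using x that(3,4) by auto
        ultimately show "sphere_dist (\<tau>' l x) (\<tau>' l y) = sphere_dist (\<tau> l x) (\<tau> l y)" by (simp add: eq)
      qed
      have "(INF l\<in>ball l0 r'. sphere_dist (\<tau> l x) (\<tau> l y)) > 0"
        using r(3)[rule_format, OF conjI[OF that(1,2)] that(3,4,5)] .
      then show ?thesis by (simp only: eq')
    qed
    show "\<exists>x1\<in>X. \<exists>x2\<in>X. \<exists>x3\<in>X. x1 \<noteq> x2 \<and> x2 \<noteq> x3 \<and> x1 \<noteq> x3 \<and>
        (\<exists>r>0. ball l0 r \<subseteq> U \<and> (\<forall>r'. 0 < r' \<and> r' < r \<longrightarrow>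
           (\<forall>x\<in>{x1, x2, x3}. \<forall>y\<in>{x1, x2, x3}. x \<noteq> y \<longrightarrow>
              (INF l\<in>ball l0 r'. sphere_dist (\<tau>' l x) (\<tau>' l y)) > 0)))"
    proof (rule bexI[OF _ x(1)], rule bexI[OF _ x(2)], rule bexI[OF _ x(3)],
        intro conjI exI[of _ r] allI impI ballI)
      fix r' x y assume "0 < r' \<and> r' < r" "x \<in> {x1, x2, x3}" "y \<in> {x1, x2, x3}" "x \<noteq> y"
      then show "(INF l\<in>ball l0 r'. sphere_dist (\<tau>' l x) (\<tau>' l y)) > 0" using inf by blast
    qed (use x r in auto)
  qed
qed

lemma boettcher_motion_of_component:
  assumes \<Lambda>: "open \<Lambda>" and fam: "analytic_family \<Lambda> P" and comp: "hyperbolic_component \<Lambda> P \<Omega>"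
    and l0: "l0 \<in> \<Omega>" and bf: "boettcher_family \<Lambda> \<Omega> P \<phi>"
  obtains S where "boettcher_motion P S \<Omega> l0"
    "\<And>l m. l \<in> \<Omega> \<Longrightarrow> exterior_inverse (\<phi> l m) (escaping (P l) m) (S l m)"
proof -
  have op: "open \<Omega>" by (rule hyperbolic_component_open[OF \<Lambda> fam comp bf])
  have con: "connected \<Omega>" using comp unfolding hyperbolic_component_def by (rule in_components_connected)
  have hyp: "\<Omega> \<subseteq> hyperbolic_parameters \<Lambda> P"
    using comp unfolding hyperbolic_component_def by (rule in_components_subset)
  then have \<Omega>\<Lambda>: "\<Omega> \<subseteq> \<Lambda>" by (auto simp: hyperbolic_parameters_def)
  obtain S where S: "\<And>l m. l \<in> \<Omega> \<Longrightarrow> exterior_inverse (\<phi> l m) (escaping (P l) m) (S l m)"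
    "\<And>l m w. l \<in> \<Omega> \<Longrightarrow> 1 < cmod w \<Longrightarrow>
       poly (P l (Suc m)) (S l m w) = S l (Suc m) (w ^ degree (P l (Suc m)))"
    "\<And>l. l \<in> \<Omega> \<Longrightarrow> \<exists>\<delta>>0. \<exists>d K M B. ball l \<delta> \<subseteq> \<Lambda> \<and> (\<forall>x\<in>ball l \<delta>. bounded_poly_seq d K M (P x)) \<and>
       (\<forall>x\<in>ball l \<delta> \<inter> \<Omega>. \<forall>m w. 1 < cmod w \<longrightarrow> cmod (S x m w) \<le> B * cmod w)"
    "\<And>m w. 1 < cmod w \<Longrightarrow> frechet_holomorphic_on (\<lambda>l. S l m w) \<Omega>"
  proof (rule boettcher_family_inverse[OF \<Lambda> fam \<Omega>\<Lambda> bf])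
    fix S
    assume h: "\<And>l m. l \<in> \<Omega> \<Longrightarrow> exterior_inverse (\<phi> l m) (escaping (P l) m) (S l m)"
      "\<And>l m w. l \<in> \<Omega> \<Longrightarrow> 1 < cmod w \<Longrightarrow>
         poly (P l (Suc m)) (S l m w) = S l (Suc m) (w ^ degree (P l (Suc m)))"
      "\<And>l. l \<in> \<Omega> \<Longrightarrow> \<exists>\<delta>>0. \<exists>d K M B. ball l \<delta> \<subseteq> \<Lambda> \<and> (\<forall>x\<in>ball l \<delta>. bounded_poly_seq d K M (P x)) \<and>
         (\<forall>x\<in>ball l \<delta> \<inter> \<Omega>. \<forall>m w. 1 < cmod w \<longrightarrow> cmod (S x m w) \<le> B * cmod w)"
      and h': "\<And>m w. open \<Omega> \<Longrightarrow> 1 < cmod w \<Longrightarrow> frechet_holomorphic_on (\<lambda>l. S l m w) \<Omega>"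
    show thesis by (rule that[OF h h'[OF op]])
  qed
  have "boettcher_motion P S \<Omega> l0"
  proof
    show "open \<Omega>" "connected \<Omega>" "l0 \<in> \<Omega>" by (rule op con l0)+
    show "hyperbolic (P l)" if "l \<in> \<Omega>" for l using hyp that by (auto simp: hyperbolic_parameters_def)
    show "frechet_holomorphic_on (\<lambda>l. S l m w) \<Omega>" if "1 < cmod w" for m w by (rule S(4)[OF that])
    show "degree (P l (Suc m)) = degree (P l0 (Suc m))" if l: "l \<in> \<Omega>" for l m
    proof (rule connected_induction_simple[where P = "\<lambda>l. degree (P l (Suc m)) = degree (P l0 (Suc m))", OF con l0 l refl])
      fix a assume a: "a \<in> \<Omega>"
      then obtain \<delta> where \<delta>: "\<delta> > 0" "\<forall>x\<in>ball a \<delta>. \<forall>m\<ge>1. degree (P x m) = degree (P a m)"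
        using analytic_family_degree_locally_constant[OF \<Lambda> fam] \<Omega>\<Lambda> by blast
      have "openin (top_of_set \<Omega>) (\<Omega> \<inter> ball a \<delta>)" by (rule openin_open_Int) simp
      moreover have "a \<in> \<Omega> \<inter> ball a \<delta>" using a \<delta>(1) by simp
      moreover have "degree (P x (Suc m)) = degree (P a (Suc m))" if "x \<in> \<Omega> \<inter> ball a \<delta>" for x
        using \<delta>(2) that by simp
      ultimately show "\<exists>T. openin (top_of_set \<Omega>) T \<and> a \<in> T \<and> (\<forall>x\<in>T. \<forall>y\<in>T.
          degree (P x (Suc m)) = degree (P l0 (Suc m)) \<longrightarrow> degree (P y (Suc m)) = degree (P l0 (Suc m)))"
        by metis
    qed
    show "\<exists>\<delta>>0. \<exists>d K M B. B > 0 \<and> ball l \<delta> \<subseteq> \<Omega> \<and>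
       (\<forall>x\<in>ball l \<delta>. boettcher_sequence (P x) d K M B (S x))" if l: "l \<in> \<Omega>" for l
    proof -
      obtain \<delta>1 d K M B where 1: "\<delta>1 > 0" "\<forall>x\<in>ball l \<delta>1. bounded_poly_seq d K M (P x)"
        "\<forall>x\<in>ball l \<delta>1 \<inter> \<Omega>. \<forall>m w. 1 < cmod w \<longrightarrow> cmod (S x m w) \<le> B * cmod w"
        using S(3)[OF l] by blast
      obtain \<delta>2 where 2: "\<delta>2 > 0" "ball l \<delta>2 \<subseteq> \<Omega>" using op l openE by blast
      have "boettcher_sequence (P x) d K M (max B 1) (S x)" if x: "x \<in> ball l (min \<delta>1 \<delta>2)" for x
      proof (rule boettcher_sequenceI)
        have x': "x \<in> ball l \<delta>1" "x \<in> \<Omega>" using x 2(2) by auto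
        show "bounded_poly_seq d K M (P x)" using 1(2) x'(1) by blast
        show "exterior_inverse (\<phi> x m) (escaping (P x) m) (S x m)" for m by (rule S(1)[OF x'(2)])
        fix m w assume w: "1 < cmod w"
        show "poly (P x (Suc m)) (S x m w) = S x (Suc m) (w ^ degree (P x (Suc m)))" by (rule S(2)[OF x'(2) w])
        have "cmod (S x m w) \<le> B * cmod w" using 1(3) x' w by blast
        also have "\<dots> \<le> max B 1 * cmod w" by (intro mult_right_mono) auto
        finally show "cmod (S x m w) \<le> max B 1 * cmod w" .
      qed
      moreover have "ball l (min \<delta>1 \<delta>2) \<subseteq> \<Omega>" using 2(2) by auto
      ultimately show ?thesis
        using 1(1) 2(1) by (intro exI[of _ "min \<delta>1 \<delta>2"] conjI exI[of _ d] exI[of _ K] exI[of _ M] exI[of _ "max B 1"]) auto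
    qed
  qed
  then show thesis using that S(1) by blast
qed

lemma conjugating_julia_motion_finite:
  assumes \<tau>: "conjugating_julia_motion P U l0 \<tau>" and l: "l \<in> U" and x: "x \<in> julia (P l0) m"
  shows "\<tau> l m (Some x) = Some (the (\<tau> l m (Some x)))" "the (\<tau> l m (Some x)) \<in> julia (P l) m"
    "the (\<tau> l (Suc m) (Some (poly (P l0 (Suc m)) x))) = poly (P l (Suc m)) (the (\<tau> l m (Some x)))"
proof -
  have im: "\<tau> l m ` (Some ` julia (P l0) m) = Some ` julia (P l) m"
    and cj: "\<tau> l (Suc m) (map_option (poly (P l0 (Suc m))) (Some x)) =
           map_option (poly (P l (Suc m))) (\<tau> l m (Some x))"
    using \<tau> l x unfolding conjugating_julia_motion_def by blast+
  have "\<tau> l m (Some x) \<in> Some ` julia (P l) m" using im x by blast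
  then obtain y where y: "y \<in> julia (P l) m" "\<tau> l m (Some x) = Some y" by blast
  then show "\<tau> l m (Some x) = Some (the (\<tau> l m (Some x)))" "the (\<tau> l m (Some x)) \<in> julia (P l) m" by simp_all
  show "the (\<tau> l (Suc m) (Some (poly (P l0 (Suc m)) x))) = poly (P l (Suc m)) (the (\<tau> l m (Some x)))"
    using cj y(2) by simp
qed

lemma conjugating_julia_motion_holomorphic:
  assumes \<tau>: "conjugating_julia_motion P U l0 \<tau>" and x: "x \<in> julia (P l0) m"
  shows "frechet_holomorphic_on (\<lambda>l. the (\<tau> l m (Some x))) U"
  unfolding frechet_holomorphic_on_def
proof
  fix l assume l: "l \<in> U"
  have hm: "holomorphic_motion (Some ` julia (P l0) m) U l0 (\<lambda>l. \<tau> l m)"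
    using \<tau> unfolding conjugating_julia_motion_def by blast
  have op: "open U" and sh: "sphere_frechet_holomorphic_on (\<lambda>l. \<tau> l m (Some x)) U"
    using hm x unfolding holomorphic_motion_def by blast+
  show "cfrechet_differentiable (\<lambda>l. the (\<tau> l m (Some x))) l"
  proof (rule cfrechet_differentiable_of_sphere)
    show "sphere_valued_differentiable cfrechet_differentiable (\<lambda>l. \<tau> l m (Some x)) l"
      using sh l unfolding sphere_frechet_holomorphic_on_def by blast
    show "\<forall>\<^sub>F k in nhds l. \<tau> k m (Some x) = Some (the (\<tau> k m (Some x)))"
      using eventually_nhds_in_open[OF op l]
      by (rule eventually_mono) (rule conjugating_julia_motion_finite(1)[OF \<tau> _ x])
  qed
qed

context boettcher_motion
begin

abbreviation sphere_motion :: "linf \<Rightarrow> nat \<Rightarrow> csphere \<Rightarrow> csphere" where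
  "sphere_motion l m \<equiv> map_option (motion l m)"

lemma motion_of_subset:
  assumes X: "X \<subseteq> insert None (Some ` carrier_set l0 m)"
    and "\<exists>a b c. Some a \<in> X \<and> Some b \<in> X \<and> Some c \<in> X \<and> a \<noteq> b \<and> b \<noteq> c \<and> a \<noteq> c"
  shows "holomorphic_motion X \<Omega> l0 (\<lambda>l. sphere_motion l m)"
proof -
  obtain a b c where abc: "Some a \<in> X" "Some b \<in> X" "Some c \<in> X" "a \<noteq> b" "b \<noteq> c" "a \<noteq> c"
    using assms(2) by blast
  show ?thesis
    by (rule holomorphic_motion_planar[OF open_\<Omega> connected_\<Omega> l0 X motion_continuous motion_inj
          motion_at_infinity motion_holomorphic motion_l0 abc])
qed

lemma motion_julia_sphere: "holomorphic_motion (Some ` julia (P l0) m) \<Omega> l0 (\<lambda>l. sphere_motion l m)"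
  by (rule motion_of_subset) (use three_julia_points[of m] in blast)+

lemma three_escaping_points:
  "\<exists>a b c. a \<in> escaping (P l0) m \<and> b \<in> escaping (P l0) m \<and> c \<in> escaping (P l0) m \<and> a \<noteq> b \<and> b \<noteq> c \<and> a \<noteq> c"
  using S_in[OF l0, of 2 m] S_in[OF l0, of 3 m] S_in[OF l0, of 4 m]
    S_inj[OF l0, of 2 3 m] S_inj[OF l0, of 3 4 m] S_inj[OF l0, of 2 4 m] by auto

lemma motion_basin_sphere: "holomorphic_motion (basin (P l0) m) \<Omega> l0 (\<lambda>l. sphere_motion l m)"
  by (rule motion_of_subset) (use three_escaping_points[of m] in \<open>auto simp: basin_eq\<close>)

lemma motion_closure_sphere:
  "holomorphic_motion (basin (P l0) m \<union> Some ` julia (P l0) m) \<Omega> l0 (\<lambda>l. sphere_motion l m)"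
  by (rule motion_of_subset) (use three_escaping_points[of m] in \<open>auto simp: basin_eq\<close>)

lemma sphere_motion_julia:
  "x \<in> julia (P l0) m \<Longrightarrow> sphere_motion l m (Some x) = Some (boundary_map l m x)"
  by (simp add: motion_julia)

lemma sphere_motion_conjugating: "conjugating_julia_motion P \<Omega> l0 sphere_motion"
  unfolding conjugating_julia_motion_def
proof (intro allI conjI ballI)
  fix m show "holomorphic_motion (Some ` julia (P l0) m) \<Omega> l0 (\<lambda>l. sphere_motion l m)"
    by (rule motion_julia_sphere)
  fix l assume l: "l \<in> \<Omega>"
  show "sphere_motion l m ` (Some ` julia (P l0) m) = Some ` julia (P l) m"
    unfolding motion_image_julia[OF l, symmetric] by (auto simp: image_image)
  fix x assume "x \<in> Some ` julia (P l0) m"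
  then obtain z where z: "z \<in> julia (P l0) m" "x = Some z" by blast
  have "poly (P l0 (Suc m)) z \<in> julia (P l0) (Suc m)"
    using julia_forward[OF l0, of m "Suc m" z] z by (simp add: Q_step)
  then show "sphere_motion l (Suc m) (map_option (poly (P l0 (Suc m))) x) =
      map_option (poly (P l (Suc m))) (sphere_motion l m x)"
    using boundary_map_conjugates[OF l z(1)] z by (simp add: motion_julia)
qed

text \<open>Along the forward orbit of a Julia point both motions give orbits of the perturbed sequence in
  its Julia sets, which are bounded uniformly near \<open>l0\<close>.\<close>

lemma conjugating_motion_unique_near:
  assumes \<Lambda>: "open \<Lambda>" and fam: "analytic_family \<Lambda> P" and \<Omega>\<Lambda>: "\<Omega> \<subseteq> \<Lambda>"
    and \<epsilon>: "\<epsilon> > 0" and \<tau>: "conjugating_julia_motion P (ball l0 \<epsilon>) l0 \<tau>"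
  shows "\<exists>\<delta>>0. ball l0 \<delta> \<subseteq> ball l0 \<epsilon> \<inter> \<Omega> \<and>
     (\<forall>l\<in>ball l0 \<delta>. \<forall>m. \<forall>x\<in>julia (P l0) m. motion l m x = the (\<tau> l m (Some x)))"
proof -
  obtain \<delta>0 d K M B where \<delta>0: "\<delta>0 > 0" "ball l0 \<delta>0 \<subseteq> \<Omega>"
      "\<forall>x\<in>ball l0 \<delta>0. boettcher_sequence (P x) d K M B (S x)"
    using locally_uniform[OF l0] by blast
  define \<delta> where "\<delta> = min \<delta>0 \<epsilon>"
  have \<delta>: "\<delta> > 0" "ball l0 \<delta> \<subseteq> ball l0 \<epsilon>" "ball l0 \<delta> \<subseteq> \<Omega>"
    using \<delta>0 \<epsilon> by (auto simp: \<delta>_def)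
  have bd: "bounded_poly_seq d K M (P x)" if "x \<in> ball l0 \<delta>" for x
    using \<delta>0(3) that by (auto simp: \<delta>_def boettcher_sequence_def)
  obtain C \<mu> where C: "C > 0" "\<mu> > 1" "\<And>i m z. z \<in> julia (P l0) m \<Longrightarrow>
      C * \<mu> ^ i \<le> cmod (deriv (Q (P l0) m (m + i)) z)"
    using hyperbolic[OF l0] unfolding hyperbolic_def by blast
  have "motion l m x = the (\<tau> l m (Some x))"
    if l: "l \<in> ball l0 \<delta>" and x: "x \<in> julia (P l0) m" for l m x
  proof -
    define X where "X n = Q (P l0) m n x" for n
    have XJ: "X n \<in> julia (P l0) n" if "n \<ge> m" for n
      unfolding X_def by (rule julia_forward[OF l0 that x])
    have XS: "X (Suc n) = poly (P l0 (Suc n)) (X n)" if "n \<ge> m" for n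
      using that by (simp add: X_def Q_Suc)
    have Xm: "X m = x" by (simp add: X_def)
    have "motion l m (X m) = the (\<tau> l m (Some (X m)))"
    proof (rule bounded_orbits_unique[where y = "\<lambda>l n. motion l n (X n)" and z = "\<lambda>l n. the (\<tau> l n (Some (X n)))"
          and R = "escape_radius d K M" and x = x and P = P, OF _ _ _ _ _ _ _ _ _ _ C(1,2) C(3)[OF x] l])
      show "frechet_holomorphic_on (\<lambda>l. motion l n (X n)) (ball l0 \<delta>)" if "n \<ge> m" for n
        by (rule frechet_holomorphic_on_subset[OF motion_holomorphic \<delta>(3)]) (use XJ[OF that] in simp)
      show "frechet_holomorphic_on (\<lambda>l. the (\<tau> l n (Some (X n)))) (ball l0 \<delta>)" if "n \<ge> m" for n
        by (rule frechet_holomorphic_on_subset[OF conjugating_julia_motion_holomorphic[OF \<tau> XJ[OF that]] \<delta>(2)])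
      fix k n assume k: "k \<in> ball l0 \<delta>"
      have k\<Omega>: "k \<in> \<Omega>" and k\<epsilon>: "k \<in> ball l0 \<epsilon>" using k \<delta> by blast+
      show "degree (P k (Suc n)) = degree (P l0 (Suc n))" by (rule degree_constant[OF k\<Omega>])
      assume n: "n \<ge> m"
      show "cmod (motion k n (X n)) \<le> escape_radius d K M"
        using julia_bound[OF bd[OF k] boundary_map_in_julia[OF k\<Omega> XJ[OF n]]] motion_julia[OF XJ[OF n]] by simp
      show "cmod (the (\<tau> k n (Some (X n)))) \<le> escape_radius d K M"
        using julia_bound[OF bd[OF k] conjugating_julia_motion_finite(2)[OF \<tau> k\<epsilon> XJ[OF n]]] by simp
      show "motion k (Suc n) (X (Suc n)) = poly (P k (Suc n)) (motion k n (X n))"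
        using boundary_map_conjugates[OF k\<Omega> XJ[OF n]] motion_julia[OF XJ[OF n], of k]
          motion_julia[OF XJ[of "Suc n"], of k] n XS[OF n] by simp
      show "the (\<tau> k (Suc n) (Some (X (Suc n)))) = poly (P k (Suc n)) (the (\<tau> k n (Some (X n))))"
        using conjugating_julia_motion_finite(3)[OF \<tau> k\<epsilon> XJ[OF n]] XS[OF n] by simp
    next
      show "motion l0 m (X m) = x" using motion_l0[of x m] x by (simp add: Xm)
      have "\<tau> l0 m (Some x) = Some x"
        using \<tau> x unfolding conjugating_julia_motion_def holomorphic_motion_def by blast
      then show "the (\<tau> l0 m (Some (X m))) = x" by (simp add: Xm)
      show "frechet_holomorphic_on (\<lambda>l. coeff (P l (Suc n)) j) (ball l0 \<delta>)" for n j
        by (rule frechet_holomorphic_on_subset[OF analytic_family_coeff_holomorphic[OF fam \<Lambda>]])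
          (use \<delta>(3) \<Omega>\<Lambda> in auto)
    qed
    then show ?thesis by (simp add: Xm)
  qed
  then show ?thesis using \<delta> by blast
qed

end

theorem theorem4p1:
  fixes \<Lambda> \<Omega> :: "linf set" and l0 :: linf
    and P :: "linf \<Rightarrow> nat \<Rightarrow> complex poly"
    and \<phi> :: "linf \<Rightarrow> nat \<Rightarrow> csphere \<Rightarrow> csphere"
  assumes "open \<Lambda>"
    and "analytic_family \<Lambda> P"
    and "monic_family \<Lambda> P \<or>
         (\<exists>P'. analytic_family \<Lambda> P' \<and> monic_family \<Lambda> P' \<and>
               globally_analytically_conjugate \<Lambda> P P')"
    and "l0 \<in> HC \<Lambda> P"
    and "hyperbolic_component \<Lambda> P \<Omega>" and "l0 \<in> \<Omega>"
    and "boettcher_family \<Lambda> \<Omega> P \<phi>"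
  shows "\<exists>T :: linf \<Rightarrow> nat \<Rightarrow> csphere \<Rightarrow> csphere.
    (\<forall>m.
       holomorphic_motion (basin (P l0) m) \<Omega> l0
         (\<lambda>l. boettcher_inv (P l) (\<phi> l) m \<circ> \<phi> l0 m) \<and>
       holomorphic_motion (basin (P l0) m \<union> Some ` julia (P l0) m) \<Omega> l0 (\<lambda>l. T l m) \<and>
       (\<forall>l\<in>\<Omega>.
          (\<forall>x\<in>basin (P l0) m. T l m x = boettcher_inv (P l) (\<phi> l) m (\<phi> l0 m x)) \<and>
          T l m ` (basin (P l0) m \<union> Some ` julia (P l0) m) =
            basin (P l) m \<union> Some ` julia (P l) m) \<and>
       (\<forall>\<theta>. \<exists>q\<in>Some ` julia (P l0) m. ray_lands_at (P l0) (\<phi> l0) \<theta> m q \<and>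
          (\<forall>l\<in>\<Omega>. ray_lands_at (P l) (\<phi> l) \<theta> m (T l m q))) \<and>
       (\<forall>q\<in>Some ` julia (P l0) m. \<exists>\<theta>. ray_lands_at (P l0) (\<phi> l0) \<theta> m q)) \<and>
    conjugating_julia_motion P \<Omega> l0 T \<and>
    (\<forall>\<epsilon>0 \<tau>. \<epsilon>0 > 0 \<and> ball l0 \<epsilon>0 \<subseteq> \<Lambda> \<and> conjugating_julia_motion P (ball l0 \<epsilon>0) l0 \<tau> \<longrightarrow>
       (\<forall>m. (\<forall>l\<in>connected_component_set (ball l0 \<epsilon>0 \<inter> \<Omega>) l0.
               \<forall>x\<in>Some ` julia (P l0) m. T l m x = \<tau> l m x) \<and>
            (\<forall>\<sigma>. holomorphic_motion (Some ` julia (P l0) m) \<Omega> l0 \<sigma> \<and>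
               (\<forall>\<^sub>F l in nhds l0. \<forall>x\<in>Some ` julia (P l0) m. \<sigma> l x = \<tau> l m x) \<longrightarrow>
               (\<forall>l\<in>\<Omega>. \<forall>x\<in>Some ` julia (P l0) m. \<sigma> l x = T l m x)))) \<and>
    (\<forall>p N (\<theta> :: nat \<Rightarrow> nat \<Rightarrow> real). p \<in> julia (P l0) 0 \<and>
       (\<forall>m. exactly_these_rays_meet_at (P l0) (\<phi> l0) m N (\<lambda>i. \<theta> i m)
              (Some (Q (P l0) 0 m p))) \<longrightarrow>
       (\<forall>m. \<forall>l\<in>\<Omega>. exactly_these_rays_meet_at (P l) (\<phi> l) m N (\<lambda>i. \<theta> i m)
              (T l m (Some (Q (P l0) 0 m p)))))"
proof -
  have comp: "\<Omega> \<in> components (hyperbolic_parameters \<Lambda> P)"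
    using assms(5) by (simp add: hyperbolic_component_def)
  have \<Omega>\<Lambda>: "\<Omega> \<subseteq> \<Lambda>" using in_components_subset[OF comp] by (auto simp: hyperbolic_parameters_def)
  obtain S where bm: "boettcher_motion P S \<Omega> l0"
    and ei: "\<And>l m. l \<in> \<Omega> \<Longrightarrow> exterior_inverse (\<phi> l m) (escaping (P l) m) (S l m)"
  proof (rule boettcher_motion_of_component[OF assms(1,2,5,6,7)])
    fix S
    assume h: "boettcher_motion P S \<Omega> l0"
      "\<And>l m. l \<in> \<Omega> \<Longrightarrow> exterior_inverse (\<phi> l m) (escaping (P l) m) (S l m)"
    show thesis by (rule that[OF h])
  qed
  interpret boettcher_motion P S \<Omega> l0 by (rule bm)
  let ?T = "\<lambda>l m. sphere_motion l m"
  have inv: "boettcher_inv (P l) (\<phi> l) m None = None"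
    "\<And>w. 1 < cmod w \<Longrightarrow> boettcher_inv (P l) (\<phi> l) m (Some w) = Some (S l m w)" if "l \<in> \<Omega>" for l m
    unfolding boettcher_inv_def basin_eq using exterior_inverse_inv_into[OF ei[OF that]] by blast+
  have \<phi>0: "\<phi> l0 m None = None" "\<And>w. 1 < cmod w \<Longrightarrow> \<phi> l0 m (Some (S l0 m w)) = Some w" for m
    using ei[OF l0] by (auto simp: exterior_inverse_def)
  have T: "boettcher_inv (P l) (\<phi> l) m (\<phi> l0 m x) = ?T l m x" if l: "l \<in> \<Omega>" and x: "x \<in> basin (P l0) m" for l m x
  proof (cases x)
    case None
    then show ?thesis using \<phi>0 inv[OF l] by simp
  next
    case (Some z)
    then have "z \<in> escaping (P l0) m" using x by (auto simp: basin_eq)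
    then obtain w where w: "1 < cmod w" "z = S l0 m w" using S_surj[OF l0] by blast
    then show ?thesis using Some \<phi>0 inv[OF l] motion_S[OF l] by simp
  qed
  have two: "(1::real) < 2" by simp
  have cis1: "cmod (cis \<theta>) = 1" for \<theta> by simp
  have ray: "\<forall>\<^sub>F R in at_right 1. boettcher_inv (P l) (\<phi> l) m (Some (of_real R * cis \<theta>)) = Some (S l m (of_real R * cis \<theta>))"
    if l: "l \<in> \<Omega>" for l m \<theta>
    using eventually_ray_in_annulus[OF cis1 two, of \<theta>]
    by (rule eventually_mono) (rule inv(2)[OF l], simp add: annulus_def)
  have lands: "ray_lands_at (P l) (\<phi> l) \<theta> m (Some q) \<longleftrightarrow> ((\<lambda>R. S l m (of_real R * cis \<theta>)) \<longlongrightarrow> q) (at_right 1)"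
    if l: "l \<in> \<Omega>" for l m \<theta> q
    unfolding ray_lands_at_def by (rule limitin_sphere_iff[OF ray[OF l]])
  \<comment> \<open>The boundary motion carries landing points to landing points, in both directions.\<close>
  have lands_T: "ray_lands_at (P l) (\<phi> l) \<theta> m (?T l m (Some q)) \<longleftrightarrow> ray_lands_at (P l0) (\<phi> l0) \<theta> m (Some q)"
    if l: "l \<in> \<Omega>" and q: "q \<in> julia (P l0) m" for l m \<theta> q
    unfolding sphere_motion_julia[OF q] lands[OF l] lands[OF l0]
    using boundary_map_ray[OF l q cis1] ray_limit_reflected[OF l q cis1] by blast
  have ext: "external_ray (P l) (\<phi> l) \<theta> m = ?T l m ` external_ray (P l0) (\<phi> l0) \<theta> m"
    and ext_in: "external_ray (P l0) (\<phi> l0) \<theta> m \<subseteq> basin (P l0) m" if l: "l \<in> \<Omega>" for l m \<theta>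
  proof -
    have R: "1 < cmod (of_real R * cis \<theta>)" if "R > 1" for R using that by (simp add: norm_mult)
    have e: "external_ray (P k) (\<phi> k) \<theta> m = (\<lambda>R. Some (S k m (of_real R * cis \<theta>))) ` {1<..}" if "k \<in> \<Omega>" for k
    proof -
      have "external_ray (P k) (\<phi> k) \<theta> m =
          (\<lambda>R. boettcher_inv (P k) (\<phi> k) m (Some (of_real R * cis \<theta>))) ` {1<..}"
        unfolding external_ray_def by auto
      also have "\<dots> = (\<lambda>R. Some (S k m (of_real R * cis \<theta>))) ` {1<..}"
        by (rule image_cong[OF refl]) (use inv(2)[OF that R] in auto)
      finally show ?thesis .
    qed
    have m: "Some (S l m (of_real R * cis \<theta>)) = ?T l m (Some (S l0 m (of_real R * cis \<theta>)))" if "R > 1" for R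
      using motion_S[OF l R[OF that]] by simp
    show "external_ray (P l) (\<phi> l) \<theta> m = ?T l m ` external_ray (P l0) (\<phi> l0) \<theta> m"
      unfolding e[OF l] e[OF l0] image_image by (rule image_cong[OF refl]) (use m in simp)
    show "external_ray (P l0) (\<phi> l0) \<theta> m \<subseteq> basin (P l0) m"
      unfolding e[OF l0] basin_eq using S_in[OF l0 R] by auto
  qed
  have ext_eq: "external_ray (P l) (\<phi> l) s m = external_ray (P l) (\<phi> l) t m \<longleftrightarrow>
      external_ray (P l0) (\<phi> l0) s m = external_ray (P l0) (\<phi> l0) t m" if l: "l \<in> \<Omega>" for l m s t
  proof -
    have "inj_on (?T l m) (basin (P l0) m)"
      using motion_basin_sphere[of m] l unfolding holomorphic_motion_def by blast
    then show ?thesis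
      unfolding ext[OF l] using inj_on_image_eq_iff ext_in[OF l] by metis
  qed
  have meet: "exactly_these_rays_meet_at (P l) (\<phi> l) m N \<theta> (?T l m (Some q))"
    if l: "l \<in> \<Omega>" and q: "q \<in> julia (P l0) m" and ex: "exactly_these_rays_meet_at (P l0) (\<phi> l0) m N \<theta> (Some q)"
    for l m N \<theta> q
    using ex unfolding exactly_these_rays_meet_at_def lands_T[OF l q] ext_eq[OF l] inj_on_def by blast
  have image: "?T l m ` (basin (P l0) m \<union> Some ` julia (P l0) m) = basin (P l) m \<union> Some ` julia (P l) m"
    if l: "l \<in> \<Omega>" for l m
    unfolding basin_eq motion_image_julia[OF l, symmetric] motion_image_escaping[OF l, symmetric]
    by (simp add: image_Un image_image)
  have landing_all: "\<exists>q\<in>Some ` julia (P l0) m. ray_lands_at (P l0) (\<phi> l0) \<theta> m q \<and>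
          (\<forall>l\<in>\<Omega>. ray_lands_at (P l) (\<phi> l) \<theta> m (?T l m q))" for m \<theta>
  proof -
    obtain q where q: "q \<in> julia (P l0) m" "((\<lambda>R. S l0 m (of_real R * cis \<theta>)) \<longlongrightarrow> q) (at_right 1)"
      using ray_lands[OF l0 cis1] by blast
    then have "ray_lands_at (P l0) (\<phi> l0) \<theta> m (Some q)" using lands[OF l0] by blast
    then show ?thesis using lands_T[OF _ q(1)] q(1) by blast
  qed
  have landing_onto: "\<exists>\<theta>. ray_lands_at (P l0) (\<phi> l0) \<theta> m q" if "q \<in> Some ` julia (P l0) m" for m q
  proof -
    obtain x where x: "x \<in> julia (P l0) m" "q = Some x" using \<open>q \<in> Some ` julia (P l0) m\<close> by blast
    obtain e where e: "cmod e = 1" "((\<lambda>R. S l0 m (of_real R * e)) \<longlongrightarrow> x) (at_right 1)"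
      using julia_landing[OF l0 x(1)] by blast
    have "e \<noteq> 0" using e(1) by auto
    then have "cis (Arg e) = e" using e(1) by (simp add: cis_Arg sgn_eq)
    then show ?thesis using lands[OF l0, of "Arg e" m x] e(2) x(2) by auto
  qed
  have unique: "(\<forall>l\<in>connected_component_set (ball l0 \<epsilon> \<inter> \<Omega>) l0.
               \<forall>x\<in>Some ` julia (P l0) m. ?T l m x = \<tau> l m x) \<and>
            (\<forall>\<sigma>. holomorphic_motion (Some ` julia (P l0) m) \<Omega> l0 \<sigma> \<and>
               (\<forall>\<^sub>F l in nhds l0. \<forall>x\<in>Some ` julia (P l0) m. \<sigma> l x = \<tau> l m x) \<longrightarrow>
               (\<forall>l\<in>\<Omega>. \<forall>x\<in>Some ` julia (P l0) m. \<sigma> l x = ?T l m x))"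
    if \<epsilon>: "\<epsilon> > 0" and \<tau>: "conjugating_julia_motion P (ball l0 \<epsilon>) l0 \<tau>" for \<epsilon> \<tau> m
  proof -
    obtain \<delta> where \<delta>: "\<delta> > 0" "ball l0 \<delta> \<subseteq> ball l0 \<epsilon> \<inter> \<Omega>"
       "\<forall>l\<in>ball l0 \<delta>. \<forall>m. \<forall>x\<in>julia (P l0) m. motion l m x = the (\<tau> l m (Some x))"
      using conjugating_motion_unique_near[OF assms(1,2) \<Omega>\<Lambda> \<epsilon> \<tau>] by blast
    have ev: "\<forall>\<^sub>F l in nhds l0. l \<in> ball l0 \<delta>" by (rule eventually_nhds_in_open) (use \<delta>(1) in auto)
    let ?C = "connected_component_set (ball l0 \<epsilon> \<inter> \<Omega>) l0"
    have opC: "open ?C" by (intro open_connected_component open_Int open_ball open_\<Omega>)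
    have subC: "?C \<subseteq> ball l0 \<epsilon>" "?C \<subseteq> \<Omega>" using connected_component_subset[of "ball l0 \<epsilon> \<inter> \<Omega>" l0] by auto
    have "?T l m (Some x) = \<tau> l m (Some x)" if l: "l \<in> ?C" and x: "x \<in> julia (P l0) m" for l x
    proof -
      have "motion l m x = the (\<tau> l m (Some x))"
      proof (rule frechet_identity_connected[OF opC connected_connected_component])
        show "frechet_holomorphic_on (\<lambda>l. motion l m x) ?C"
          by (rule frechet_holomorphic_on_subset[OF motion_holomorphic subC(2)]) (use x in simp)
        show "frechet_holomorphic_on (\<lambda>l. the (\<tau> l m (Some x))) ?C"
          by (rule frechet_holomorphic_on_subset[OF conjugating_julia_motion_holomorphic[OF \<tau> x] subC(1)])
        show "l0 \<in> ?C" using l0 \<epsilon> by (simp add: connected_component_refl)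
        show "\<forall>\<^sub>F l in nhds l0. motion l m x = the (\<tau> l m (Some x))"
          using ev by (rule eventually_mono) (use \<delta>(3) x in blast)
        show "l \<in> ?C" by (rule l)
      qed
      moreover have "l \<in> ball l0 \<epsilon>" using l subC(1) by blast
      ultimately show ?thesis using conjugating_julia_motion_finite(1)[OF \<tau> _ x] by simp
    qed
    moreover have "\<sigma> l (Some x) = ?T l m (Some x)"
      if \<sigma>: "holomorphic_motion (Some ` julia (P l0) m) \<Omega> l0 \<sigma>"
        and ag: "\<forall>\<^sub>F l in nhds l0. \<forall>x\<in>Some ` julia (P l0) m. \<sigma> l x = \<tau> l m x"
        and l: "l \<in> \<Omega>" and x: "x \<in> julia (P l0) m" for \<sigma> l x
    proof -
      have "\<sigma> l (Some x) = Some (motion l m x)"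
      proof (rule sphere_valued_identity[OF open_\<Omega> connected_\<Omega> _ _ l0 l])
        show "sphere_frechet_holomorphic_on (\<lambda>l. \<sigma> l (Some x)) \<Omega>"
          using \<sigma> x unfolding holomorphic_motion_def by blast
        show "frechet_holomorphic_on (\<lambda>l. motion l m x) \<Omega>" by (rule motion_holomorphic) (use x in simp)
        show "\<forall>\<^sub>F l in nhds l0. \<sigma> l (Some x) = Some (motion l m x)"
          using ev ag
        proof eventually_elim
          case (elim k)
          have "k \<in> ball l0 \<epsilon>" using elim(1) \<delta>(2) by blast
          then have "\<tau> k m (Some x) = Some (the (\<tau> k m (Some x)))"
            by (rule conjugating_julia_motion_finite(1)[OF \<tau> _ x])
          moreover have "motion k m x = the (\<tau> k m (Some x))" using \<delta>(3) elim(1) x by blast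
          ultimately show ?case using elim(2) x by simp
        qed
      qed
      then show ?thesis by simp
    qed
    ultimately show ?thesis by blast
  qed
  have basin_motion: "holomorphic_motion (basin (P l0) m) \<Omega> l0 (\<lambda>l. boettcher_inv (P l) (\<phi> l) m \<circ> \<phi> l0 m)" for m
    by (rule holomorphic_motion_cong[OF motion_basin_sphere]) (use T in simp)
  show ?thesis
  proof (intro exI[of _ ?T] conjI allI ballI impI)
    fix m
    show "holomorphic_motion (basin (P l0) m) \<Omega> l0 (\<lambda>l. boettcher_inv (P l) (\<phi> l) m \<circ> \<phi> l0 m)"
      by (rule basin_motion)
    show "holomorphic_motion (basin (P l0) m \<union> Some ` julia (P l0) m) \<Omega> l0 (\<lambda>l. ?T l m)"
      by (rule motion_closure_sphere)
    show "?T l m x = boettcher_inv (P l) (\<phi> l) m (\<phi> l0 m x)" if "l \<in> \<Omega>" "x \<in> basin (P l0) m" for l x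
      using T[OF that] by simp
    show "?T l m ` (basin (P l0) m \<union> Some ` julia (P l0) m) = basin (P l) m \<union> Some ` julia (P l) m"
      if "l \<in> \<Omega>" for l by (rule image[OF that])
    show "\<exists>q\<in>Some ` julia (P l0) m. ray_lands_at (P l0) (\<phi> l0) \<theta> m q \<and>
          (\<forall>l\<in>\<Omega>. ray_lands_at (P l) (\<phi> l) \<theta> m (?T l m q))" for \<theta> by (rule landing_all)
    show "\<exists>\<theta>. ray_lands_at (P l0) (\<phi> l0) \<theta> m q" if "q \<in> Some ` julia (P l0) m" for q
      by (rule landing_onto[OF that])
  next
    show "conjugating_julia_motion P \<Omega> l0 ?T" by (rule sphere_motion_conjugating)
  next
    fix \<epsilon> \<tau> m l x
    assume "\<epsilon> > 0 \<and> ball l0 \<epsilon> \<subseteq> \<Lambda> \<and> conjugating_julia_motion P (ball l0 \<epsilon>) l0 \<tau>"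
      and "l \<in> connected_component_set (ball l0 \<epsilon> \<inter> \<Omega>) l0" "x \<in> Some ` julia (P l0) m"
    then show "?T l m x = \<tau> l m x" using unique by blast
  next
    fix \<epsilon> \<tau> m \<sigma> l x
    assume "\<epsilon> > 0 \<and> ball l0 \<epsilon> \<subseteq> \<Lambda> \<and> conjugating_julia_motion P (ball l0 \<epsilon>) l0 \<tau>"
      and "holomorphic_motion (Some ` julia (P l0) m) \<Omega> l0 \<sigma> \<and>
               (\<forall>\<^sub>F l in nhds l0. \<forall>x\<in>Some ` julia (P l0) m. \<sigma> l x = \<tau> l m x)"
      and "l \<in> \<Omega>" "x \<in> Some ` julia (P l0) m"
    then show "\<sigma> l x = ?T l m x" using unique by blast
  next
    fix p N m l and \<theta> :: "nat \<Rightarrow> nat \<Rightarrow> real"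
    assume p: "p \<in> julia (P l0) 0 \<and>
       (\<forall>m. exactly_these_rays_meet_at (P l0) (\<phi> l0) m N (\<lambda>i. \<theta> i m) (Some (Q (P l0) 0 m p)))"
      and l: "l \<in> \<Omega>"
    have "Q (P l0) 0 m p \<in> julia (P l0) m" using julia_forward[OF l0] p by simp
    then show "exactly_these_rays_meet_at (P l) (\<phi> l) m N (\<lambda>i. \<theta> i m) (?T l m (Some (Q (P l0) 0 m p)))"
      using meet[OF l] p by blast
  qed
qed

end
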